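(* Let $(T^2\times S^4,\ g:=dx^2\oplus d\theta^2)$ be the Riemannian product of a flat two-torus $(T^2,dx^2)$ and a round four-sphere $(S^4,d\theta^2)$ of constant sectional curvature one. Then $$\mathcal{L}_1(T^2\times S^4,g)=-96\pi^2\,\mathrm{Vol}_{dx^2}(T^2).$$ In particular, $g$ is not conformally Einstein, i.e. there is no smooth function $u$ on $T^2\times S^4$ such that $e^{2u}g$ is Einstein.
   Context: Abstract index notation is used; indices are raised and lowered with $g$, and norms are full contractions (e.g. $\lvert W\rvert^2=W_{ijkl}W^{ijkl}$). $R_{ijkl}$ is the Riemann curvature tensor, with sign such that constant sectional curvature $\mu$ means $R_{ijkl}=\mu(g_{ik}g_{jl}-g_{il}g_{jk})$, and $R_{ij}=R_{isj}{}^s$ is the Ricci tensor. In dimension $n\ge3$: the Schouten tensor is $P_{ij}:=\frac{1}{n-2}(R_{ij}-Jg_{ij})$ with $J:=P_s{}^s$ (equivalently $J=\frac{R}{2(n-1)}$, $R$ the scalar curvature); the Weyl tensor is $W_{ijkl}:=R_{ijkl}-P_{ik}g_{jl}-P_{jl}g_{ik}+P_{il}g_{jk}+P_{jk}g_{il}$; the Cotton tensor is $C_{ijk}:=\nabla_iP_{jk}-\nabla_jP_{ik}$. On a closed six-manifold $\mathcal{L}_1(M,g):=\int_M L_1^g\,\mathrm{dvol}_g$, where, with $\Delta=\nabla^s\nabla_s$, $$L_1:=2\Delta\lvert W\rvert^2-48\nabla^l(W_{ijkl}C^{ijk})+\lvert\nabla W\rvert^2+48P_t{}^sW_{sijk}W^{tijk}-8J\lvert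 W\rvert^2-64\lvert C\rvert^2.$$ A metric is Einstein if $\mathrm{Ric}=\lambda g$ for some constant $\lambda\in\mathbb{R}$. *)

theory Defs
  imports "HOL-Analysis.Analysis"
begin

section \<open>Tensor calculus of a metric in local coordinates\<close>

text \<open>A metric on a coordinate domain is a matrix field \<open>g\<close>, with \<open>g x $ i $ j\<close> the component
  \<open>g\<^sub>i\<^sub>j\<close> at \<open>x\<close>. A tensor field is given by its components with all indices lowered. All
  expressions at \<open>x\<close> depend only on the germ of \<open>g\<close> at \<open>x\<close>, so the values of \<open>g\<close> outside the
  coordinate domain (an open set) are irrelevant.\<close>

definition pd :: "'n::finite \<Rightarrow> (real^'n \<Rightarrow> 'b::real_normed_vector) \<Rightarrow> real^'n \<Rightarrow> 'b" where
  "pd i f x = frechet_derivative f (at x) (axis i 1)"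

primrec Ck_on :: "nat \<Rightarrow> (real^'n::finite) set \<Rightarrow> (real^'n \<Rightarrow> 'b::real_normed_vector) \<Rightarrow> bool" where
  "Ck_on 0 S f = continuous_on S f"
| "Ck_on (Suc k) S f = (f differentiable_on S \<and> (\<forall>i. Ck_on k S (pd i f)))"

definition smooth_on :: "(real^'n::finite) set \<Rightarrow> (real^'n \<Rightarrow> 'b::real_normed_vector) \<Rightarrow> bool" where
  "smooth_on S f \<longleftrightarrow> (\<forall>k. Ck_on k S f)"

type_synonym 'n metric = "real^'n \<Rightarrow> real^'n^'n"

definition ginv :: "'n::finite metric \<Rightarrow> real^'n \<Rightarrow> 'n \<Rightarrow> 'n \<Rightarrow> real" where
  "ginv g x i j = matrix_inv (g x) $ i $ j"

text \<open>\<open>christoffel g x k i j\<close> is \<open>\<Gamma>\<^sup>k\<^sub>i\<^sub>j\<close>.\<close>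

definition christoffel :: "'n::finite metric \<Rightarrow> real^'n \<Rightarrow> 'n \<Rightarrow> 'n \<Rightarrow> 'n \<Rightarrow> real" where
  "christoffel g x k i j = 1/2 * (\<Sum>l\<in>UNIV. ginv g x k l *
     (pd i (\<lambda>y. g y $ j $ l) x + pd j (\<lambda>y. g y $ i $ l) x - pd l (\<lambda>y. g y $ i $ j) x))"

text \<open>In the covariant derivatives the index of differentiation comes first.\<close>

definition cov1 :: "'n::finite metric \<Rightarrow> (real^'n \<Rightarrow> 'n \<Rightarrow> real) \<Rightarrow> real^'n \<Rightarrow> 'n \<Rightarrow> 'n \<Rightarrow> real" where
  "cov1 g T x a i = pd a (\<lambda>y. T y i) x - (\<Sum>m\<in>UNIV. christoffel g x m a i * T x m)"

definition cov2 :: "'n::finite metric \<Rightarrow> (real^'n \<Rightarrow> 'n \<Rightarrow> 'n \<Rightarrow> real) \<Rightarrow>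
    real^'n \<Rightarrow> 'n \<Rightarrow> 'n \<Rightarrow> 'n \<Rightarrow> real" where
  "cov2 g T x a i j = pd a (\<lambda>y. T y i j) x
     - (\<Sum>m\<in>UNIV. christoffel g x m a i * T x m j)
     - (\<Sum>m\<in>UNIV. christoffel g x m a j * T x i m)"

definition cov4 :: "'n::finite metric \<Rightarrow> (real^'n \<Rightarrow> 'n \<Rightarrow> 'n \<Rightarrow> 'n \<Rightarrow> 'n \<Rightarrow> real) \<Rightarrow>
    real^'n \<Rightarrow> 'n \<Rightarrow> 'n \<Rightarrow> 'n \<Rightarrow> 'n \<Rightarrow> 'n \<Rightarrow> real" where
  "cov4 g T x a i j k l = pd a (\<lambda>y. T y i j k l) x
     - (\<Sum>m\<in>UNIV. christoffel g x m a i * T x m j k l)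
     - (\<Sum>m\<in>UNIV. christoffel g x m a j * T x i m k l)
     - (\<Sum>m\<in>UNIV. christoffel g x m a k * T x i j m l)
     - (\<Sum>m\<in>UNIV. christoffel g x m a l * T x i j k m)"

definition divergence :: "'n::finite metric \<Rightarrow> (real^'n \<Rightarrow> 'n \<Rightarrow> real) \<Rightarrow> real^'n \<Rightarrow> real" where
  "divergence g V x = (\<Sum>i\<in>UNIV. \<Sum>j\<in>UNIV. ginv g x i j * cov1 g V x i j)"

definition laplacian :: "'n::finite metric \<Rightarrow> (real^'n \<Rightarrow> real) \<Rightarrow> real^'n \<Rightarrow> real" where
  "laplacian g f = divergence g (\<lambda>x i. pd i f x)"

definition raise3 :: "'n::finite metric \<Rightarrow> real^'n \<Rightarrow> ('n \<Rightarrow> 'n \<Rightarrow> 'n \<Rightarrow> real) \<Rightarrow>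
    'n \<Rightarrow> 'n \<Rightarrow> 'n \<Rightarrow> real" where
  "raise3 g x T i j k = (\<Sum>a\<in>UNIV. \<Sum>b\<in>UNIV. \<Sum>c\<in>UNIV.
     ginv g x i a * ginv g x j b * ginv g x k c * T a b c)"

definition raise4 :: "'n::finite metric \<Rightarrow> real^'n \<Rightarrow> ('n \<Rightarrow> 'n \<Rightarrow> 'n \<Rightarrow> 'n \<Rightarrow> real) \<Rightarrow>
    'n \<Rightarrow> 'n \<Rightarrow> 'n \<Rightarrow> 'n \<Rightarrow> real" where
  "raise4 g x T i j k l = (\<Sum>a\<in>UNIV. \<Sum>b\<in>UNIV. \<Sum>c\<in>UNIV. \<Sum>d\<in>UNIV.
     ginv g x i a * ginv g x j b * ginv g x k c * ginv g x l d * T a b c d)"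

text \<open>The component \<open>R\<^sub>i\<^sub>j\<^sub>k\<^sub>l = g(R(\<partial>\<^sub>i,\<partial>\<^sub>j)\<partial>\<^sub>l, \<partial>\<^sub>k)\<close> with
  \<open>R(X,Y)Z = \<nabla>\<^sub>X\<nabla>\<^sub>Y Z - \<nabla>\<^sub>Y\<nabla>\<^sub>X Z - \<nabla>\<^sub>[\<^sub>X\<^sub>,\<^sub>Y\<^sub>] Z\<close>; constant sectional curvature \<open>\<mu>\<close> then means
  \<open>R\<^sub>i\<^sub>j\<^sub>k\<^sub>l = \<mu> (g\<^sub>i\<^sub>k g\<^sub>j\<^sub>l - g\<^sub>i\<^sub>l g\<^sub>j\<^sub>k)\<close>.\<close>

definition riemann :: "'n::finite metric \<Rightarrow> real^'n \<Rightarrow> 'n \<Rightarrow> 'n \<Rightarrow> 'n \<Rightarrow> 'n \<Rightarrow> real" where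
  "riemann g x i j k l = (\<Sum>m\<in>UNIV. g x $ k $ m *
     (pd i (\<lambda>y. christoffel g y m j l) x - pd j (\<lambda>y. christoffel g y m i l) x
      + (\<Sum>s\<in>UNIV. christoffel g x m i s * christoffel g x s j l
                - christoffel g x m j s * christoffel g x s i l)))"

definition ricci :: "'n::finite metric \<Rightarrow> real^'n \<Rightarrow> 'n \<Rightarrow> 'n \<Rightarrow> real" where
  "ricci g x i j = (\<Sum>s\<in>UNIV. \<Sum>t\<in>UNIV. ginv g x s t * riemann g x i s j t)"

definition scalar_curv :: "'n::finite metric \<Rightarrow> real^'n \<Rightarrow> real" where
  "scalar_curv g x = (\<Sum>i\<in>UNIV. \<Sum>j\<in>UNIV. ginv g x i j * ricci g x i j)"

text \<open>\<open>J\<close> is the trace of the Schouten tensor \<open>P\<close>; since \<open>P\<close> is itself defined by means of \<open>J\<close>, the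
  explicit form \<open>J = R / (2 (n - 1))\<close> is taken as the definition.\<close>

definition schouten_trace :: "'n::finite metric \<Rightarrow> real^'n \<Rightarrow> real" where
  "schouten_trace g x = scalar_curv g x / (2 * (real CARD('n) - 1))"

definition schouten :: "'n::finite metric \<Rightarrow> real^'n \<Rightarrow> 'n \<Rightarrow> 'n \<Rightarrow> real" where
  "schouten g x i j = 1 / (real CARD('n) - 2) * (ricci g x i j - schouten_trace g x * g x $ i $ j)"

definition weyl :: "'n::finite metric \<Rightarrow> real^'n \<Rightarrow> 'n \<Rightarrow> 'n \<Rightarrow> 'n \<Rightarrow> 'n \<Rightarrow> real" where
  "weyl g x i j k l = riemann g x i j k l
     - schouten g x i k * g x $ j $ l - schouten g x j l * g x $ i $ k
     + schouten g x i l * g x $ j $ k + schouten g x j k * g x $ i $ l"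

definition cotton :: "'n::finite metric \<Rightarrow> real^'n \<Rightarrow> 'n \<Rightarrow> 'n \<Rightarrow> 'n \<Rightarrow> real" where
  "cotton g x i j k = cov2 g (schouten g) x i j k - cov2 g (schouten g) x j i k"

definition weyl_norm2 :: "'n::finite metric \<Rightarrow> real^'n \<Rightarrow> real" where
  "weyl_norm2 g x = (\<Sum>i\<in>UNIV. \<Sum>j\<in>UNIV. \<Sum>k\<in>UNIV. \<Sum>l\<in>UNIV.
     weyl g x i j k l * raise4 g x (weyl g x) i j k l)"

definition nabla_weyl_norm2 :: "'n::finite metric \<Rightarrow> real^'n \<Rightarrow> real" where
  "nabla_weyl_norm2 g x = (\<Sum>a\<in>UNIV. \<Sum>b\<in>UNIV. ginv g x a b *
     (\<Sum>i\<in>UNIV. \<Sum>j\<in>UNIV. \<Sum>k\<in>UNIV. \<Sum>l\<in>UNIV.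
        cov4 g (weyl g) x a i j k l * raise4 g x (cov4 g (weyl g) x b) i j k l))"

definition cotton_norm2 :: "'n::finite metric \<Rightarrow> real^'n \<Rightarrow> real" where
  "cotton_norm2 g x = (\<Sum>i\<in>UNIV. \<Sum>j\<in>UNIV. \<Sum>k\<in>UNIV.
     cotton g x i j k * raise3 g x (cotton g x) i j k)"

text \<open>The one-form \<open>W\<^sub>i\<^sub>j\<^sub>k\<^sub>l C\<^sup>i\<^sup>j\<^sup>k\<close> with free index \<open>l\<close>.\<close>

definition weyl_cotton :: "'n::finite metric \<Rightarrow> real^'n \<Rightarrow> 'n \<Rightarrow> real" where
  "weyl_cotton g x l = (\<Sum>i\<in>UNIV. \<Sum>j\<in>UNIV. \<Sum>k\<in>UNIV.
     weyl g x i j k l * raise3 g x (cotton g x) i j k)"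

text \<open>The contraction \<open>P\<^sub>t\<^sup>s W\<^sub>s\<^sub>i\<^sub>j\<^sub>k W\<^sup>t\<^sup>i\<^sup>j\<^sup>k\<close>.\<close>

definition schouten_weyl_weyl :: "'n::finite metric \<Rightarrow> real^'n \<Rightarrow> real" where
  "schouten_weyl_weyl g x = (\<Sum>t\<in>UNIV. \<Sum>s\<in>UNIV.
     (\<Sum>u\<in>UNIV. schouten g x t u * ginv g x u s) *
     (\<Sum>i\<in>UNIV. \<Sum>j\<in>UNIV. \<Sum>k\<in>UNIV. weyl g x s i j k * raise4 g x (weyl g x) t i j k))"

definition L1_coord :: "'n::finite metric \<Rightarrow> real^'n \<Rightarrow> real" where
  "L1_coord g x = 2 * laplacian g (weyl_norm2 g) x - 48 * divergence g (weyl_cotton g) x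
     + nabla_weyl_norm2 g x + 48 * schouten_weyl_weyl g x
     - 8 * schouten_trace g x * weyl_norm2 g x - 64 * cotton_norm2 g x"

section \<open>Riemannian manifolds\<close>

text \<open>A manifold modelled on \<open>real^'n\<close> is given by its set of points and an indexed family of
  local parametrizations: for each index \<open>\<alpha>\<close>, an injective map \<open>par M \<alpha>\<close> from the open set
  \<open>pdom M \<alpha>\<close> of \<open>real^'n\<close> into the points, the images covering. The inverses of the
  parametrizations are the coordinate charts; the topology, smooth structure and Borel sets are the
  ones they induce. The metric is given by its matrix field \<open>met M \<alpha>\<close> in each chart. Values of
  \<open>par M \<alpha>\<close> and \<open>met M \<alpha>\<close> outside \<open>pdom M \<alpha>\<close> carry no meaning.\<close>

record ('a, 'n::finite, 'i) riem_mfd =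
  points :: "'a set"
  charts :: "'i set"
  pdom :: "'i \<Rightarrow> (real^'n) set"
  par :: "'i \<Rightarrow> real^'n \<Rightarrow> 'a"
  met :: "'i \<Rightarrow> real^'n \<Rightarrow> real^'n^'n"

definition smooth_function :: "('a, 'n::finite, 'i) riem_mfd \<Rightarrow> ('a \<Rightarrow> real) \<Rightarrow> bool" where
  "smooth_function M u \<longleftrightarrow> (\<forall>\<alpha>\<in>charts M. smooth_on (pdom M \<alpha>) (u \<circ> par M \<alpha>))"

definition einstein :: "('a, 'n::finite, 'i) riem_mfd \<Rightarrow> bool" where
  "einstein M \<longleftrightarrow> (\<exists>c::real. \<forall>\<alpha>\<in>charts M. \<forall>x\<in>pdom M \<alpha>. \<forall>i j.
     ricci (met M \<alpha>) x i j = c * met M \<alpha> x $ i $ j)"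

text \<open>The manifold \<open>M\<close> with the metric \<open>g\<close> replaced by \<open>e\<^sup>2\<^sup>u g\<close>.\<close>

definition conformal_change ::
    "('a \<Rightarrow> real) \<Rightarrow> ('a, 'n::finite, 'i) riem_mfd \<Rightarrow> ('a, 'n, 'i) riem_mfd" where
  "conformal_change u M = M\<lparr>met := (\<lambda>\<alpha> x. exp (2 * u (par M \<alpha> x)) *\<^sub>R met M \<alpha> x)\<rparr>"

definition conformally_einstein :: "('a, 'n::finite, 'i) riem_mfd \<Rightarrow> bool" where
  "conformally_einstein M \<longleftrightarrow> (\<exists>u. smooth_function M u \<and> einstein (conformal_change u M))"

definition chart_preimage :: "('a, 'n::finite, 'i) riem_mfd \<Rightarrow> 'i \<Rightarrow> 'a set \<Rightarrow> (real^'n) set" where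
  "chart_preimage M \<alpha> B = {x \<in> pdom M \<alpha>. par M \<alpha> x \<in> B}"

definition borel_sets :: "('a, 'n::finite, 'i) riem_mfd \<Rightarrow> 'a set set" where
  "borel_sets M = {B. B \<subseteq> points M \<and> (\<forall>\<alpha>\<in>charts M. chart_preimage M \<alpha> B \<in> sets borel)}"

text \<open>The Riemannian volume measure is the unique Borel measure on \<open>M\<close> that in every chart is
  \<open>sqrt (det g)\<close> times Lebesgue measure.\<close>

definition volume_measure :: "('a, 'n::finite, 'i) riem_mfd \<Rightarrow> 'a measure" where
  "volume_measure M = (THE \<mu>. space \<mu> = points M \<and> sets \<mu> = borel_sets M \<and>
     (\<forall>\<alpha>\<in>charts M. \<forall>B\<in>borel_sets M. B \<subseteq> par M \<alpha> ` pdom M \<alpha> \<longrightarrow>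
        emeasure \<mu> B =
          (\<integral>\<^sup>+x\<in>chart_preimage M \<alpha> B. ennreal (sqrt (det (met M \<alpha> x))) \<partial>lborel)))"

definition riem_volume :: "('a, 'n::finite, 'i) riem_mfd \<Rightarrow> real" where
  "riem_volume M = measure (volume_measure M) (points M)"

text \<open>The scalar \<open>L\<^sub>1\<close> at a point is its value there in any chart around the point.\<close>

definition L1 :: "('a, 'n::finite, 'i) riem_mfd \<Rightarrow> 'a \<Rightarrow> real" where
  "L1 M p = (THE r. \<forall>\<alpha>\<in>charts M. \<forall>x\<in>pdom M \<alpha>. par M \<alpha> x = p \<longrightarrow> r = L1_coord (met M \<alpha>) x)"

text \<open>The invariant of interest when \<open>M\<close> is closed of dimension six.\<close>

definition total_L1 :: "('a, 'n::finite, 'i) riem_mfd \<Rightarrow> real" where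
  "total_L1 M = (\<integral>p. L1 M p \<partial>volume_measure M)"

section \<open>The product of a flat torus and a round sphere\<close>

text \<open>The Riemannian product: coordinates on the product are indexed by the disjoint sum of the
  index types, so that the dimensions add up, and the metric is block diagonal.\<close>

definition fst_coords :: "real^('m::finite + 'n::finite) \<Rightarrow> real^'m" where
  "fst_coords x = (\<chi> a. x $ Inl a)"

definition snd_coords :: "real^('m::finite + 'n::finite) \<Rightarrow> real^'n" where
  "snd_coords x = (\<chi> b. x $ Inr b)"

definition block_diag :: "real^'m^'m \<Rightarrow> real^'n^'n \<Rightarrow> real^('m::finite + 'n::finite)^('m + 'n)" where
  "block_diag A B = (\<chi> i j. case (i, j) of
       (Inl a, Inl b) \<Rightarrow> A $ a $ b
     | (Inr a, Inr b) \<Rightarrow> B $ a $ b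
     | _ \<Rightarrow> 0)"

definition riem_product :: "('a, 'm::finite, 'i) riem_mfd \<Rightarrow> ('b, 'n::finite, 'j) riem_mfd \<Rightarrow>
    ('a \<times> 'b, 'm + 'n, 'i \<times> 'j) riem_mfd" where
  "riem_product M N = \<lparr>
     points = points M \<times> points N,
     charts = charts M \<times> charts N,
     pdom = (\<lambda>(\<alpha>, \<beta>). {x. fst_coords x \<in> pdom M \<alpha> \<and> snd_coords x \<in> pdom N \<beta>}),
     par = (\<lambda>(\<alpha>, \<beta>) x. (par M \<alpha> (fst_coords x), par N \<beta> (snd_coords x))),
     met = (\<lambda>(\<alpha>, \<beta>) x. block_diag (met M \<alpha> (fst_coords x)) (met N \<beta> (snd_coords x)))\<rparr>"

text \<open>A flat two-torus is the quotient of the Euclidean plane by a lattice \<open>\<int>v + \<int>w\<close>, where \<open>v\<close>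
  and \<open>w\<close> are linearly independent; its points are the cosets. Every open set on which the quotient
  map is injective gives a local parametrization, in which the metric is Euclidean.\<close>

definition torus_lattice :: "real^2 \<Rightarrow> real^2 \<Rightarrow> (real^2) set" where
  "torus_lattice v w = {of_int m *\<^sub>R v + of_int n *\<^sub>R w | m n. True}"

definition torus_proj :: "real^2 \<Rightarrow> real^2 \<Rightarrow> real^2 \<Rightarrow> (real^2) set" where
  "torus_proj v w x = (\<lambda>l. x + l) ` torus_lattice v w"

definition flat_torus :: "real^2 \<Rightarrow> real^2 \<Rightarrow> ((real^2) set, 2, (real^2) set) riem_mfd" where
  "flat_torus v w = \<lparr>
     points = range (torus_proj v w),
     charts = {V. open V \<and> inj_on (torus_proj v w) V},
     pdom = (\<lambda>V. V),
     par = (\<lambda>V. torus_proj v w),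
     met = (\<lambda>V x. mat 1)\<rparr>"

text \<open>The round sphere of curvature one is the unit sphere in \<open>(real^'n) \<times> real\<close>, a Euclidean space of
  dimension \<open>CARD('n) + 1\<close>, with the induced metric. The two parametrizations are the inverses of the
  stereographic projections from \<open>(0, 1)\<close> and \<open>(0, -1)\<close>.\<close>

definition stereo_inv :: "real \<Rightarrow> real^'n::finite \<Rightarrow> (real^'n) \<times> real" where
  "stereo_inv s y = ((2 / (1 + (norm y)\<^sup>2)) *\<^sub>R y, s * (((norm y)\<^sup>2 - 1) / (1 + (norm y)\<^sup>2)))"

definition round_sphere :: "((real^'n) \<times> real, 'n::finite, real) riem_mfd" where
  "round_sphere = \<lparr>
     points = sphere 0 1,
     charts = {1, -1},
     pdom = (\<lambda>s. UNIV),
     par = stereo_inv,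
     met = (\<lambda>s y. \<chi> i j. pd i (stereo_inv s) y \<bullet> pd j (stereo_inv s) y)\<rparr>"

definition round_S4 :: "((real^4) \<times> real, 4, real) riem_mfd" where
  "round_S4 = round_sphere"

end

theory Submission
  imports Defs
begin

text \<open>
  The two assertions have independent proofs. Both compute in one family of coordinates: Euclidean
  coordinates on the torus together with a stereographic projection of the sphere. There the metric is
  diagonal with entries \<open>exp (2 F\<^sub>i)\<close>, where \<open>F\<^sub>i = 0\<close> in the torus directions and
  \<open>F\<^sub>i = f = ln (2 / (1 + |y|\<^sup>2))\<close> in the sphere directions. This expression is the
  same in all charts and makes sense on all of \<open>\<real>\<^sup>6\<close>, where each local formula is proved once.

  \<^emph>\<open>The value.\<close> The curvature is that of the sphere factor alone (\<open>riemann_model\<close>). Hence \<open>J = 6/5\<close>,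
  the Schouten tensor is \<open>-3/10\<close> times the torus metric plus \<open>9/20\<close> times the sphere metric, and the
  Weyl tensor has sectional values \<open>3/5\<close>, \<open>1/10\<close> and \<open>-3/20\<close> on torus planes, sphere planes and mixed
  planes. Both tensors are built from the two parallel block metrics, so \<open>C\<close>, \<open>\<nabla>W\<close> and the
  divergence terms vanish, and at every point
  \<open>L\<^sub>1 = 48 \<sqdot> (-27/100) - 8 \<sqdot> (6/5) \<sqdot> (12/5) = -36\<close> (\<open>L1_coord_model\<close>). It remains to know that the volume of
  the product is \<open>8\<pi>\<^sup>2/3\<close> times the area of the torus (\<open>volume_product\<close>). As the volume measure is
  described by its values in all charts, this comprises its existence. It is constructed as the image
  of the density of one chart on (fundamental cell of the lattice) \<open>\<times> \<real>\<^sup>4\<close>; that it has the right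
  values in every other chart rests on two invariances: sets that meet the same cosets of the lattice, each
  once, have equal area (\<open>emeasure_fundamental_domains\<close>), and the spherical density is preserved by
  the inversion \<open>y \<mapsto> y/|y|\<^sup>2\<close>, which is the change between the two stereographic charts
  (\<open>sphere_density_inversion_invariant\<close>). Uniqueness follows from a countable atlas
  (\<open>volume_measure_unique\<close>).

  \<^emph>\<open>No conformal Einstein metric.\<close> Suppose that \<open>e\<^sup>2\<^sup>u g\<close> is Einstein. The components of its
  Ricci tensor that mix torus and sphere directions vanish, which says that the mixed second
  derivatives of \<open>e\<^sup>-\<^sup>u\<close> vanish. Thus \<open>e\<^sup>-\<^sup>u = A + B\<close> with \<open>A\<close> a function on the torus and \<open>B\<close> one on
  the sphere (\<open>einstein_separable\<close>). Take a point where \<open>A\<close> is maximal and \<open>B\<close> is minimal. There \<open>u\<close> is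
  critical, minimal along the torus and maximal along the sphere. But at a critical point of \<open>u\<close> the
  traces of the Einstein equation over the two factors give \<open>\<Delta>\<^sub>S u = 3 + 2 \<Delta>\<^sub>T u\<close>, whereas \<open>\<Delta>\<^sub>S u \<le> 0 \<le> \<Delta>\<^sub>T u\<close> (\<open>einstein_no_saddle\<close>).
\<close>

section \<open>Curvature of diagonal metrics\<close>

lemma pd_eqI: "(f has_derivative D) (at x) \<Longrightarrow> pd i f x = D (axis i 1)"
  unfolding pd_def using frechet_derivative_at by metis

lemma differentiable_has_derivative:
  "f differentiable at x \<Longrightarrow> (f has_derivative frechet_derivative f (at x)) (at x)"
  by (simp add: frechet_derivative_works)

lemma pd_const [simp]: "pd i (\<lambda>y. c) x = 0"
  by (rule pd_eqI[THEN trans]) (rule has_derivative_const, simp)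

lemma pd_add:
  assumes "f differentiable at x" "g differentiable at x"
  shows "pd i (\<lambda>y. f y + g y) x = pd i f x + pd i g x"
  using pd_eqI[OF has_derivative_add[OF assms[THEN differentiable_has_derivative]]] by (simp add: pd_def)

lemma pd_diff:
  assumes "f differentiable at x" "g differentiable at x"
  shows "pd i (\<lambda>y. f y - g y) x = pd i f x - pd i g x"
  using pd_eqI[OF has_derivative_diff[OF assms[THEN differentiable_has_derivative]]] by (simp add: pd_def)

lemma pd_minus:
  assumes "f differentiable at x"
  shows "pd i (\<lambda>y. - f y) x = - pd i f x"
  using pd_eqI[OF has_derivative_minus[OF assms[THEN differentiable_has_derivative]]] by (simp add: pd_def)

lemma pd_mult:
  fixes f g :: "real^'n::finite \<Rightarrow> real"
  assumes "f differentiable at x" "g differentiable at x"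
  shows "pd i (\<lambda>y. f y * g y) x = f x * pd i g x + pd i f x * g x"
  using pd_eqI[OF has_derivative_mult[OF assms[THEN differentiable_has_derivative]]] by (simp add: pd_def)

lemma pd_cmult:
  fixes f :: "real^'n::finite \<Rightarrow> real"
  assumes "f differentiable at x"
  shows "pd i (\<lambda>y. c * f y) x = c * pd i f x"
  using pd_mult[of "\<lambda>y. c" x f i] assms by simp

lemma differentiable_exp_comp:
  fixes f :: "real^'n::finite \<Rightarrow> real"
  assumes "f differentiable at x"
  shows "(\<lambda>y. exp (f y)) differentiable at x"
  using differentiable_chain_at[of f x exp] assms
  by (auto simp: o_def intro: field_differentiable_imp_differentiable field_differentiable_within_exp)

lemma pd_exp:
  fixes f :: "real^'n::finite \<Rightarrow> real"
  assumes "f differentiable at x"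
  shows "pd i (\<lambda>y. exp (f y)) x = exp (f x) * pd i f x"
proof -
  have "((\<lambda>y. exp (f y)) has_derivative (\<lambda>h. exp (f x) * frechet_derivative f (at x) h)) (at x)"
    using assms[THEN differentiable_has_derivative] by (auto intro!: derivative_eq_intros)
  from pd_eqI[OF this] show ?thesis by (simp add: pd_def)
qed

text \<open>Exponents rather than entries: the Christoffel symbols are polynomials in the first
  derivatives of the exponents and the ratios of the entries, and a conformal change adds one function to all of them.\<close>

definition diag_metric :: "('n::finite \<Rightarrow> real^'n \<Rightarrow> real) \<Rightarrow> 'n metric" where
  "diag_metric F x = (\<chi> i j. if i = j then exp (2 * F i x) else 0)"

lemma diag_metric_nth [simp]: "diag_metric F x $ i $ j = (if i = j then exp (2 * F i x) else 0)"
  by (simp add: diag_metric_def)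

lemma ginv_diag: "ginv (diag_metric F) x i j = (if i = j then exp (- 2 * F i x) else 0)"
proof -
  let ?A = "diag_metric F x" and ?B = "(\<chi> i j. if i = j then exp (- 2 * F i x) else 0) :: real^'a^'a"
  have AB: "?A ** ?B = mat 1" "?B ** ?A = mat 1"
    by (simp_all add: vec_eq_iff matrix_matrix_mult_def mat_def mult_delta_left mult_delta_right
        flip: exp_add)
  then have "?A ** matrix_inv ?A = mat 1 \<and> matrix_inv ?A ** ?A = mat 1"
    unfolding matrix_inv_def by (rule_tac someI_ex) blast
  then have I: "?A ** matrix_inv ?A = mat 1" by (rule conjunct1)
  have "matrix_inv ?A = (?B ** ?A) ** matrix_inv ?A" by (simp only: AB matrix_mul_lid)
  also have "\<dots> = ?B ** (?A ** matrix_inv ?A)" by (rule matrix_mul_assoc[symmetric])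
  also have "\<dots> = ?B" by (simp only: I matrix_mul_rid)
  finally have "matrix_inv ?A = ?B" .
  then show ?thesis by (simp add: ginv_def)
qed

lemma pd_diag_metric:
  assumes "F i differentiable at x"
  shows "pd a (\<lambda>y. diag_metric F y $ i $ j) x = (if i = j then 2 * exp (2 * F i x) * pd a (F i) x else 0)"
  using assms by (auto simp: pd_exp pd_cmult)

lemma christoffel_diag:
  fixes F :: "'n::finite \<Rightarrow> real^'n \<Rightarrow> real"
  assumes "\<And>i. F i differentiable at x"
  shows "christoffel (diag_metric F) x k i j =
     (if k = i then pd j (F i) x else 0) + (if k = j then pd i (F j) x else 0)
     - (if i = j then exp (2 * F i x - 2 * F k x) * pd k (F i) x else 0)"
proof -
  have "christoffel (diag_metric F) x k i j = 1/2 * exp (- 2 * F k x) *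
     (pd i (\<lambda>y. diag_metric F y $ j $ k) x + pd j (\<lambda>y. diag_metric F y $ i $ k) x
      - pd k (\<lambda>y. diag_metric F y $ i $ j) x)"
    unfolding christoffel_def ginv_diag by (simp add: mult_delta_left del: diag_metric_nth)
  also have "\<dots> = (if k = i then pd j (F i) x else 0) + (if k = j then pd i (F j) x else 0)
     - (if i = j then exp (2 * F i x - 2 * F k x) * pd k (F i) x else 0)"
    unfolding pd_diag_metric[OF assms]
    by (auto simp: exp_diff exp_minus field_simps)
  finally show ?thesis .
qed

lemma pd_christoffel_diag:
  fixes F :: "'n::finite \<Rightarrow> real^'n \<Rightarrow> real"
  assumes F: "\<And>i x. F i differentiable at x" and F2: "\<And>i k x. pd k (F i) differentiable at x"
  shows "pd a (\<lambda>y. christoffel (diag_metric F) y k i j) x =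
     (if k = i then pd a (pd j (F i)) x else 0) + (if k = j then pd a (pd i (F j)) x else 0)
     - (if i = j then exp (2 * F i x - 2 * F k x) *
          (pd a (pd k (F i)) x + 2 * (pd a (F i) x - pd a (F k) x) * pd k (F i) x) else 0)"
proof -
  have e: "pd a (\<lambda>y. exp (2 * F i y - 2 * F k y) * pd k (F i) y) x = exp (2 * F i x - 2 * F k x) *
          (pd a (pd k (F i)) x + 2 * (pd a (F i) x - pd a (F k) x) * pd k (F i) x)"
    using F F2 by (subst pd_mult)
      (auto intro!: differentiable_exp_comp simp: pd_exp pd_diff pd_cmult, simp add: algebra_simps)
  have d: "(\<lambda>y. exp (2 * F i y - 2 * F k y) * pd k (F i) y) differentiable at x"
    by (intro differentiable_mult differentiable_exp_comp differentiable_diff differentiable_const F F2)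
  have d1: "(\<lambda>y. if k = i then pd j (F i) y else 0) differentiable at x"
    by (cases "k = i") (simp_all add: F2)
  have d2: "(\<lambda>y. if k = j then pd i (F j) y else 0) differentiable at x"
    by (cases "k = j") (simp_all add: F2)
  have d3: "(\<lambda>y. if i = j then exp (2 * F i y - 2 * F k y) * pd k (F i) y else 0) differentiable at x"
    by (cases "i = j") (use d in auto)
  have "pd a (\<lambda>y. christoffel (diag_metric F) y k i j) x =
    pd a (\<lambda>y. (if k = i then pd j (F i) y else 0) + (if k = j then pd i (F j) y else 0)
     - (if i = j then exp (2 * F i y - 2 * F k y) * pd k (F i) y else 0)) x"
    by (simp add: christoffel_diag F)
  also have "\<dots> = pd a (\<lambda>y. (if k = i then pd j (F i) y else 0)) x + pd a (\<lambda>y. (if k = j then pd i (F j) y else 0)) x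
     - pd a (\<lambda>y. (if i = j then exp (2 * F i y - 2 * F k y) * pd k (F i) y else 0)) x"
    by (simp only: pd_diff[OF differentiable_add[OF d1 d2] d3] pd_add[OF d1 d2])
  also have "\<dots> = (if k = i then pd a (pd j (F i)) x else 0) + (if k = j then pd a (pd i (F j)) x else 0)
     - (if i = j then exp (2 * F i x - 2 * F k x) *
          (pd a (pd k (F i)) x + 2 * (pd a (F i) x - pd a (F k) x) * pd k (F i) x) else 0)"
    using e by auto
  finally show ?thesis .
qed

lemma riemann_diag_sum:
  "riemann (diag_metric F) x i j k l = exp (2 * F k x) *
     (pd i (\<lambda>y. christoffel (diag_metric F) y k j l) x - pd j (\<lambda>y. christoffel (diag_metric F) y k i l) x
      + (\<Sum>s\<in>UNIV. christoffel (diag_metric F) x k i s * christoffel (diag_metric F) x s j l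
                - christoffel (diag_metric F) x k j s * christoffel (diag_metric F) x s i l))"
  unfolding riemann_def by (simp add: mult_delta_left)

lemma ricci_diag_sum:
  "ricci (diag_metric F) x i j = (\<Sum>s\<in>UNIV. exp (- 2 * F s x) * riemann (diag_metric F) x i s j s)"
  unfolding ricci_def ginv_diag by (simp add: mult_delta_left)

lemma riemann_diag_self: "riemann (diag_metric F) x i i k l = 0"
  by (simp add: riemann_diag_sum)

lemma sum_two_points:
  fixes f :: "'n::finite \<Rightarrow> real"
  assumes "i \<noteq> j" "\<And>s. s \<noteq> i \<Longrightarrow> s \<noteq> j \<Longrightarrow> f s = 0"
  shows "sum f UNIV = f i + f j"
proof -
  have "sum f UNIV = sum f {i, j}"
    by (rule sum.mono_neutral_right) (use assms in auto)
  then show ?thesis using assms by simp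
qed

text \<open>Of the sums over \<open>m\<close> in the curvature only the terms with \<open>m \<in> {i, j}\<close> and \<open>m \<in> {s, j}\<close> survive, because
  a Christoffel symbol of a diagonal metric vanishes when its three indices are distinct. These are the
  components that enter an off-diagonal entry of the Ricci tensor.\<close>

lemma riemann_diag_mixed:
  fixes F :: "'n::finite \<Rightarrow> real^'n \<Rightarrow> real"
  assumes F: "\<And>i x. F i differentiable at x" and F2: "\<And>i k x. pd k (F i) differentiable at x"
    and neq: "i \<noteq> j" "s \<noteq> i" "s \<noteq> j"
  shows "riemann (diag_metric F) x i s j s = exp (2 * F s x) *
     (- pd i (pd j (F s)) x - pd i (F s) x * pd j (F s) x
       + pd i (F j) x * pd j (F s) x + pd j (F i) x * pd i (F s) x)"
proof -
  let ?\<Gamma> = "christoffel (diag_metric F) x"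
  have "(\<Sum>m\<in>UNIV. ?\<Gamma> j i m * ?\<Gamma> m s s - ?\<Gamma> j s m * ?\<Gamma> m i s)
     = (\<Sum>m\<in>UNIV. ?\<Gamma> j i m * ?\<Gamma> m s s) - (\<Sum>m\<in>UNIV. ?\<Gamma> j s m * ?\<Gamma> m i s)"
    by (rule sum_subtractf)
  also have "(\<Sum>m\<in>UNIV. ?\<Gamma> j i m * ?\<Gamma> m s s) = ?\<Gamma> j i i * ?\<Gamma> i s s + ?\<Gamma> j i j * ?\<Gamma> j s s"
    by (rule sum_two_points) (use neq in \<open>auto simp: christoffel_diag F\<close>)
  also have "(\<Sum>m\<in>UNIV. ?\<Gamma> j s m * ?\<Gamma> m i s) = ?\<Gamma> j s s * ?\<Gamma> s i s + ?\<Gamma> j s j * ?\<Gamma> j i s"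
    by (rule sum_two_points) (use neq in \<open>auto simp: christoffel_diag F\<close>)
  finally show ?thesis
    unfolding riemann_diag_sum pd_christoffel_diag[OF F F2] using neq
    by (simp add: christoffel_diag F exp_diff exp_minus divide_simps) (simp add: algebra_simps)
qed

text \<open>The curvature is antisymmetric in its last two indices, so both sides are \<open>0\<close> for a twice
  continuously differentiable exponent. Here the second derivatives merely
  exist, and the commutator is kept until the Einstein equation forces it to vanish.\<close>

lemma riemann_diag_degenerate:
  fixes F :: "'n::finite \<Rightarrow> real^'n \<Rightarrow> real"
  assumes F: "\<And>i x. F i differentiable at x" and F2: "\<And>i k x. pd k (F i) differentiable at x"
    and neq: "i \<noteq> j"
  shows "riemann (diag_metric F) x i j j j = exp (2 * F j x) *
     (pd i (pd j (F j)) x - pd j (pd i (F j)) x)"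
proof -
  let ?\<Gamma> = "christoffel (diag_metric F) x"
  have "(\<Sum>m\<in>UNIV. ?\<Gamma> j i m * ?\<Gamma> m j j - ?\<Gamma> j j m * ?\<Gamma> m i j)
     = (?\<Gamma> j i i * ?\<Gamma> i j j - ?\<Gamma> j j i * ?\<Gamma> i i j) + (?\<Gamma> j i j * ?\<Gamma> j j j - ?\<Gamma> j j j * ?\<Gamma> j i j)"
    by (rule sum_two_points) (use neq in \<open>auto simp: christoffel_diag F\<close>)
  then show ?thesis
    unfolding riemann_diag_sum pd_christoffel_diag[OF F F2] using neq
    by (simp add: christoffel_diag F exp_diff exp_minus divide_simps)
qed

text \<open>The sectional curvatures determine the diagonal of the Ricci tensor.\<close>

lemma riemann_diag_sectional:
  fixes F :: "'n::finite \<Rightarrow> real^'n \<Rightarrow> real"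
  assumes F: "\<And>i x. F i differentiable at x" and F2: "\<And>i k x. pd k (F i) differentiable at x"
    and neq: "i \<noteq> s"
  shows "riemann (diag_metric F) x i s i s =
     - exp (2 * F s x) * (pd i (pd i (F s)) x + (pd i (F s) x)\<^sup>2 - pd i (F i) x * pd i (F s) x)
     - exp (2 * F i x) * (pd s (pd s (F i)) x + (pd s (F i) x)\<^sup>2 - pd s (F i) x * pd s (F s) x)
     - exp (2 * F i x + 2 * F s x) *
         (\<Sum>m\<in>UNIV - {i, s}. exp (- 2 * F m x) * pd m (F i) x * pd m (F s) x)"
proof -
  let ?\<Gamma> = "christoffel (diag_metric F) x"
  have 1: "(\<Sum>m\<in>UNIV. ?\<Gamma> i s m * ?\<Gamma> m i s) = ?\<Gamma> i s i * ?\<Gamma> i i s + ?\<Gamma> i s s * ?\<Gamma> s i s"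
    by (rule sum_two_points) (use neq in \<open>auto simp: christoffel_diag F\<close>)
  have "(\<Sum>m\<in>UNIV. ?\<Gamma> i i m * ?\<Gamma> m s s) = ?\<Gamma> i i i * ?\<Gamma> i s s + ?\<Gamma> i i s * ?\<Gamma> s s s
     + (\<Sum>m\<in>UNIV - {i, s}. ?\<Gamma> i i m * ?\<Gamma> m s s)"
    using neq sum.subset_diff[of "{i, s}" UNIV "\<lambda>m. ?\<Gamma> i i m * ?\<Gamma> m s s"] by simp
  also have "(\<Sum>m\<in>UNIV - {i, s}. ?\<Gamma> i i m * ?\<Gamma> m s s) =
    (\<Sum>m\<in>UNIV - {i, s}. - exp (2 * F s x) * (exp (- 2 * F m x) * pd m (F i) x * pd m (F s) x))"
    by (rule sum.cong) (use neq in \<open>auto simp: christoffel_diag F exp_diff exp_minus divide_simps\<close>)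
  finally have 2: "(\<Sum>m\<in>UNIV. ?\<Gamma> i i m * ?\<Gamma> m s s) = ?\<Gamma> i i i * ?\<Gamma> i s s + ?\<Gamma> i i s * ?\<Gamma> s s s
     - exp (2 * F s x) * (\<Sum>m\<in>UNIV - {i, s}. exp (- 2 * F m x) * pd m (F i) x * pd m (F s) x)"
    by (simp add: sum_distrib_left sum_negf)
  show ?thesis
    unfolding riemann_diag_sum pd_christoffel_diag[OF F F2] sum_subtractf 1 2 using neq
    by (simp add: christoffel_diag F exp_diff exp_add exp_minus divide_simps)
      (simp add: algebra_simps power2_eq_square)
qed

section \<open>The product metric in coordinates\<close>

text \<open>The weight is \<open>0\<close> in torus directions and \<open>1\<close> in sphere directions, so that one formula with
  coefficients \<open>sph i\<close> covers both factors and their interaction.\<close>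

definition sph :: "'m::finite + 'n::finite \<Rightarrow> real" where
  "sph i = (case i of Inl _ \<Rightarrow> 0 | Inr _ \<Rightarrow> 1)"

lemma sph_simps [simp]: "sph (Inl a) = 0" "sph (Inr b) = 1"
  by (simp_all add: sph_def)

lemma sph_cases: "sph i = 0 \<or> sph i = 1"
  by (cases i) auto

lemma sph_idem [simp]: "sph i * sph i = sph i" "sph i * (sph i * r) = sph i * r"
  using sph_cases[of i] by auto

text \<open>The stereographic metric is \<open>exp (2 f)\<close> times the Euclidean one for this \<open>f\<close>.\<close>

definition conf_log :: "real^('m::finite + 'n::finite) \<Rightarrow> real" where
  "conf_log x = ln (2 / (1 + (norm (snd_coords x))\<^sup>2))"

lemma exp_conf_log: "exp (conf_log x) = 2 / (1 + (norm (snd_coords x))\<^sup>2)"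
  unfolding conf_log_def by (rule exp_ln) (simp add: add_pos_nonneg)

lemma linear_snd_coords: "linear (snd_coords :: real^('m::finite + 'n::finite) \<Rightarrow> _)"
  by (rule linearI) (simp_all add: snd_coords_def vec_eq_iff)

lemma linear_fst_coords: "linear (fst_coords :: real^('m::finite + 'n::finite) \<Rightarrow> _)"
  by (rule linearI) (simp_all add: fst_coords_def vec_eq_iff)

lemmas has_derivative_snd_coords =
  bounded_linear.has_derivative[OF linear_conv_bounded_linear[THEN iffD1, OF linear_snd_coords]]

lemma snd_coords_inner_axis:
  fixes x :: "real^('a::finite + 'b::finite)"
  shows "snd_coords x \<bullet> snd_coords (axis k 1) = sph k * x $ k"
proof (cases k)
  case (Inl a)
  then have "snd_coords (axis k 1 :: real^('a + 'b)) = 0"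
    by (simp add: snd_coords_def vec_eq_iff axis_def)
  then show ?thesis using Inl by simp
next
  case (Inr b)
  then have "snd_coords (axis k 1 :: real^('a + 'b)) = axis b 1"
    by (simp add: snd_coords_def vec_eq_iff axis_def)
  then show ?thesis using Inr by (simp add: inner_axis snd_coords_def)
qed

lemma conf_log_has_derivative:
  fixes x :: "real^('a::finite + 'b::finite)"
  shows "(conf_log has_derivative (\<lambda>h. - exp (conf_log x) * (snd_coords x \<bullet> snd_coords h))) (at x)"
proof -
  have p: "1 + norm (snd_coords y) ^ 2 > 0" for y :: "real^('a + 'b)"
    by (simp add: add_pos_nonneg)
  have "conf_log = (\<lambda>y :: real^('a + 'b). ln 2 - ln (1 + snd_coords y \<bullet> snd_coords y))"
    using p by (simp add: conf_log_def ln_div less_imp_neq[OF p, symmetric] fun_eq_iff flip: power2_norm_eq_inner)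
  moreover have "((\<lambda>y :: real^('a + 'b). ln 2 - ln (1 + snd_coords y \<bullet> snd_coords y)) has_derivative
      (\<lambda>h. - exp (conf_log x) * (snd_coords x \<bullet> snd_coords h))) (at x)"
    using p[of x]
    by (auto intro!: derivative_eq_intros has_derivative_snd_coords
        simp: exp_conf_log power2_norm_eq_inner inner_commute field_simps)
  ultimately show ?thesis by simp
qed

lemma conf_log_differentiable [simp]: "conf_log differentiable at x"
  using conf_log_has_derivative differentiable_def by blast

lemma pd_conf_log: "pd k conf_log x = - (sph k * (x $ k * exp (conf_log x)))"
  by (simp add: pd_eqI[OF conf_log_has_derivative] snd_coords_inner_axis)

lemma sph_pd_conf_log [simp]: "sph k * pd k conf_log x = pd k conf_log x"
  by (simp add: pd_conf_log)

lemma nth_has_derivative: "((\<lambda>y. y $ k) has_derivative (\<lambda>h. h $ k)) (at x)"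
  by (rule bounded_linear.has_derivative[OF bounded_linear_vec_nth has_derivative_ident])

lemma nth_differentiable [simp]: "(\<lambda>y. y $ k :: real) differentiable at x"
  using nth_has_derivative differentiable_def by blast

lemma pd_nth: "pd l (\<lambda>y. y $ k) x = (if k = l then 1 else 0 :: real)"
  by (simp add: pd_eqI[OF nth_has_derivative] axis_def)

lemma pd_conf_log_differentiable [simp]: "pd k conf_log differentiable at x"
  unfolding pd_conf_log[abs_def]
  by (intro differentiable_minus differentiable_mult differentiable_exp_comp differentiable_const
      nth_differentiable conf_log_differentiable)

text \<open>The conformal factor of the sphere satisfies the Riccati type equation
  \<open>\<partial>\<^sub>l \<partial>\<^sub>k f = \<partial>\<^sub>k f \<partial>\<^sub>l f - \<delta>\<^sub>k\<^sub>l e\<^sup>f\<close> in sphere directions; together with the value of \<open>|\<partial>f|\<^sup>2\<close> below it contains all that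
  the curvature of the sphere depends on, and coordinates disappear from the calculation.\<close>

lemma pd_pd_conf_log:
  "pd l (pd k conf_log) x = pd k conf_log x * pd l conf_log x - (if k = l then sph k * exp (conf_log x) else 0)"
proof -
  have "pd l (pd k conf_log) x = - (sph k * (x $ k * (exp (conf_log x) * pd l conf_log x) + pd l (\<lambda>y. y $ k) x * exp (conf_log x)))"
    unfolding pd_conf_log[of k, abs_def]
    by (simp add: pd_minus pd_cmult pd_mult pd_exp differentiable_exp_comp)
  then show ?thesis
    unfolding pd_conf_log[of k x] pd_nth by (cases "k = l") (simp_all add: algebra_simps)
qed

lemma sum_sum_type: "(\<Sum>i\<in>UNIV. f i) = (\<Sum>a\<in>UNIV. f (Inl a)) + (\<Sum>b\<in>UNIV. f (Inr b))"
  for f :: "'m::finite + 'n::finite \<Rightarrow> real"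
  using sum.Plus[of "UNIV :: 'm set" "UNIV :: 'n set" f] by (simp add: o_def)

lemma conf_log_gradient:
  "(\<Sum>k\<in>UNIV. (pd k conf_log x)\<^sup>2) = 2 * exp (conf_log x) - (exp (conf_log x))\<^sup>2"
proof -
  have "(\<Sum>k\<in>UNIV. (pd k conf_log x)\<^sup>2) = (exp (conf_log x))\<^sup>2 * (\<Sum>b\<in>UNIV. (x $ Inr b)\<^sup>2)"
    by (simp add: sum_sum_type pd_conf_log power_mult_distrib sum_distrib_left mult.commute)
  also have "(\<Sum>b\<in>UNIV. (x $ Inr b)\<^sup>2) = (norm (snd_coords x))\<^sup>2"
    unfolding power2_norm_eq_inner inner_vec_def by (simp add: snd_coords_def power2_eq_square)
  also have "(exp (conf_log x))\<^sup>2 * (norm (snd_coords x))\<^sup>2 = 2 * exp (conf_log x) - (exp (conf_log x))\<^sup>2"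
  proof -
    have "1 + (norm (snd_coords x))\<^sup>2 > 0" by (simp add: add_pos_nonneg)
    then show ?thesis unfolding exp_conf_log by (simp add: divide_simps power2_eq_square)
  qed
  finally show ?thesis .
qed

abbreviation model_log :: "'m::finite + 'n::finite \<Rightarrow> real^('m + 'n) \<Rightarrow> real" where
  "model_log \<equiv> \<lambda>i x. sph i * conf_log x"

abbreviation model_metric :: "('m::finite + 'n::finite) metric" where
  "model_metric \<equiv> diag_metric model_log"

lemma pd_model_log: "pd k (model_log i) = (\<lambda>x. sph i * pd k conf_log x)"
  by (simp add: fun_eq_iff pd_cmult)

lemma model_log_differentiable: "model_log i differentiable at x" "pd k (model_log i) differentiable at x"
  by (simp_all add: pd_model_log)

text \<open>If the weights of \<open>i\<close> and \<open>k\<close> are both \<open>1\<close>, the exponent is \<open>0\<close>; otherwise both sides vanish, as \<open>f\<close>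
  does not depend on the torus coordinates.\<close>

lemma exp_scaled_pd [simp]: "exp (2 * (sph i * conf_log x) - 2 * (sph k * conf_log x)) * (sph i * pd k conf_log x)
    = sph i * pd k conf_log x"
proof (cases "sph i = 1 \<and> sph k = 1")
  case False
  moreover have "sph k = 0 \<Longrightarrow> pd k conf_log x = 0" by (simp add: pd_conf_log)
  ultimately show ?thesis using sph_cases[of i] sph_cases[of k] by auto
qed simp

lemma christoffel_model:
  "christoffel model_metric x k i j = (if k = i then sph i * pd j conf_log x else 0)
     + (if k = j then sph j * pd i conf_log x else 0) - (if i = j then sph i * pd k conf_log x else 0)"
  by (simp add: christoffel_diag model_log_differentiable) (simp add: pd_model_log)

lemma pd_christoffel_model:
  "pd a (\<lambda>y. christoffel model_metric y k i j) x = (if k = i then sph i * pd a (pd j conf_log) x else 0)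
     + (if k = j then sph j * pd a (pd i conf_log) x else 0) - (if i = j then sph i * pd a (pd k conf_log) x else 0)"
proof -
  have d: "(\<lambda>y. if c then r * pd m conf_log y else 0) differentiable at x" for c r and m :: "'a + 'b"
    by (cases c; simp)
  have e: "pd a (\<lambda>y. if c then r * pd m conf_log y else 0) x = (if c then r * pd a (pd m conf_log) x else 0)"
    for c r and m :: "'a + 'b"
    by (cases c; simp add: pd_cmult)
  show ?thesis unfolding christoffel_model
    by (simp only: pd_diff[OF differentiable_add[OF d d] d] pd_add[OF d d] e)
qed

text \<open>The quadratic part of the curvature. Every product of two Kronecker symbols collapses the sum over
  \<open>s\<close>, except the one in which neither symbol involves \<open>s\<close>; that one produces \<open>|\<partial>f|\<^sup>2\<close>.\<close>

lemma christoffel_model_quadratic: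
  fixes x :: "real^('m::finite + 'n::finite)" and k i j l :: "'m + 'n"
  defines "f \<equiv> \<lambda>k. pd k conf_log x"
  shows "(\<Sum>s\<in>UNIV. christoffel model_metric x k i s * christoffel model_metric x s j l) =
     (if k = i then sph i * (2 * f j * f l - (if j = l then sph j * (\<Sum>s\<in>UNIV. (f s)\<^sup>2) else 0)) else 0)
     + f i * (((if k = j then sph j * f l else 0) + (if k = l then sph l * f j else 0) - (if j = l then sph j * f k else 0)))
     - (if i = j then sph i * f k * f l else 0) - (if i = l then sph i * f k * f j else 0)
     + (if j = l then sph j * f k * f i else 0)"
proof -
  have s: "sph a * pd a conf_log x = f a" "f a * sph a = f a" "sph a * (f a * r) = f a * r" for a r
    using sph_pd_conf_log[of a x] by (simp_all add: f_def mult_ac)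
  have z: "sph a = 0 \<Longrightarrow> f a = 0" for a
    using s(1)[of a] by (simp add: f_def pd_conf_log)
  have fd: "pd a conf_log x = f a" for a by (simp add: f_def)
  have C: "christoffel model_metric x k i s = (if k = i then sph i * f s else 0)
     + (if s = k then sph s * f i else 0) - (if s = i then sph i * f k else 0)" for k i s
    by (auto simp: christoffel_model f_def)
  have "(\<Sum>s\<in>UNIV. christoffel model_metric x k i s * christoffel model_metric x s j l)
    = (if k = i then sph i else 0) * (\<Sum>s\<in>UNIV. f s * christoffel model_metric x s j l)
     + sph k * f i * christoffel model_metric x k j l - sph i * f k * christoffel model_metric x i j l"
    unfolding C[of k i] by (cases "k = i") (simp_all add: distrib_right left_diff_distrib sum.distrib
        sum_subtractf mult_delta_left sum_distrib_left mult.assoc)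
  also have "(\<Sum>s\<in>UNIV. f s * christoffel model_metric x s j l) = 2 * f j * f l
     - (if j = l then sph j * (\<Sum>s\<in>UNIV. (f s)\<^sup>2) else 0)"
    unfolding christoffel_model fd using sph_cases[of j] sph_cases[of l] z[of j] z[of l]
    by (cases "j = l") (auto simp: distrib_left right_diff_distrib
        sum.distrib sum_subtractf mult_delta_right sum_distrib_left power2_eq_square s mult_ac)
  finally show ?thesis
    unfolding christoffel_model fd
    using sph_cases[of i] sph_cases[of j] sph_cases[of k] sph_cases[of l] z[of i] z[of j] z[of k] z[of l]
    by (auto simp: algebra_simps)
qed

text \<open>The sphere has constant curvature one and the torus none. The power \<open>e\<^sup>4\<^sup>f\<close> is \<open>g\<^sub>i\<^sub>i g\<^sub>j\<^sub>j\<close> for sphere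
  directions.\<close>

lemma riemann_model:
  "riemann model_metric x i j k l = sph i * sph j * exp (4 * conf_log x) *
     ((if i = k \<and> j = l then 1 else 0) - (if i = l \<and> j = k then 1 else 0))"
proof -
  let ?e = "exp (conf_log x)"
  have e: "exp (2 * (sph k * conf_log x)) * (sph k * (?e^2 * r)) = sph k * (exp (4 * conf_log x) * r)" for r and k :: "'a + 'b"
    using sph_cases[of k] by (auto simp flip: exp_add exp_double)
  define f where "f k = pd k conf_log x" for k
  have s: "sph a * f a = f a" "f a * sph a = f a" for a
    using sph_pd_conf_log[of a x] by (simp_all add: f_def mult_ac)
  have g: "(\<Sum>s\<in>UNIV. (f s)\<^sup>2) = 2 * ?e - ?e\<^sup>2"
    using conf_log_gradient[of x] by (simp add: f_def)
  have z: "sph a = 0 \<Longrightarrow> f a = 0" for a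
    using s[of a] by simp
  have "pd i (\<lambda>y. christoffel model_metric y k j l) x - pd j (\<lambda>y. christoffel model_metric y k i l) x
      + (\<Sum>s\<in>UNIV. christoffel model_metric x k i s * christoffel model_metric x s j l
                - christoffel model_metric x k j s * christoffel model_metric x s i l)
    = sph k * (?e^2 * (sph i * sph j * ((if i = k \<and> j = l then 1 else 0) - (if i = l \<and> j = k then 1 else 0))))"
    unfolding sum_subtractf christoffel_model_quadratic pd_christoffel_model pd_pd_conf_log f_def[symmetric] g
    using sph_cases[of i] sph_cases[of j] sph_cases[of k] sph_cases[of l] z[of i] z[of j] z[of k] z[of l]
    by (cases "i = k"; cases "i = l"; cases "j = k"; cases "j = l"; cases "i = j"; cases "k = l")
       (auto simp: algebra_simps power2_eq_square)
  then have "riemann model_metric x i j k l = sph k * (exp (4 * conf_log x) *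
      (sph i * sph j * ((if i = k \<and> j = l then 1 else 0) - (if i = l \<and> j = k then 1 else 0))))"
    unfolding riemann_diag_sum by (simp only: e)
  also have "\<dots> = exp (4 * conf_log x) * (sph k *
      (sph i * sph j * ((if i = k \<and> j = l then 1 else 0) - (if i = l \<and> j = k then 1 else 0))))"
    by (rule mult.left_commute)
  also have "sph k * (sph i * sph j * ((if i = k \<and> j = l then 1 else 0) - (if i = l \<and> j = k then 1 else 0)))
     = sph i * sph j * ((if i = k \<and> j = l then 1 else 0) - (if i = l \<and> j = k then 1 else 0))"
    using sph_cases[of k] by (cases "i = k"; cases "j = k") auto
  finally show ?thesis
    by (simp only: mult_ac)
qed

section \<open>The scalar \<open>L\<^sub>1\<close> of the product\<close>

lemma sum_sph: "(\<Sum>s\<in>UNIV. sph (s :: 'm::finite + 'n::finite)) = real CARD('n)"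
  by (simp add: sum_sum_type)

lemma ricci_model:
  fixes x :: "real^('m::finite + 'n::finite)"
  shows "ricci model_metric x i j =
    (if i = j then (real CARD('n) - 1) * (sph i * exp (2 * (sph i * conf_log x))) else 0)"
proof (cases "i = j")
  case True
  have e: "exp (- 2 * (sph s * conf_log x)) * (sph i * sph s * exp (4 * conf_log x) * r)
    = sph i * exp (2 * (sph i * conf_log x)) * (sph s * r)" for s :: "'m + 'n" and r
    using sph_cases[of s] sph_cases[of i] by (auto simp flip: exp_add)
  have "ricci model_metric x i j = (\<Sum>s\<in>UNIV. exp (- 2 * (sph s * conf_log x)) *
      (sph i * sph s * exp (4 * conf_log x) * (1 - (if s = i then 1 else 0))))"
    unfolding ricci_diag_sum riemann_model using True by (intro sum.cong) auto
  also have "\<dots> = sph i * exp (2 * (sph i * conf_log x)) * (\<Sum>s\<in>UNIV. sph s * (1 - (if s = i then 1 else 0)))"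
    unfolding e sum_distrib_left ..
  also have "(\<Sum>s\<in>UNIV. sph s * (1 - (if s = i then 1 else 0))) = real CARD('n) - sph i"
    by (simp add: right_diff_distrib sum_subtractf sum_sph mult_delta_right)
  finally show ?thesis using True sph_cases[of i] by auto
next
  case False
  then show ?thesis unfolding ricci_diag_sum riemann_model by (auto intro!: sum.neutral)
qed

lemma scalar_curv_model:
  fixes x :: "real^('m::finite + 'n::finite)"
  shows "scalar_curv model_metric x = real CARD('n) * (real CARD('n) - 1)"
proof -
  have "scalar_curv model_metric x = (\<Sum>i\<in>UNIV. (real CARD('n) - 1) * sph (i :: 'm + 'n))"
    unfolding scalar_curv_def ginv_diag ricci_model
    by (simp add: mult_delta_left) (intro sum.cong refl, simp add: exp_minus)
  then show ?thesis by (simp add: sum_sph flip: sum_distrib_left)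
qed

abbreviation torus_sphere_metric :: "(2 + 4) metric" where "torus_sphere_metric \<equiv> model_metric"

lemma schouten_trace_model: "schouten_trace torus_sphere_metric x = 6 / 5"
  by (simp add: schouten_trace_def scalar_curv_model)

text \<open>The tensor \<open>a h + (a + b) k\<close>, where \<open>h\<close> and \<open>k\<close> are the metrics of the two factors.\<close>

definition block_tensor :: "real \<Rightarrow> real \<Rightarrow> real^('m::finite + 'n::finite) \<Rightarrow> 'm + 'n \<Rightarrow> 'm + 'n \<Rightarrow> real" where
  "block_tensor a b x i j = (if i = j then (a + b * sph i) * exp (2 * (sph i * conf_log x)) else 0)"

lemma schouten_model: "schouten torus_sphere_metric = block_tensor (- 3 / 10) (3 / 4)"
  unfolding fun_eq_iff schouten_def schouten_trace_model ricci_model block_tensor_def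
  by (auto simp: algebra_simps)

lemma block_tensor_differentiable: "(\<lambda>y. block_tensor a b y i j) differentiable at x"
  unfolding block_tensor_def by (cases "i = j")
    (auto intro!: differentiable_mult differentiable_exp_comp)

lemma pd_block_tensor: "pd a (\<lambda>y. block_tensor \<alpha> \<beta> y i j) x =
  (if i = j then (\<alpha> + \<beta> * sph i) * (2 * (pd a conf_log x * (sph i * exp (2 * (sph i * conf_log x))))) else 0)"
  unfolding block_tensor_def by (cases "i = j") (auto simp: pd_cmult pd_exp differentiable_exp_comp)

text \<open>The metrics of the two factors are parallel: within one block this is the compatibility of the metric
  with its connection, and between the blocks the Christoffel symbols vanish.\<close>

lemma cov2_block_tensor: "cov2 model_metric (block_tensor \<alpha> \<beta>) x a i j = 0"
proof -
  have s: "(\<Sum>m\<in>UNIV. christoffel model_metric x m a i * block_tensor \<alpha> \<beta> x m j)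
      = christoffel model_metric x j a i * block_tensor \<alpha> \<beta> x j j" for i j
    unfolding block_tensor_def by (simp add: mult_delta_right)
  have s': "(\<Sum>m\<in>UNIV. christoffel model_metric x m a j * block_tensor \<alpha> \<beta> x i m)
      = christoffel model_metric x i a j * block_tensor \<alpha> \<beta> x i i" for i j
    unfolding block_tensor_def by (simp add: mult_delta_right)
  have z: "sph k = 0 \<Longrightarrow> pd k conf_log x = 0" for k by (simp add: pd_conf_log)
  show ?thesis
    unfolding cov2_def s s' unfolding pd_block_tensor christoffel_model
    using sph_cases[of i] sph_cases[of j] sph_cases[of a] z[of i] z[of j] z[of a]
    by (auto simp: block_tensor_def algebra_simps)
qed

lemma cotton_model: "cotton torus_sphere_metric x i j k = 0"
  by (simp add: cotton_def schouten_model cov2_block_tensor)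

text \<open>The Kulkarni-Nomizu product of \<open>A\<close> and \<open>B\<close> is \<open>curv_product A B + curv_product B A\<close>.\<close>

definition curv_product :: "(real^'n \<Rightarrow> 'n \<Rightarrow> 'n \<Rightarrow> real) \<Rightarrow> (real^'n \<Rightarrow> 'n \<Rightarrow> 'n \<Rightarrow> real) \<Rightarrow>
    real^'n \<Rightarrow> 'n \<Rightarrow> 'n \<Rightarrow> 'n \<Rightarrow> 'n::finite \<Rightarrow> real" where
  "curv_product A B x i j k l = A x i k * B x j l - A x i l * B x j k"

lemma curv_product_differentiable:
  assumes "\<And>i j. (\<lambda>y. A y i j) differentiable at x" "\<And>i j. (\<lambda>y. B y i j) differentiable at x"
  shows "(\<lambda>y. curv_product A B y i j k l) differentiable at x"
  unfolding curv_product_def by (intro differentiable_diff differentiable_mult assms)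

lemma cov4_curv_product:
  assumes d: "\<And>i j. (\<lambda>y. A y i j) differentiable at x" "\<And>i j. (\<lambda>y. B y i j) differentiable at x"
    and A: "\<And>a i j. cov2 g A x a i j = 0" and B: "\<And>a i j. cov2 g B x a i j = 0"
  shows "cov4 g (curv_product A B) x a i j k l = 0"
proof -
  have A': "pd a (\<lambda>y. A y i j) x = (\<Sum>m\<in>UNIV. christoffel g x m a i * A x m j)
     + (\<Sum>m\<in>UNIV. christoffel g x m a j * A x i m)" for i j
    using A[of a i j] by (simp add: cov2_def)
  have B': "pd a (\<lambda>y. B y i j) x = (\<Sum>m\<in>UNIV. christoffel g x m a i * B x m j)
     + (\<Sum>m\<in>UNIV. christoffel g x m a j * B x i m)" for i j
    using B[of a i j] by (simp add: cov2_def)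
  have P: "pd a (\<lambda>y. curv_product A B y i j k l) x =
     A x i k * pd a (\<lambda>y. B y j l) x + pd a (\<lambda>y. A y i k) x * B x j l
     - (A x i l * pd a (\<lambda>y. B y j k) x + pd a (\<lambda>y. A y i l) x * B x j k)"
    unfolding curv_product_def
    by (simp only: pd_diff[OF differentiable_mult[OF d] differentiable_mult[OF d]] pd_mult[OF d])
  show ?thesis
    unfolding cov4_def P unfolding A' B' curv_product_def
    by (simp add: right_diff_distrib sum_subtractf sum_distrib_left sum_distrib_right distrib_left distrib_right sum.distrib mult_ac)
qed

lemma cov4_diff:
  assumes "\<And>i j k l. (\<lambda>y. S y i j k l) differentiable at x" "\<And>i j k l. (\<lambda>y. T y i j k l) differentiable at x"
  shows "cov4 g (\<lambda>y i j k l. S y i j k l - T y i j k l) x a i j k l = cov4 g S x a i j k l - cov4 g T x a i j k l"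
  unfolding cov4_def by (simp add: pd_diff assms right_diff_distrib sum_subtractf)

text \<open>The curvature is half the Kulkarni-Nomizu square of the sphere metric. Written in this form, the Weyl
  tensor is parallel by the Leibniz rule.\<close>

lemma weyl_model: "weyl torus_sphere_metric = (\<lambda>x i j k l. curv_product (block_tensor 0 1) (block_tensor 0 1) x i j k l
    - curv_product (schouten torus_sphere_metric) (block_tensor 1 0) x i j k l
    - curv_product (block_tensor 1 0) (schouten torus_sphere_metric) x i j k l)"
proof (intro ext)
  fix x :: "real^(2+4)" and i j k l :: "2 + 4"
  have g: "torus_sphere_metric x $ i $ j = block_tensor 1 0 x i j" for i j by (simp add: block_tensor_def)
  have e: "sph i * exp (2 * (sph i * conf_log x)) * (sph j * exp (2 * (sph j * conf_log x)))
     = sph i * sph j * exp (4 * conf_log x)" for i j :: "2 + 4"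
    using sph_cases[of i] sph_cases[of j] by (auto simp flip: exp_add)
  have r: "riemann torus_sphere_metric x i j k l = curv_product (block_tensor 0 1) (block_tensor 0 1) x i j k l"
    unfolding riemann_model curv_product_def block_tensor_def using e[of i j] by auto
  show "weyl torus_sphere_metric x i j k l = curv_product (block_tensor 0 1) (block_tensor 0 1) x i j k l
    - curv_product (schouten torus_sphere_metric) (block_tensor 1 0) x i j k l
    - curv_product (block_tensor 1 0) (schouten torus_sphere_metric) x i j k l"
    unfolding weyl_def g r by (simp add: curv_product_def)
qed

lemma nabla_weyl_model: "cov4 torus_sphere_metric (weyl torus_sphere_metric) x a i j k l = 0"
  unfolding weyl_model schouten_model
  by (subst cov4_diff)
    (auto intro!: differentiable_diff curv_product_differentiable block_tensor_differentiable
      simp: cov4_diff curv_product_differentiable block_tensor_differentiable cov4_curv_product cov2_block_tensor)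

text \<open>The value of the Weyl tensor on the orthonormalized coordinate plane of directions \<open>i\<close> and \<open>j\<close>: it is
  \<open>3/5\<close>, \<open>1/10\<close> or \<open>-3/20\<close> if \<open>0\<close>, \<open>2\<close> or \<open>1\<close> of them belong to the sphere.\<close>

definition weyl_coeff :: "2 + 4 \<Rightarrow> 2 + 4 \<Rightarrow> real" where
  "weyl_coeff i j = sph i * sph j - 3 / 4 * (sph i + sph j) + 3 / 5"

lemma weyl_model_components: "weyl torus_sphere_metric x i j k l =
  weyl_coeff i j * exp (2 * (sph i * conf_log x)) * exp (2 * (sph j * conf_log x)) *
     ((if i = k \<and> j = l then 1 else 0) - (if i = l \<and> j = k then 1 else 0))"
proof -
  define E where "E i = exp (2 * (sph i * conf_log x))" for i :: "2 + 4"
  have b: "block_tensor \<alpha> \<beta> x i j = (if i = j then (\<alpha> + \<beta> * sph i) * E i else 0)" for \<alpha> \<beta> i j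
    by (simp add: block_tensor_def E_def)
  show ?thesis
    unfolding weyl_model schouten_model curv_product_def b weyl_coeff_def E_def[symmetric]
    by (auto simp: field_simps)
qed

lemma raise4_diag: "raise4 (diag_metric F) x T i j k l =
  exp (- 2 * F i x) * exp (- 2 * F j x) * exp (- 2 * F k x) * exp (- 2 * F l x) * T i j k l"
  unfolding raise4_def ginv_diag
  by (simp add: mult_delta_left mult_delta_right)

lemma weyl_model_raise: "weyl torus_sphere_metric x i j k l * raise4 torus_sphere_metric x (weyl torus_sphere_metric x) i j k l =
  (if i = j then 0 else (weyl_coeff i j)\<^sup>2 *
    ((if l = j then (if k = i then 1 else 0) else 0) + (if l = i then (if k = j then 1 else 0) else 0)))"
  unfolding raise4_diag weyl_model_components
  by (auto simp: exp_minus divide_simps power2_eq_square)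

text \<open>Summing the square of the antisymmetric product of Kronecker symbols over \<open>k\<close> and \<open>l\<close> gives \<open>2\<close> for
  \<open>j \<noteq> i\<close> and \<open>0\<close> for \<open>j = i\<close>. The subtracted term removes the latter from the full sum over \<open>j\<close>, so that the
  sum can be evaluated block by block.\<close>

lemma weyl_model_raise_sum: "(\<Sum>j\<in>UNIV. \<Sum>k\<in>UNIV. \<Sum>l\<in>UNIV.
    weyl torus_sphere_metric x i j k l * raise4 torus_sphere_metric x (weyl torus_sphere_metric x) i j k l)
  = (\<Sum>j\<in>UNIV. 2 * (weyl_coeff i j)\<^sup>2) - 2 * (weyl_coeff i i)\<^sup>2"
proof -
  have "(\<Sum>k\<in>UNIV. \<Sum>l\<in>UNIV. weyl torus_sphere_metric x i j k l * raise4 torus_sphere_metric x (weyl torus_sphere_metric x) i j k l)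
    = 2 * (weyl_coeff i j)\<^sup>2 - (if j = i then 2 * (weyl_coeff i i)\<^sup>2 else 0)" for j
    unfolding weyl_model_raise
    by (cases "i = j") (simp_all add: sum.distrib sum_distrib_left distrib_left mult_delta_right)
  then show ?thesis by (simp add: sum_subtractf)
qed

lemma weyl_norm2_model: "weyl_norm2 torus_sphere_metric x = 12 / 5"
  unfolding weyl_norm2_def weyl_model_raise_sum
  by (simp add: sum_sum_type weyl_coeff_def power2_eq_square)

lemma schouten_weyl_weyl_model: "schouten_weyl_weyl torus_sphere_metric x = - 27 / 100"
proof -
  have p: "(\<Sum>u\<in>UNIV. schouten torus_sphere_metric x t u * ginv torus_sphere_metric x u s) = (if s = t then 3 / 4 * sph t - 3 / 10 else 0)" for t s
    unfolding schouten_model block_tensor_def ginv_diag by (simp add: mult_delta_left exp_minus)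
  have "schouten_weyl_weyl torus_sphere_metric x = (\<Sum>t\<in>UNIV. (3 / 4 * sph t - 3 / 10) *
      ((\<Sum>j\<in>UNIV. 2 * (weyl_coeff t j)\<^sup>2) - 2 * (weyl_coeff t t)\<^sup>2))"
    unfolding schouten_weyl_weyl_def p by (simp only: mult_delta_left sum.delta finite UNIV_I if_True weyl_model_raise_sum)
  then show ?thesis
    by (simp add: sum_sum_type weyl_coeff_def power2_eq_square)
qed

lemma L1_coord_model: "L1_coord torus_sphere_metric x = - 36"
proof -
  have "weyl_norm2 torus_sphere_metric = (\<lambda>_. 12 / 5)" by (simp add: fun_eq_iff weyl_norm2_model)
  moreover have "weyl_cotton torus_sphere_metric = (\<lambda>_ _. 0)"
    by (simp add: fun_eq_iff weyl_cotton_def raise3_def cotton_model)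
  ultimately show ?thesis
    by (simp add: L1_coord_def laplacian_def divergence_def cov1_def nabla_weyl_norm2_def
        nabla_weyl_model cotton_norm2_def cotton_model schouten_weyl_weyl_model schouten_trace_model)
qed

section \<open>Conformal changes of the product metric\<close>

abbreviation conf_model :: "(real^('m::finite + 'n::finite) \<Rightarrow> real) \<Rightarrow> ('m + 'n) metric" where
  "conf_model U \<equiv> diag_metric (\<lambda>i x. U x + sph i * conf_log x)"

context
  fixes U :: "real^('m::finite + 'n::finite) \<Rightarrow> real"
  assumes U: "\<And>x. U differentiable at x" and U2: "\<And>k x. pd k U differentiable at x"
begin

lemma pd_conf: "pd k (\<lambda>x. U x + sph i * conf_log x) = (\<lambda>x. pd k U x + sph i * pd k conf_log x)"
  by (simp add: fun_eq_iff pd_add U pd_cmult)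

lemma pd_pd_conf: "pd l (\<lambda>x. pd k U x + sph i * pd k conf_log x) x = pd l (pd k U) x + sph i * pd l (pd k conf_log) x"
  by (simp add: pd_add U2 pd_cmult)

lemma conf_differentiable:
  "(\<lambda>x. U x + sph i * conf_log x) differentiable at x" "pd k (\<lambda>x. U x + sph i * conf_log x) differentiable at x"
  by (simp_all add: pd_conf U U2)

text \<open>Each of the \<open>n - 2\<close> directions other than \<open>i\<close> and \<open>j\<close> contributes the same amount: in a mixed
  component the derivatives of \<open>conf_log\<close> cancel.\<close>

lemma ricci_conf_mixed:
  assumes ij: "sph i \<noteq> sph j"
  shows "ricci (conf_model U) x i j = real (CARD('m + 'n) - 2) * (pd i U x * pd j U x - pd i (pd j U) x)
     + (pd i (pd j U) x - pd j (pd i U) x)"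
proof -
  have neq: "i \<noteq> j" using ij by auto
  have z: "sph k = 0 \<Longrightarrow> pd k conf_log x = 0" for k by (simp add: pd_conf_log)
  have e: "exp (- 2 * a) * (exp (2 * a) * r) = r" for a r :: real
    by (simp add: mult.assoc[symmetric] flip: exp_add)
  have s: "exp (- 2 * (U x + sph s * conf_log x)) * riemann (conf_model U) x i s j s
     = pd i U x * pd j U x - pd i (pd j U) x" if "s \<noteq> i" "s \<noteq> j" for s
    unfolding riemann_diag_mixed[OF conf_differentiable neq that] e
    unfolding pd_conf pd_pd_conf pd_pd_conf_log
    using ij sph_cases[of i] sph_cases[of j] sph_cases[of s] z[of i] z[of j] neq
    by (auto simp: algebra_simps)
  have d: "exp (- 2 * (U x + sph j * conf_log x)) * riemann (conf_model U) x i j j j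
     = pd i (pd j U) x - pd j (pd i U) x"
    unfolding riemann_diag_degenerate[OF conf_differentiable neq] e
    unfolding pd_conf pd_pd_conf pd_pd_conf_log
    using neq by (simp add: algebra_simps)
  have "ricci (conf_model U) x i j = (\<Sum>s\<in>UNIV - {i, j}. exp (- 2 * (U x + sph s * conf_log x)) * riemann (conf_model U) x i s j s)
    + (\<Sum>s\<in>{i, j}. exp (- 2 * (U x + sph s * conf_log x)) * riemann (conf_model U) x i s j s)"
    unfolding ricci_diag_sum by (rule sum.subset_diff) auto
  also have "(\<Sum>s\<in>UNIV - {i, j}. exp (- 2 * (U x + sph s * conf_log x)) * riemann (conf_model U) x i s j s)
    = real (CARD('m + 'n) - 2) * (pd i U x * pd j U x - pd i (pd j U) x)"
    using s neq by (simp add: card_Diff_subset numeral_2_eq_2)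
  also have "(\<Sum>s\<in>{i, j}. exp (- 2 * (U x + sph s * conf_log x)) * riemann (conf_model U) x i s j s)
    = pd i (pd j U) x - pd j (pd i U) x"
    using neq d by (simp add: riemann_diag_self)
  finally show ?thesis .
qed

text \<open>The general formula for the Ricci tensor of \<open>e\<^sup>2\<^sup>U g\<close> is
  \<open>Ric - (n - 2) (\<nabla>\<^sup>2U - dU \<otimes> dU) - (\<Delta>U + (n - 2) |dU|\<^sup>2) g\<close>. At a critical point the quadratic terms vanish, and
  \<open>\<nabla>\<^sup>2U\<close> and \<open>\<Delta>U\<close> reduce to second partial derivatives.\<close>

lemma ricci_conf_critical:
  assumes crit: "\<And>k. pd k U x = 0"
  shows "ricci (conf_model U) x i i = exp (2 * (sph i * conf_log x)) *
    ((real CARD('n) - 1) * sph i - (real CARD('m + 'n) - 2) * (exp (- 2 * (sph i * conf_log x)) * pd i (pd i U) x)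
      - (\<Sum>s\<in>UNIV. exp (- 2 * (sph s * conf_log x)) * pd s (pd s U) x))"
proof -
  define \<phi> where "\<phi> = conf_log x"
  have z: "sph k = 0 \<Longrightarrow> pd k conf_log x = 0" for k by (simp add: pd_conf_log)
  have s: "exp (- 2 * (U x + sph s * \<phi>)) * riemann (conf_model U) x i s i s
     = sph i * sph s * exp (2 * \<phi>) - pd i (pd i U) x - exp (2 * (sph i * \<phi>)) * (exp (- 2 * (sph s * \<phi>)) * pd s (pd s U) x)"
    if neq: "i \<noteq> s" for s
  proof -
    have "(\<Sum>m\<in>UNIV - {i, s}. (pd m conf_log x)\<^sup>2) + ((pd i conf_log x)\<^sup>2 + (pd s conf_log x)\<^sup>2) = (\<Sum>m\<in>UNIV. (pd m conf_log x)\<^sup>2)"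
      using neq sum.subset_diff[of "{i, s}" UNIV "\<lambda>m. (pd m conf_log x)\<^sup>2"] by simp
    then have g: "(\<Sum>m\<in>UNIV - {i, s}. (pd m conf_log x)\<^sup>2)
        = 2 * exp \<phi> - (exp \<phi>)\<^sup>2 - (pd i conf_log x)\<^sup>2 - (pd s conf_log x)\<^sup>2"
      unfolding conf_log_gradient \<phi>_def by simp
    have "exp (2 * (U x + sph i * \<phi>)) * (exp (- 2 * (U x + sph m * \<phi>)) * (sph i * pd m conf_log x) * (sph s * pd m conf_log x))
      = sph i * (sph s * (pd m conf_log x)\<^sup>2)" for m
      using sph_cases[of m] sph_cases[of i] z[of m] by (auto simp: power2_eq_square simp flip: exp_add)
    then have Q: "exp (2 * (U x + sph i * \<phi>)) * (\<Sum>m\<in>UNIV - {i, s}. exp (- 2 * (U x + sph m * \<phi>)) * (sph i * pd m conf_log x) * (sph s * pd m conf_log x))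
      = sph i * (sph s * (\<Sum>m\<in>UNIV - {i, s}. (pd m conf_log x)\<^sup>2))"
      by (simp only: sum_distrib_left)
    have e: "exp (- 2 * (U x + sph s * \<phi>)) * (- exp (2 * (U x + sph s * \<phi>)) * A - exp (2 * (U x + sph i * \<phi>)) * B
        - exp (2 * (U x + sph i * \<phi>) + 2 * (U x + sph s * \<phi>)) * C)
      = - A - exp (2 * (sph i * \<phi>)) * (exp (- 2 * (sph s * \<phi>)) * B) - exp (2 * (U x + sph i * \<phi>)) * C" for A B C
    proof -
      have 1: "exp (- 2 * (U x + sph s * \<phi>)) * exp (2 * (U x + sph s * \<phi>)) = 1"
        and 2: "exp (- 2 * (U x + sph s * \<phi>)) * exp (2 * (U x + sph i * \<phi>))
          = exp (2 * (sph i * \<phi>)) * exp (- 2 * (sph s * \<phi>))"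
        and 3: "exp (- 2 * (U x + sph s * \<phi>)) * exp (2 * (U x + sph i * \<phi>) + 2 * (U x + sph s * \<phi>))
          = exp (2 * (U x + sph i * \<phi>))"
        by (simp_all add: algebra_simps flip: exp_add)
      have "e * (- e1 * A - e2 * B - e3 * C) = - A - e4 * (e5 * B) - e2 * C"
        if "e * e1 = 1" "e * e2 = e4 * e5" "e * e3 = e2" for e e1 e2 e3 e4 e5 :: real
        using that by algebra
      from this[OF 1 2 3] show ?thesis .
    qed
    have d: "exp (\<phi> * 2) = exp \<phi> * exp \<phi>"
      by (simp flip: exp_add)
    have c: "exp (2 * \<phi>) * (exp (- (2 * \<phi>)) * r) = r" for r
      by (simp add: mult.assoc[symmetric] flip: exp_add)
    show ?thesis
      unfolding riemann_diag_sectional[OF conf_differentiable neq] \<phi>_def[symmetric] e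
      unfolding pd_conf pd_pd_conf pd_pd_conf_log crit \<phi>_def[symmetric] add_0_left
      unfolding Q g
      using sph_cases[of i] sph_cases[of s] z[of i] z[of s]
      by (elim disjE; simp add: c; simp add: power2_eq_square algebra_simps d)
  qed
  let ?L = "\<Sum>s\<in>UNIV. exp (- 2 * (sph s * \<phi>)) * pd s (pd s U) x"
  let ?g = "\<lambda>s. sph i * sph s * exp (2 * \<phi>) - pd i (pd i U) x - exp (2 * (sph i * \<phi>)) * (exp (- 2 * (sph s * \<phi>)) * pd s (pd s U) x)"
  have "ricci (conf_model U) x i i = (\<Sum>s\<in>UNIV. if s = i then 0 else ?g s)"
    unfolding ricci_diag_sum \<phi>_def[symmetric] by (intro sum.cong refl) (use s in \<open>auto simp: riemann_diag_self\<close>)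
  also have "\<dots> = (\<Sum>s\<in>UNIV. ?g s - (if s = i then ?g i else 0))"
    by (intro sum.cong) auto
  also have "\<dots> = (\<Sum>s\<in>UNIV. ?g s) - ?g i"
    by (simp only: sum_subtractf sum.delta finite UNIV_I if_True)
  also have "(\<Sum>s\<in>UNIV. ?g s) = sph i * exp (2 * \<phi>) * real CARD('n) - real CARD('m + 'n) * pd i (pd i U) x
      - exp (2 * (sph i * \<phi>)) * ?L"
    by (simp add: sum_subtractf sum_distrib_left[symmetric] sum_sum_type)
  finally have R: "ricci (conf_model U) x i i = sph i * exp (2 * \<phi>) * real CARD('n)
      - real CARD('m + 'n) * pd i (pd i U) x - exp (2 * (sph i * \<phi>)) * ?L - ?g i" .
  have "s * X * n - N * u - E * L - (s * s * X - u - E * (e * u)) = E * ((n - 1) * s - (N - 2) * (e * u) - L)"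
    if "E * e = 1" "s * X = s * E" "s * s = s" for E e s X n N u L :: real
    using that by algebra
  from this[of "exp (2 * (sph i * \<phi>))" "exp (- 2 * (sph i * \<phi>))" "sph i" "exp (2 * \<phi>)"]
  show ?thesis
    unfolding R \<phi>_def[symmetric] using sph_cases[of i] by (auto simp flip: exp_add)
qed

end

text \<open>Let \<open>X = \<partial>\<^sub>i \<partial>\<^sub>j U\<close> and \<open>Y = \<partial>\<^sub>j \<partial>\<^sub>i U\<close>. The two off-diagonal entries of the Ricci tensor vanish, and their
  difference is \<open>-2 (X - Y)\<close>, since \<open>n - 2 = 4\<close>. So the Einstein equation itself gives the symmetry \<open>X = Y\<close>.\<close>

lemma einstein_mixed_hessian:
  fixes U :: "real^(2 + 4) \<Rightarrow> real"
  assumes "\<And>x. U differentiable at x" "\<And>k x. pd k U differentiable at x"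
    and ein: "\<And>i j. ricci (conf_model U) x i j = c * conf_model U x $ i $ j"
    and ij: "sph i \<noteq> sph j"
  shows "pd i (pd j U) x = pd i U x * pd j U x"
proof -
  have "i \<noteq> j" using ij by auto
  then show ?thesis
    using ein[of i j] ein[of j i] ij
      ricci_conf_mixed[OF assms(1,2) ij, of x] ricci_conf_mixed[OF assms(1,2) ij[symmetric], of x]
    by (simp add: algebra_simps)
qed

text \<open>With \<open>T\<close> and \<open>S\<close> the Laplacians of \<open>U\<close> along the two factors, the traces of the Einstein equation are
  \<open>-6 T - 2 S = 2 c e\<^sup>2\<^sup>U\<close> and \<open>12 - 4 T - 8 S = 4 c e\<^sup>2\<^sup>U\<close>. Eliminating the right-hand sides leaves
  \<open>S = 3 + 2 T\<close>.\<close>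

lemma einstein_no_saddle:
  fixes U :: "real^(2 + 4) \<Rightarrow> real"
  assumes U: "\<And>x. U differentiable at x" "\<And>k x. pd k U differentiable at x"
    and ein: "\<And>i j. ricci (conf_model U) x i j = c * conf_model U x $ i $ j"
    and crit: "\<And>k. pd k U x = 0"
    and torus: "\<And>a. pd (Inl a) (pd (Inl a) U) x \<ge> 0"
    and sphere: "\<And>b. pd (Inr b) (pd (Inr b) U) x \<le> 0"
  shows False
proof -
  let ?L = "\<Sum>s\<in>UNIV. exp (- 2 * (sph s * conf_log x)) * pd s (pd s U) x"
  let ?T = "\<Sum>a\<in>UNIV. pd (Inl a) (pd (Inl a) U) x"
  let ?S = "\<Sum>b\<in>UNIV. exp (- 2 * conf_log x) * pd (Inr b) (pd (Inr b) U) x"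
  have L: "?L = ?T + ?S" by (simp add: sum_sum_type)
  have 1: "3 * sph i - 4 * (exp (- 2 * (sph i * conf_log x)) * pd i (pd i U) x) - ?L = c * exp (2 * U x)" for i
  proof -
    have "exp (2 * (sph i * conf_log x)) * (3 * sph i - 4 * (exp (- 2 * (sph i * conf_log x)) * pd i (pd i U) x) - ?L)
      = exp (2 * (sph i * conf_log x)) * (c * exp (2 * U x))"
      using ein[of i i] ricci_conf_critical[OF U crit, of i] by (simp add: exp_add distrib_left)
    then show ?thesis by (simp only: mult_cancel_left exp_not_eq_zero if_False) simp
  qed
  have "(\<Sum>a\<in>UNIV. - 4 * pd (Inl a) (pd (Inl a) U) x - ?L) = (\<Sum>a\<in>(UNIV :: 2 set). c * exp (2 * U x))"
    by (intro sum.cong refl) (use 1[of "Inl _"] in simp)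
  then have T: "- 4 * ?T - 2 * ?L = 2 * (c * exp (2 * U x))"
    by (simp add: sum_subtractf sum_distrib_left sum_negf)
  have "(\<Sum>b\<in>UNIV. 3 - 4 * (exp (- 2 * conf_log x) * pd (Inr b) (pd (Inr b) U) x) - ?L) = (\<Sum>b\<in>(UNIV :: 4 set). c * exp (2 * U x))"
    by (intro sum.cong refl) (use 1[of "Inr _"] in simp)
  then have S: "12 - 4 * ?S - 4 * ?L = 4 * (c * exp (2 * U x))"
    by (simp add: sum_subtractf sum_distrib_left sum_negf)
  have "?T \<ge> 0" by (intro sum_nonneg torus)
  moreover have "?S \<le> 0" by (intro sum_nonpos mult_nonneg_nonpos sphere) auto
  ultimately show False using T S L by linarith
qed

section \<open>Stereographic charts of the sphere\<close>

lemma stereo_inv_has_derivative: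
  fixes x :: "real^'n::finite"
  defines "q \<equiv> 1 + (norm x)\<^sup>2"
  shows "(stereo_inv s has_derivative
    (\<lambda>h. ((2 / q) *\<^sub>R h - (4 * (x \<bullet> h) / q\<^sup>2) *\<^sub>R x, s * (4 * (x \<bullet> h) / q\<^sup>2)))) (at x)"
proof -
  have q: "q \<noteq> 0" "1 + x \<bullet> x \<noteq> 0"
    using add_pos_nonneg[OF zero_less_one zero_le_power2[of "norm x"]]
    by (auto simp: q_def power2_norm_eq_inner)
  have qi: "q = 1 + x \<bullet> x" by (simp add: q_def power2_norm_eq_inner)
  have 1: "((\<lambda>y. 2 / (1 + y \<bullet> y)) has_derivative (\<lambda>h. - (4 * (x \<bullet> h) / q\<^sup>2))) (at x)"
    using q by (auto intro!: derivative_eq_intros simp: qi inner_commute power2_eq_square divide_simps)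
  have 2: "((\<lambda>y. s * (1 - 2 / (1 + y \<bullet> y))) has_derivative (\<lambda>h. s * (4 * (x \<bullet> h) / q\<^sup>2))) (at x)"
    by (rule derivative_eq_intros 1 refl | simp)+
  have 3: "((\<lambda>y. (2 / (1 + y \<bullet> y)) *\<^sub>R y) has_derivative (\<lambda>h. (2 / q) *\<^sub>R h - (4 * (x \<bullet> h) / q\<^sup>2) *\<^sub>R x)) (at x)"
    by (rule derivative_eq_intros 1 refl | simp add: qi)+
  have eq: "stereo_inv s = (\<lambda>y :: real^'n. ((2 / (1 + y \<bullet> y)) *\<^sub>R y, s * (1 - 2 / (1 + y \<bullet> y))))"
  proof
    fix y :: "real^'n"
    have "1 + y \<bullet> y \<noteq> 0"
      using add_pos_nonneg[OF zero_less_one inner_ge_zero[of y]] by simp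
    then show "stereo_inv s y = ((2 / (1 + y \<bullet> y)) *\<^sub>R y, s * (1 - 2 / (1 + y \<bullet> y)))"
      by (simp add: stereo_inv_def power2_norm_eq_inner diff_divide_eq_iff algebra_simps)
  qed
  show ?thesis unfolding eq by (rule has_derivative_Pair[OF 3 2])
qed

lemma round_sphere_metric:
  assumes "s = 1 \<or> s = - 1"
  shows "met round_sphere s y $ i $ j = (if i = j then (2 / (1 + (norm y)\<^sup>2))\<^sup>2 else 0)"
proof -
  define q where "q = 1 + (norm y)\<^sup>2"
  have q: "q > 0" unfolding q_def by (simp add: add_pos_nonneg)
  have yy: "y \<bullet> y = q - 1" by (simp add: q_def power2_norm_eq_inner)
  have s2: "s * s = 1" using assms by auto
  have ax: "axis i 1 \<bullet> axis j (1 :: real) = (if i = j then 1 else 0)" by (simp add: inner_axis_axis)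
  have P: "pd k (stereo_inv s) y = ((2 / q) *\<^sub>R axis k 1 - (4 * y $ k / q\<^sup>2) *\<^sub>R y, s * (4 * y $ k / q\<^sup>2))" for k
    by (simp add: pd_eqI[OF stereo_inv_has_derivative] inner_axis flip: q_def)
  have I: "(a *\<^sub>R e - b *\<^sub>R y) \<bullet> (a *\<^sub>R f - c *\<^sub>R y) = a * a * (e \<bullet> f) - a * c * (e \<bullet> y) - b * a * (f \<bullet> y) + b * c * (y \<bullet> y)"
    for a b c e f by (simp add: inner_diff_left inner_diff_right inner_commute algebra_simps)
  have "met round_sphere s y $ i $ j =
    (2 / q) * (2 / q) * (axis i 1 \<bullet> axis j (1 :: real)) - 2 / q * (4 * y $ j / q\<^sup>2) * y $ i - 4 * y $ i / q\<^sup>2 * (2 / q) * y $ j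
      + 4 * y $ i / q\<^sup>2 * (4 * y $ j / q\<^sup>2) * (y \<bullet> y) + (s * s) * (4 * y $ i / q\<^sup>2) * (4 * y $ j / q\<^sup>2)"
    by (simp add: round_sphere_def P inner_Pair I inner_axis'[of _ _ y] del: times_divide_eq_left times_divide_eq_right)
  also have "\<dots> = (if i = j then (2 / q)\<^sup>2 else 0)"
    unfolding yy s2 ax using q by (simp add: divide_simps power2_eq_square) (simp add: algebra_simps)
  finally show ?thesis by (simp add: q_def)
qed

lemma product_chart_metric:
  assumes "s = 1 \<or> s = - 1"
  shows "met (riem_product (flat_torus v w) round_S4) (V, s) = torus_sphere_metric"
proof
  fix x :: "real^(2+4)"
  have "met round_sphere s y = (\<chi> i j. if i = j then (2 / (1 + (norm y)\<^sup>2))\<^sup>2 else 0)" for y :: "real^4"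
    using assms by (simp add: vec_eq_iff round_sphere_metric)
  then show "met (riem_product (flat_torus v w) round_S4) (V, s) x = torus_sphere_metric x"
    by (auto simp: riem_product_def flat_torus_def round_S4_def block_diag_def vec_eq_iff mat_def
        exp_double exp_conf_log split: sum.split)
qed

section \<open>Plane lattices and the flat torus\<close>

definition plane_det :: "real^2 \<Rightarrow> real^2 \<Rightarrow> real" where
  "plane_det a b = a $ 1 * b $ 2 - a $ 2 * b $ 1"

locale plane_lattice =
  fixes v w :: "real^2"
  assumes indep: "independent {v, w}" and distinct: "v \<noteq> w"
begin

lemma plane_det_nonzero: "plane_det v w \<noteq> 0"
proof
  assume D: "plane_det v w = 0"
  have c: "a = 0 \<and> b = 0" if "a *\<^sub>R v + b *\<^sub>R w = 0" for a b
  proof -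
    have "\<forall>c. (\<Sum>x\<in>{v, w}. c x *\<^sub>R x) = 0 \<longrightarrow> (\<forall>x\<in>{v, w}. c x = 0)"
      using indep unfolding independent_explicit by blast
    from this[THEN spec, of "\<lambda>x. if x = v then a else b"]
    have "\<forall>x\<in>{v, w}. (if x = v then a else b) = 0" using that distinct by simp
    then have "(if v = v then a else b) = 0" "(if w = v then a else b) = 0" by blast+
    then show ?thesis using distinct by simp
  qed
  have "w $ 2 *\<^sub>R v + (- v $ 2) *\<^sub>R w = 0" "w $ 1 *\<^sub>R v + (- v $ 1) *\<^sub>R w = 0"
    using D by (simp_all add: vec_eq_iff forall_2 plane_det_def algebra_simps)
  from this[THEN c] have "v = w" by (simp add: vec_eq_iff forall_2)
  with distinct show False by simp
qed

definition coord1 :: "real^2 \<Rightarrow> real" where "coord1 x = plane_det x w / plane_det v w"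
definition coord2 :: "real^2 \<Rightarrow> real" where "coord2 x = plane_det v x / plane_det v w"

text \<open>Cramer's rule.\<close>

lemma coords: "x = coord1 x *\<^sub>R v + coord2 x *\<^sub>R w"
  using plane_det_nonzero
  by (simp add: vec_eq_iff forall_2 coord1_def coord2_def divide_simps) (simp add: plane_det_def algebra_simps)

lemma coord_combination: "coord1 (a *\<^sub>R v + b *\<^sub>R w) = a" "coord2 (a *\<^sub>R v + b *\<^sub>R w) = b"
  using plane_det_nonzero
  by (simp_all add: coord1_def coord2_def divide_simps) (simp_all add: plane_det_def algebra_simps)

lemma coord_add: "coord1 (x + y) = coord1 x + coord1 y" "coord2 (x + y) = coord2 x + coord2 y"
  by (simp_all add: coord1_def coord2_def plane_det_def add_divide_distrib diff_divide_distrib algebra_simps)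

lemma continuous_coord: "continuous_on UNIV coord1" "continuous_on UNIV coord2"
  unfolding coord1_def coord2_def plane_det_def using plane_det_nonzero[unfolded plane_det_def] by (auto intro!: continuous_intros)

abbreviation L where "L \<equiv> torus_lattice v w"
abbreviation proj where "proj \<equiv> torus_proj v w"

lemma lattice_iff: "l \<in> L \<longleftrightarrow> coord1 l \<in> \<int> \<and> coord2 l \<in> \<int>"
proof
  assume "coord1 l \<in> \<int> \<and> coord2 l \<in> \<int>"
  then obtain m n where "coord1 l = of_int m" "coord2 l = of_int n" by (auto elim!: Ints_cases)
  then show "l \<in> L" using coords[of l] unfolding torus_lattice_def by auto
qed (auto simp: torus_lattice_def coord_combination)

lemma coord_zero [simp]: "coord1 0 = 0" "coord2 0 = 0"
  using coord_combination[of 0 0] by simp_all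

lemma coord_diff: "coord1 (x - y) = coord1 x - coord1 y" "coord2 (x - y) = coord2 x - coord2 y"
  using coord_add[of "x - y" y] by simp_all

lemma lattice_zero: "0 \<in> L" by (simp add: lattice_iff)
lemma lattice_add: "l \<in> L \<Longrightarrow> l' \<in> L \<Longrightarrow> l + l' \<in> L" by (simp add: lattice_iff coord_add)
lemma lattice_diff: "l \<in> L \<Longrightarrow> l' \<in> L \<Longrightarrow> l - l' \<in> L" by (simp add: lattice_iff coord_diff)

lemma proj_eq_iff: "proj x = proj y \<longleftrightarrow> x - y \<in> L"
proof
  assume "proj x = proj y"
  moreover have "x \<in> proj x" unfolding torus_proj_def using lattice_zero by (auto intro: image_eqI[of _ _ 0])
  ultimately show "x - y \<in> L" by (auto simp: torus_proj_def)
next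
  have sub: "proj x \<subseteq> proj y" if "x - y \<in> L" for x y
    unfolding torus_proj_def using lattice_add[OF that] by (force intro: image_eqI[of _ _ "x - y + _"])
  assume "x - y \<in> L"
  then have "x - y \<in> L" "y - x \<in> L" using lattice_diff[OF lattice_zero, of "x - y"] by auto
  then show "proj x = proj y" using sub by blast
qed

lemma proj_add_lattice: "l \<in> L \<Longrightarrow> proj (x + l) = proj x"
  by (simp add: proj_eq_iff)

text \<open>If \<open>l = m v + n w\<close>, then \<open>|m| |det (v, w)| = |det (l, w)| \<le> 2 |l| |w|\<close>, and likewise for \<open>n\<close>. For short
  \<open>l\<close> these integers are less than \<open>1\<close> in absolute value.\<close>

lemma lattice_separated: "\<exists>\<delta>>0. \<forall>l\<in>L. norm l < \<delta> \<longrightarrow> l = 0"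
proof -
  \<comment> \<open>The summand \<open>1\<close> keeps the denominator positive.\<close>
  define \<delta> where "\<delta> = \<bar>plane_det v w\<bar> / (2 * (norm v + norm w) + 1)"
  have pos: "2 * (norm v + norm w) + 1 > 0" by (simp add: add_nonneg_pos)
  have bound: "\<bar>plane_det a b\<bar> \<le> 2 * (norm a * norm b)" for a b
  proof -
    have "\<bar>a $ i * b $ j\<bar> \<le> norm a * norm b" for i j
      unfolding abs_mult by (intro mult_mono component_le_norm_cart) auto
    from this[of 1 2] this[of 2 1] show ?thesis unfolding plane_det_def by linarith
  qed
  have zero: "r = 0" if "r \<in> \<int>" "\<bar>r\<bar> * \<bar>plane_det v w\<bar> \<le> 2 * (norm l * c)" "norm l < \<delta>" "0 \<le> c" "c \<le> norm v + norm w"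
    for r l c
  proof -
    have "2 * (norm l * c) \<le> norm l * (2 * (norm v + norm w) + 1)"
    proof -
      have "norm l * c \<le> norm l * (norm v + norm w)" by (rule mult_left_mono[OF that(5) norm_ge_zero])
      moreover have "norm l * (2 * (norm v + norm w) + 1) = 2 * (norm l * (norm v + norm w)) + norm l"
        by (simp add: algebra_simps)
      ultimately show ?thesis using norm_ge_zero[of l] by linarith
    qed
    also have "\<dots> < \<bar>plane_det v w\<bar>"
      using that(3) pos by (simp add: \<delta>_def pos_less_divide_eq)
    finally have "\<bar>r\<bar> * \<bar>plane_det v w\<bar> < 1 * \<bar>plane_det v w\<bar>" using that(2) by simp
    then have "\<bar>r\<bar> < 1" by (simp only: mult_less_cancel_right)
    with that(1) show ?thesis using Ints_nonzero_abs_ge1 by force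
  qed
  have "l = 0" if l: "l \<in> L" "norm l < \<delta>" for l
  proof -
    have "\<bar>coord1 l\<bar> * \<bar>plane_det v w\<bar> = \<bar>plane_det l w\<bar>" "\<bar>coord2 l\<bar> * \<bar>plane_det v w\<bar> = \<bar>plane_det v l\<bar>"
      using plane_det_nonzero by (simp_all add: coord1_def coord2_def)
    then have "coord1 l = 0" "coord2 l = 0"
      using l bound[of l w] bound[of v l] zero[of "coord1 l" l "norm w"] zero[of "coord2 l" l "norm v"]
      by (auto simp: lattice_iff mult.commute)
    then show ?thesis using coords[of l] by simp
  qed
  moreover have "\<delta> > 0" using plane_det_nonzero pos by (simp add: \<delta>_def)
  ultimately show ?thesis by blast
qed

lemma proj_inj_on_balls: "\<exists>\<epsilon>>0. \<forall>x. inj_on proj (ball x \<epsilon>)"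
proof -
  obtain \<delta> where \<delta>: "\<delta> > 0" "\<And>l. l \<in> L \<Longrightarrow> norm l < \<delta> \<Longrightarrow> l = 0" using lattice_separated by blast
  have "y = z" if "y \<in> ball x (\<delta>/2)" "z \<in> ball x (\<delta>/2)" "proj y = proj z" for x y z
  proof -
    have "norm (y - z) < \<delta>"
      using that(1,2) dist_triangle_half_r[of x y \<delta> z] by (simp add: dist_norm)
    then show ?thesis using that(3) \<delta>(2)[of "y - z"] by (simp add: proj_eq_iff)
  qed
  then show ?thesis using \<delta>(1) by (intro exI[of _ "\<delta>/2"]) (auto simp: inj_on_def)
qed

text \<open>A strict fundamental domain: the half-open parallelogram meets each coset of the lattice exactly once.\<close>

definition cell :: "(real^2) set" where
  "cell = {x. 0 \<le> coord1 x \<and> coord1 x < 1 \<and> 0 \<le> coord2 x \<and> coord2 x < 1}"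

lemma cell_representative: "\<exists>!l. l \<in> L \<and> x + l \<in> cell"
proof
  let ?l = "of_int (- \<lfloor>coord1 x\<rfloor>) *\<^sub>R v + of_int (- \<lfloor>coord2 x\<rfloor>) *\<^sub>R w"
  show "?l \<in> L \<and> x + ?l \<in> cell"
    unfolding lattice_iff cell_def mem_Collect_eq coord_add[of x] coord_combination by (auto; linarith)
  fix l assume l: "l \<in> L \<and> x + l \<in> cell"
  have f: "r = of_int (- \<lfloor>y\<rfloor>)" if r: "r \<in> \<int>" "0 \<le> y + r" "y + r < 1" for r y :: real
  proof -
    obtain z where z: "r = of_int z" using r(1) by (auto elim: Ints_cases)
    have "\<lfloor>y\<rfloor> = - z" using r(2,3) z by (intro floor_unique) auto
    then show ?thesis using z by simp
  qed
  have "coord1 l = of_int (- \<lfloor>coord1 x\<rfloor>)" "coord2 l = of_int (- \<lfloor>coord2 x\<rfloor>)"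
    using l f[of "coord1 l" "coord1 x"] f[of "coord2 l" "coord2 x"]
    by (simp_all add: lattice_iff cell_def coord_add)
  then show "l = ?l" using coords[of l] by simp
qed

lemma cell_subset_compact: "\<exists>K. compact K \<and> cell \<subseteq> K"
proof -
  let ?K = "(\<lambda>(a, b). a *\<^sub>R v + b *\<^sub>R w) ` ({0..1} \<times> {0..1 :: real})"
  have "compact ?K"
    by (intro compact_continuous_image compact_Times compact_Icc) (auto intro!: continuous_intros simp: case_prod_beta)
  moreover have "cell \<subseteq> ?K"
  proof
    fix x assume "x \<in> cell"
    then show "x \<in> ?K" using coords[of x] by (intro image_eqI[of _ _ "(coord1 x, coord2 x)"]) (auto simp: cell_def)
  qed
  ultimately show ?thesis by blast
qed

end

section \<open>Saddle points of separable functions\<close>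

lemma frechet_eq_sum_pd:
  fixes f :: "real^'n::finite \<Rightarrow> real"
  assumes "f differentiable at x"
  shows "frechet_derivative f (at x) h = (\<Sum>i\<in>UNIV. h $ i * pd i f x)"
proof -
  have lin: "linear (frechet_derivative f (at x))"
    using differentiable_has_derivative[OF assms] has_derivative_linear by blast
  have "h = (\<Sum>i\<in>UNIV. h $ i *\<^sub>R axis i 1)"
    using basis_expansion[of h] by (simp add: scalar_mult_eq_scaleR)
  then have "frechet_derivative f (at x) h = frechet_derivative f (at x) (\<Sum>i\<in>UNIV. h $ i *\<^sub>R axis i 1)"
    by simp
  also have "\<dots> = (\<Sum>i\<in>UNIV. h $ i * pd i f x)"
    by (simp add: linear_sum[OF lin] linear_scale[OF lin] pd_def)
  finally show ?thesis .
qed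

lemma line_has_derivative:
  fixes f :: "real^'n::finite \<Rightarrow> real"
  assumes "f differentiable at (x + t *\<^sub>R h)"
  shows "((\<lambda>t. f (x + t *\<^sub>R h)) has_real_derivative (\<Sum>i\<in>UNIV. h $ i * pd i f (x + t *\<^sub>R h))) (at t)"
proof -
  have "((\<lambda>t. x + t *\<^sub>R h) has_derivative (\<lambda>r. r *\<^sub>R h)) (at t)"
    by (auto intro!: derivative_eq_intros)
  from has_derivative_compose[OF this differentiable_has_derivative[OF assms]]
  show ?thesis
    using linear_scale[OF has_derivative_linear[OF differentiable_has_derivative[OF assms]]]
    by (simp add: has_field_derivative_def frechet_eq_sum_pd[OF assms] mult.commute[of _ "sum _ _"] fun_eq_iff)
qed

lemma constant_along:
  fixes f :: "real^'n::finite \<Rightarrow> real"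
  assumes f: "\<And>x. f differentiable at x" and z: "\<And>i x. h $ i \<noteq> 0 \<Longrightarrow> pd i f x = 0"
  shows "f (x + h) = f x"
proof -
  have "((\<lambda>t. f (x + t *\<^sub>R h)) has_real_derivative 0) (at t)" for t
  proof -
    have "(\<Sum>i\<in>UNIV. h $ i * pd i f (x + t *\<^sub>R h)) = 0" by (intro sum.neutral) (use z in auto)
    with line_has_derivative[OF f, of x h t] show ?thesis by simp
  qed
  from DERIV_isconst_all[OF allI[OF this], of 1 0] show ?thesis by simp
qed

text \<open>For fixed \<open>h\<close> the function \<open>x \<mapsto> f (x + h) - f x\<close> has partial derivative \<open>\<partial>\<^sub>j f (x + h) - \<partial>\<^sub>j f x\<close>, which is
  zero in the directions of \<open>k\<close> since \<open>\<partial>\<^sub>j f\<close> is constant in the directions of \<open>h\<close>.\<close>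

lemma separable_of_mixed_zero:
  fixes f :: "real^'n::finite \<Rightarrow> real"
  assumes f: "\<And>x. f differentiable at x" "\<And>k x. pd k f differentiable at x"
    and z: "\<And>i j x. h $ i \<noteq> 0 \<Longrightarrow> k $ j \<noteq> 0 \<Longrightarrow> pd i (pd j f) x = 0"
  shows "f (x + h + k) - f (x + k) = f (x + h) - f x"
proof -
  define D where "D x = f (x + h) - f x" for x
  have sh: "((\<lambda>y. f (y + h)) has_derivative frechet_derivative f (at (x + h))) (at x)" for x
  proof -
    have "((\<lambda>y. y + h) has_derivative (\<lambda>y. y)) (at x)" by (auto intro!: derivative_eq_intros)
    from has_derivative_compose[OF this differentiable_has_derivative[OF f(1)]] show ?thesis .
  qed
  have dif: "(\<lambda>y. f (y + h)) differentiable at x" for x using sh differentiable_def by blast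
  have pdD: "pd j D x = pd j f (x + h) - pd j f x" for j x
    unfolding D_def pd_diff[OF dif f(1)] pd_eqI[OF sh] by (simp add: pd_def)
  have "D (x + k) = D x"
  proof (rule constant_along)
    show "D differentiable at x" for x unfolding D_def by (intro differentiable_diff dif f(1))
    show "pd j D x = 0" if "k $ j \<noteq> 0" for j x
      unfolding pdD using constant_along[OF f(2)[of j], of h x] z that by simp
  qed
  then show ?thesis by (simp add: D_def add_ac)
qed

lemma second_derivative_nonneg_at_min:
  fixes g g' :: "real \<Rightarrow> real"
  assumes g: "\<And>t. (g has_real_derivative g' t) (at t)" and g': "(g' has_real_derivative c) (at 0)"
    and min: "\<And>t. g 0 \<le> g t"
  shows "g' 0 = 0 \<and> 0 \<le> c"
proof -
  have 0: "g' 0 = 0"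
    by (rule DERIV_local_min[OF g zero_less_one]) (simp add: min)
  have "0 \<le> c"
  proof (rule ccontr)
    assume "\<not> 0 \<le> c"
    then obtain d where d: "d > 0" "\<And>h. 0 < h \<Longrightarrow> h < d \<Longrightarrow> g' (0 + h) < g' 0"
      using DERIV_neg_dec_right[OF g'] by force
    have "g (d/2) < g 0"
      by (rule DERIV_neg_imp_decreasing_open) (use d 0 g in \<open>auto intro!: exI continuous_at_imp_continuous_on DERIV_isCont\<close>)
    with min[of "d/2"] show False by simp
  qed
  with 0 show ?thesis by simp
qed

lemma pd_at_line_min:
  fixes f :: "real^'n::finite \<Rightarrow> real"
  assumes f: "\<And>x. f differentiable at x" "\<And>k x. pd k f differentiable at x"
    and min: "\<And>t. f x \<le> f (x + t *\<^sub>R axis k 1)"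
  shows "pd k f x = 0 \<and> 0 \<le> pd k (pd k f) x"
proof -
  have s: "(\<Sum>i\<in>UNIV. axis k 1 $ i * g i) = g k" for g :: "'n \<Rightarrow> real"
    by (simp add: axis_def mult_delta_left)
  have 1: "((\<lambda>t. f (x + t *\<^sub>R axis k 1)) has_real_derivative pd k f (x + t *\<^sub>R axis k 1)) (at t)" for t
    using line_has_derivative[OF f(1), of x "axis k 1" t] unfolding s .
  have 2: "((\<lambda>t. pd k f (x + t *\<^sub>R axis k 1)) has_real_derivative pd k (pd k f) x) (at 0)"
    using line_has_derivative[OF f(2), of k x "axis k 1" 0] unfolding s by simp
  from second_derivative_nonneg_at_min[OF 1 2] min show ?thesis by simp
qed

text \<open>The Einstein equation \<open>\<partial>\<^sub>i \<partial>\<^sub>j U = \<partial>\<^sub>i U \<partial>\<^sub>j U\<close> for mixed indices says that \<open>\<partial>\<^sub>i \<partial>\<^sub>j e\<^sup>-\<^sup>U = 0\<close>.\<close>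

lemma einstein_separable:
  fixes U :: "real^(2 + 4) \<Rightarrow> real"
  assumes U: "\<And>x. U differentiable at x" "\<And>k x. pd k U differentiable at x"
    and ein: "\<And>x i j. ricci (conf_model U) x i j = c * conf_model U x $ i $ j"
    and h: "snd_coords h = 0" and k: "fst_coords k = 0"
  shows "exp (- U (x + h + k)) - exp (- U (x + k)) = exp (- U (x + h)) - exp (- U x)"
proof (rule separable_of_mixed_zero)
  have mU: "(\<lambda>x. - U x) differentiable at x" for x by (intro differentiable_minus U)
  have 1: "pd j (\<lambda>x. exp (- U x)) = (\<lambda>x. - (exp (- U x) * pd j U x))" for j
    by (simp add: fun_eq_iff pd_exp mU pd_minus U)
  show "(\<lambda>x. exp (- U x)) differentiable at x" for x by (intro differentiable_exp_comp mU)
  show "pd j (\<lambda>x. exp (- U x)) differentiable at x" for j x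
    unfolding 1 by (intro differentiable_minus differentiable_mult differentiable_exp_comp mU U)
  fix i j x assume "h $ i \<noteq> 0" "k $ j \<noteq> 0"
  then have "sph i \<noteq> sph j"
    using h k by (cases i; cases j) (auto simp: snd_coords_def fst_coords_def vec_eq_iff)
  from einstein_mixed_hessian[OF U ein this]
  have m: "pd i (pd j U) x = pd i U x * pd j U x" .
  have "pd i (pd j (\<lambda>x. exp (- U x))) x = - (exp (- U x) * pd i (pd j U) x + (exp (- U x) * pd i (\<lambda>x. - U x) x) * pd j U x)"
    unfolding 1 by (simp add: pd_minus pd_mult differentiable_exp_comp mU U) (simp add: pd_exp pd_minus mU U)
  then show "pd i (pd j (\<lambda>x. exp (- U x))) x = 0"
    by (simp add: m pd_minus U)
qed

section \<open>Conformal Einstein metrics on the product\<close>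

definition join_coords :: "real^'m::finite \<Rightarrow> real^'n::finite \<Rightarrow> real^('m + 'n)" where
  "join_coords p y = (\<chi> i. case i of Inl a \<Rightarrow> p $ a | Inr b \<Rightarrow> y $ b)"

lemma join_coords_simps [simp]:
  "fst_coords (join_coords p y) = p" "snd_coords (join_coords p y) = y"
  "join_coords (fst_coords x) (snd_coords x) = x"
  by (auto simp: fst_coords_def snd_coords_def join_coords_def vec_eq_iff split: sum.split)

lemma continuous_join_coords:
  fixes p :: "real^'m::finite" and y :: "real^'n::finite"
  shows "continuous_on A (\<lambda>y :: real^'n. join_coords p y)" "continuous_on B (\<lambda>p :: real^'m. join_coords p y)"
proof -
  have "continuous_on A (\<lambda>y :: real^'n. case i of Inl a \<Rightarrow> p $ a | Inr b \<Rightarrow> y $ b)"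
    "continuous_on B (\<lambda>p :: real^'m. case i of Inl a \<Rightarrow> p $ a | Inr b \<Rightarrow> y $ b)" for i
    by (cases i; auto intro!: continuous_intros)+
  then show "continuous_on A (\<lambda>y :: real^'n. join_coords p y)" "continuous_on B (\<lambda>p :: real^'m. join_coords p y)"
    unfolding join_coords_def by (auto intro!: continuous_on_vec_lambda)
qed

text \<open>The two stereographic projections differ by the inversion in the unit sphere.\<close>

lemma stereo_inv_inversion:
  assumes "y \<noteq> 0"
  shows "stereo_inv s ((1 / (norm y)\<^sup>2) *\<^sub>R y) = stereo_inv (- s) y"
proof -
  define r where "r = norm y"
  have r: "r > 0" "norm ((1 / r\<^sup>2) *\<^sub>R y) = 1 / r"
    using assms by (simp_all add: r_def power2_eq_square)
  have p: "1 + r\<^sup>2 > 0" by (simp add: add_pos_nonneg)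
  show ?thesis
    unfolding stereo_inv_def r_def[symmetric] r(2) using r(1) p
    by (simp add: power_divide divide_simps) (simp add: algebra_simps)
qed

text \<open>The two closed unit discs cover the sphere: each chart maps its unit disc onto a closed hemisphere. So a
  continuous function on the sphere attains its extrema by compactness of the discs.\<close>

lemma stereo_inv_disc:
  assumes "s = 1 \<or> s = - 1"
  shows "\<exists>s' y'. (s' = 1 \<or> s' = - 1) \<and> y' \<in> cball 0 1 \<and> stereo_inv s y = stereo_inv s' y'"
proof (cases "norm y \<le> 1")
  case False
  then have "y \<noteq> 0" "norm ((1 / (norm y)\<^sup>2) *\<^sub>R y) \<le> 1"
    by (auto simp: power2_eq_square divide_simps)
  then show ?thesis
    using assms stereo_inv_inversion[of y "- s"]
    by (intro exI[of _ "- s"] exI[of _ "(1 / (norm y)\<^sup>2) *\<^sub>R y"]) auto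
qed (use assms in auto)

context plane_lattice
begin

abbreviation "M \<equiv> riem_product (flat_torus v w) round_S4"

text \<open>The function \<open>u\<close> on the product, pulled back to the universal cover of the torus and a chart of the
  sphere. Every point of \<open>\<real>\<^sup>6\<close> lies in a coordinate domain on which this is a coordinate expression of \<open>u\<close>, so
  local statements hold on all of \<open>\<real>\<^sup>6\<close>.\<close>

definition cover_lift :: "((real^2) set \<times> ((real^4) \<times> real) \<Rightarrow> real) \<Rightarrow> real \<Rightarrow> real^(2+4) \<Rightarrow> real" where
  "cover_lift u s x = u (proj (fst_coords x), stereo_inv s (snd_coords x))"

lemma cover_lift_differentiable:
  assumes "smooth_function M u" and s: "s = 1 \<or> s = - 1"
  shows "cover_lift u s differentiable at x" "pd k (cover_lift u s) differentiable at x"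
proof -
  obtain \<epsilon> where e: "\<epsilon> > 0" "inj_on proj (ball (fst_coords x) \<epsilon>)" using proj_inj_on_balls by blast
  define V where "V = ball (fst_coords x) \<epsilon>"
  have c: "(V, s) \<in> charts M"
    using e s by (simp add: riem_product_def flat_torus_def round_S4_def round_sphere_def V_def)
  define S where "S = pdom M (V, s)"
  have S: "S = fst_coords -` V"
    by (auto simp: S_def riem_product_def flat_torus_def round_S4_def round_sphere_def)
  have "continuous_on UNIV (fst_coords :: real^(2+4) \<Rightarrow> _)"
    using linear_continuous_on linear_conv_bounded_linear linear_fst_coords by blast
  then have op: "open S" unfolding S V_def by (intro open_vimage) auto
  have x: "x \<in> S" using e by (simp add: S V_def)
  have "Ck_on (Suc (Suc 0)) S (u \<circ> par M (V, s))"
    using assms(1) c unfolding smooth_function_def smooth_on_def S_def by blast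
  also have "u \<circ> par M (V, s) = cover_lift u s"
    by (simp add: fun_eq_iff riem_product_def flat_torus_def round_S4_def round_sphere_def cover_lift_def)
  finally have "cover_lift u s differentiable_on S" "pd k (cover_lift u s) differentiable_on S" by auto
  then show "cover_lift u s differentiable at x" "pd k (cover_lift u s) differentiable at x"
    using op x by (simp_all add: differentiable_on_eq_differentiable_at)
qed

lemma einstein_cover_lift:
  assumes "einstein (conformal_change u M)"
  shows "\<exists>c. \<forall>s x i j. s = 1 \<or> s = - 1 \<longrightarrow>
    ricci (conf_model (cover_lift u s)) x i j = c * conf_model (cover_lift u s) x $ i $ j"
proof -
  obtain c where c: "\<forall>\<alpha>\<in>charts (conformal_change u M). \<forall>x\<in>pdom (conformal_change u M) \<alpha>. \<forall>i j.
     ricci (met (conformal_change u M) \<alpha>) x i j = c * met (conformal_change u M) \<alpha> x $ i $ j"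
    using assms unfolding einstein_def by blast
  have "ricci (conf_model (cover_lift u s)) x i j = c * conf_model (cover_lift u s) x $ i $ j"
    if s: "s = 1 \<or> s = - 1" for s x i j
  proof -
    obtain \<epsilon> where e: "\<epsilon> > 0" "inj_on proj (ball (fst_coords x) \<epsilon>)" using proj_inj_on_balls by blast
    define V where "V = ball (fst_coords x) \<epsilon>"
    have ch: "(V, s) \<in> charts (conformal_change u M)"
      using e s by (simp add: conformal_change_def riem_product_def flat_torus_def round_S4_def round_sphere_def V_def)
    have x: "x \<in> pdom (conformal_change u M) (V, s)"
      using e by (simp add: conformal_change_def riem_product_def flat_torus_def round_S4_def round_sphere_def V_def)
    have "par M (V, s) x = (proj (fst_coords x), stereo_inv s (snd_coords x))" for x
      by (simp add: riem_product_def flat_torus_def round_S4_def round_sphere_def)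
    then have eq: "met (conformal_change u M) (V, s) = conf_model (cover_lift u s)"
      by (simp add: fun_eq_iff vec_eq_iff conformal_change_def product_chart_metric[OF s] cover_lift_def distrib_left flip: exp_add)
    from c[rule_format, OF ch x, of i j] show ?thesis unfolding eq .
  qed
  then show ?thesis by blast
qed

lemma not_conformally_einstein: "\<not> conformally_einstein M"
proof
  assume "conformally_einstein M"
  then obtain u where u: "smooth_function M u" "einstein (conformal_change u M)"
    unfolding conformally_einstein_def by blast
  obtain c where c: "\<And>s x i j. s = 1 \<or> s = - 1 \<Longrightarrow>
      ricci (conf_model (cover_lift u s)) x i j = c * conf_model (cover_lift u s) x $ i $ j"
    using einstein_cover_lift[OF u(2)] by blast
  note dif = cover_lift_differentiable[OF u(1)]
  have contU: "continuous_on A (cover_lift u s)" if "s = 1 \<or> s = - 1" for A s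
    using dif(1)[OF that] by (intro continuous_at_imp_continuous_on ballI differentiable_imp_continuous_within) auto
  have cont_snd: "continuous_on A (\<lambda>y. cover_lift u s (join_coords p y))" if "s = 1 \<or> s = - 1" for A s p
    by (rule continuous_on_compose2[OF contU[OF that, of UNIV]]) (auto intro: continuous_join_coords)
  have cont_fst: "continuous_on A (\<lambda>p. cover_lift u s (join_coords p y))" if "s = 1 \<or> s = - 1" for A s y
    by (rule continuous_on_compose2[OF contU[OF that, of UNIV]]) (auto intro: continuous_join_coords)

  have "\<exists>y\<^sub>0\<in>cball 0 1. \<forall>y\<in>cball 0 1. cover_lift u s (join_coords 0 y) \<le> cover_lift u s (join_coords 0 y\<^sub>0)"
    if "s = 1 \<or> s = - 1" for s
    by (rule continuous_attains_sup) (use cont_snd[OF that] in auto)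
  then obtain y\<^sub>m where y\<^sub>m: "\<And>s y. s = 1 \<or> s = - 1 \<Longrightarrow> y \<in> cball 0 1 \<Longrightarrow>
      cover_lift u s (join_coords 0 y) \<le> cover_lift u s (join_coords 0 (y\<^sub>m s))"
    by metis
  define a b where "a = y\<^sub>m 1" and "b = y\<^sub>m (- 1)"
  have a: "cover_lift u 1 (join_coords 0 y) \<le> cover_lift u 1 (join_coords 0 a)"
    and b: "cover_lift u (- 1) (join_coords 0 y) \<le> cover_lift u (- 1) (join_coords 0 b)" if "y \<in> cball 0 1" for y
    using y\<^sub>m[OF _ that] by (auto simp: a_def b_def)
  \<comment> \<open>The maximum of \<open>u\<close> on the fibre of the sphere over the base point of the torus, in a chart \<open>s\<close> around it.\<close>
  obtain s y\<^sub>0 where s: "s = 1 \<or> s = - 1"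
    and top: "\<And>s' y. s' = 1 \<or> s' = - 1 \<Longrightarrow> y \<in> cball 0 1 \<Longrightarrow> cover_lift u s' (join_coords 0 y) \<le> cover_lift u s (join_coords 0 y\<^sub>0)"
  proof (cases "cover_lift u 1 (join_coords 0 a) \<le> cover_lift u (- 1) (join_coords 0 b)")
    case True
    show ?thesis by (rule that[of "- 1" b]) (use a b True in \<open>auto intro: order_trans\<close>)
  next
    case False
    show ?thesis by (rule that[of 1 a]) (use a b False in \<open>fastforce+\<close>)
  qed
  have top': "cover_lift u s (join_coords 0 y) \<le> cover_lift u s (join_coords 0 y\<^sub>0)" for y
  proof -
    obtain s' y' where "s' = 1 \<or> s' = - 1" "y' \<in> cball 0 1" "stereo_inv s y = stereo_inv s' y'"
      using stereo_inv_disc[OF s, of y] by blast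
    then show ?thesis using top[of s' y'] by (simp add: cover_lift_def)
  qed

  \<comment> \<open>The minimum along the torus through that point; by periodicity it is attained on the closed cell.\<close>
  obtain K where K: "compact K" "cell \<subseteq> K" using cell_subset_compact by blast
  have "K \<noteq> {}" using cell_representative K(2) by fast
  then obtain p\<^sub>0 where p0: "\<And>p. p \<in> K \<Longrightarrow> cover_lift u s (join_coords p\<^sub>0 y\<^sub>0) \<le> cover_lift u s (join_coords p y\<^sub>0)"
    using continuous_attains_inf[OF K(1) _ cont_fst[OF s, of K y\<^sub>0]] by blast
  have bot: "cover_lift u s (join_coords p\<^sub>0 y\<^sub>0) \<le> cover_lift u s (join_coords p y\<^sub>0)" for p
  proof -
    obtain l where "l \<in> L" "p + l \<in> cell" using cell_representative by blast
    then show ?thesis using p0[of "p + l"] K(2) by (auto simp: cover_lift_def proj_add_lattice)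
  qed

  define z where "z = join_coords p\<^sub>0 y\<^sub>0"
  let ?U = "cover_lift u s"
  have torus: "?U z \<le> ?U (z + h)" if "snd_coords h = 0" for h
  proof -
    have "z + h = join_coords (p\<^sub>0 + fst_coords h) y\<^sub>0"
      using that by (auto simp: z_def join_coords_def fst_coords_def snd_coords_def vec_eq_iff split: sum.split)
    then show ?thesis using bot by (simp add: z_def)
  qed
  \<comment> \<open>Separability carries the maximum along the sphere from the base point of the torus to \<open>p\<^sub>0\<close>.\<close>
  have sphere: "?U (z + k) \<le> ?U z" if k: "fst_coords k = 0" for k
  proof -
    define x where "x = join_coords (0 :: real^2) y\<^sub>0"
    define h where "h = join_coords p\<^sub>0 (0 :: real^4)"
    have z: "z = x + h"
      by (auto simp: z_def x_def h_def join_coords_def vec_eq_iff split: sum.split)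
    have "x + k = join_coords 0 (y\<^sub>0 + snd_coords k)"
      using k by (auto simp: x_def join_coords_def fst_coords_def snd_coords_def vec_eq_iff split: sum.split)
    then have "?U (x + k) \<le> ?U x" using top' by (simp add: x_def)
    moreover have "exp (- ?U (x + h + k)) - exp (- ?U (x + k)) = exp (- ?U (x + h)) - exp (- ?U x)"
      by (rule einstein_separable[OF dif[OF s] c[OF s]]) (simp_all add: h_def k)
    ultimately show ?thesis unfolding z
      by (smt (verit) exp_le_cancel_iff)
  qed
  have T: "pd (Inl a) ?U z = 0 \<and> 0 \<le> pd (Inl a) (pd (Inl a) ?U) z" for a
    by (rule pd_at_line_min[OF dif[OF s]], rule torus) (simp add: snd_coords_def axis_def vec_eq_iff)
  have N: "pd k (\<lambda>x. - ?U x) = (\<lambda>x. - pd k ?U x)" for k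
    using dif[OF s] by (simp add: fun_eq_iff pd_minus)
  have "pd (Inr b) (\<lambda>x. - ?U x) z = 0 \<and> 0 \<le> pd (Inr b) (pd (Inr b) (\<lambda>x. - ?U x)) z" for b
  proof (rule pd_at_line_min)
    show "(\<lambda>x. - ?U x) differentiable at x" "pd k (\<lambda>x. - ?U x) differentiable at x" for k x
      using dif[OF s] by (simp_all add: N)
    show "- ?U z \<le> - ?U (z + t *\<^sub>R axis (Inr b) 1)" for t
      using sphere[of "t *\<^sub>R axis (Inr b) 1"] by (simp add: fst_coords_def axis_def vec_eq_iff)
  qed
  then have S: "pd (Inr b) ?U z = 0 \<and> pd (Inr b) (pd (Inr b) ?U) z \<le> 0" for b
    using dif[OF s] by (simp add: N pd_minus)
  show False
  proof (rule einstein_no_saddle[OF dif[OF s] c[OF s]])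
    show "pd k ?U z = 0" for k using T S by (cases k) auto
  qed (use T S in auto)
qed

end

section \<open>Lebesgue measure in block coordinates\<close>

lemma prod_Basis_cart: "(\<Prod>b\<in>Basis. f b) = (\<Prod>i\<in>UNIV. f (axis i 1 :: real^'n::finite))"
proof -
  have B: "(Basis :: (real^'n) set) = range (\<lambda>i. axis i 1)" by (auto simp: Basis_vec_def)
  have "inj (\<lambda>i. axis i 1 :: real^'n)" by (auto simp: inj_on_def axis_eq_axis)
  then show ?thesis unfolding B by (rule prod.reindex[unfolded o_def])
qed

lemma prod_sum_type: "(\<Prod>i\<in>UNIV. f i) = (\<Prod>a\<in>UNIV. f (Inl a)) * (\<Prod>b\<in>UNIV. f (Inr b))"
  for f :: "'m::finite + 'n::finite \<Rightarrow> real"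
  using prod.Plus[of "UNIV :: 'm set" "UNIV :: 'n set" f] by (simp add: o_def)

lemma continuous_join_coords_pair:
  "continuous_on A (\<lambda>z :: (real^'m::finite) \<times> (real^'n::finite). join_coords (fst z) (snd z))"
proof -
  have "continuous_on A (\<lambda>z :: (real^'m) \<times> (real^'n). case i of Inl a \<Rightarrow> fst z $ a | Inr b \<Rightarrow> snd z $ b)" for i
    by (cases i; auto intro!: continuous_intros)
  then show ?thesis unfolding join_coords_def by (auto intro!: continuous_on_vec_lambda)
qed

lemma join_coords_measurable [measurable]:
  "(\<lambda>z. join_coords (fst z) (snd z)) \<in> borel \<rightarrow>\<^sub>M borel"
  by (intro borel_measurable_continuous_onI continuous_join_coords_pair)

lemma lborel_join_coords:
  "distr (lborel \<Otimes>\<^sub>M lborel) borel (\<lambda>z :: (real^'m::finite) \<times> (real^'n::finite). join_coords (fst z) (snd z)) = lborel"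
proof (rule lborel_eqI[symmetric])
  fix l u :: "real^('m + 'n)"
  assume lu: "\<And>b. b \<in> Basis \<Longrightarrow> l \<bullet> b \<le> u \<bullet> b"
  have le: "l $ i \<le> u $ i" for i using lu[of "axis i 1"] by (simp add: inner_axis axis_in_Basis_iff)
  have le': "fst_coords l \<bullet> b \<le> fst_coords u \<bullet> b" if "b \<in> Basis" for b
    using that le by (auto simp: Basis_vec_def inner_axis fst_coords_def)
  have le'': "snd_coords l \<bullet> b \<le> snd_coords u \<bullet> b" if "b \<in> Basis" for b
    using that le by (auto simp: Basis_vec_def inner_axis snd_coords_def)
  have box: "(\<lambda>z. join_coords (fst z) (snd z)) -` box l u = box (fst_coords l) (fst_coords u) \<times> box (snd_coords l) (snd_coords u)"
    by (auto simp: mem_box_cart join_coords_def fst_coords_def snd_coords_def split: sum.split)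
      (metis sum.simps(5), metis sum.simps(5), metis sum.simps(6), metis sum.simps(6))
  have "emeasure (distr (lborel \<Otimes>\<^sub>M lborel) borel (\<lambda>z. join_coords (fst z) (snd z))) (box l u)
    = emeasure (lborel \<Otimes>\<^sub>M lborel) (box (fst_coords l) (fst_coords u) \<times> box (snd_coords l) (snd_coords u))"
    by (subst emeasure_distr) (auto simp: box lborel_prod space_pair_measure)
  also have "\<dots> = emeasure lborel (box (fst_coords l) (fst_coords u)) * emeasure lborel (box (snd_coords l) (snd_coords u))"
    by (rule lborel.emeasure_pair_measure_Times) auto
  also have "\<dots> = ennreal ((\<Prod>a\<in>UNIV. (u - l) $ Inl a) * (\<Prod>b\<in>UNIV. (u - l) $ Inr b))"
  proof -
    have "emeasure lborel (box (fst_coords l) (fst_coords u)) = ennreal (\<Prod>a\<in>UNIV. (u - l) $ Inl a)"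
      using emeasure_lborel_box[of "fst_coords l" "fst_coords u"] le'
      by (simp add: prod_Basis_cart inner_axis) (simp add: fst_coords_def)
    moreover have "emeasure lborel (box (snd_coords l) (snd_coords u)) = ennreal (\<Prod>b\<in>UNIV. (u - l) $ Inr b)"
      using emeasure_lborel_box[of "snd_coords l" "snd_coords u"] le''
      by (simp add: prod_Basis_cart inner_axis) (simp add: snd_coords_def)
    ultimately show ?thesis using le by (simp add: ennreal_mult prod_nonneg)
  qed
  also have "\<dots> = ennreal (\<Prod>b\<in>Basis. (u - l) \<bullet> b)"
    by (simp add: prod_Basis_cart inner_axis prod_sum_type)
  finally show "emeasure (distr (lborel \<Otimes>\<^sub>M lborel) borel (\<lambda>z. join_coords (fst z) (snd z))) (box l u) = ennreal (\<Prod>b\<in>Basis. (u - l) \<bullet> b)" .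
qed simp

lemma nn_integral_join_coords:
  fixes f :: "real^('m::finite + 'n::finite) \<Rightarrow> ennreal"
  assumes f [measurable]: "f \<in> borel_measurable borel"
  shows "(\<integral>\<^sup>+x. f x \<partial>lborel) = (\<integral>\<^sup>+p. \<integral>\<^sup>+y. f (join_coords p y) \<partial>lborel \<partial>lborel)"
    and "(\<integral>\<^sup>+x. f x \<partial>lborel) = (\<integral>\<^sup>+y. \<integral>\<^sup>+p. f (join_coords p y) \<partial>lborel \<partial>lborel)"
proof -
  have m: "(\<lambda>z. f (join_coords (fst z) (snd z))) \<in> borel_measurable (lborel \<Otimes>\<^sub>M lborel)"
    unfolding lborel_prod by measurable
  have "(\<integral>\<^sup>+x. f x \<partial>lborel) = (\<integral>\<^sup>+z. f (join_coords (fst z) (snd z)) \<partial>(lborel \<Otimes>\<^sub>M lborel))"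
    unfolding lborel_join_coords[symmetric] by (rule nn_integral_distr) (simp_all add: lborel_prod)
  also have "\<dots> = (\<integral>\<^sup>+p. \<integral>\<^sup>+y. f (join_coords p y) \<partial>lborel \<partial>lborel)"
    using lborel.nn_integral_fst[OF m] by simp
  finally show 1: "(\<integral>\<^sup>+x. f x \<partial>lborel) = (\<integral>\<^sup>+p. \<integral>\<^sup>+y. f (join_coords p y) \<partial>lborel \<partial>lborel)" .
  show "(\<integral>\<^sup>+x. f x \<partial>lborel) = (\<integral>\<^sup>+y. \<integral>\<^sup>+p. f (join_coords p y) \<partial>lborel \<partial>lborel)"
    unfolding 1 by (rule lborel_pair.Fubini'[symmetric]) (use m in \<open>simp add: case_prod_beta'\<close>)
qed

section \<open>The volume density of the sphere\<close>

definition sphere_density :: "real^4 \<Rightarrow> real" where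
  "sphere_density y = (2 / (1 + (norm y)\<^sup>2)) ^ 4"

lemma sphere_density_pos: "sphere_density y > 0"
proof -
  have "1 + (norm y)\<^sup>2 > 0" by (simp add: add_pos_nonneg)
  then show ?thesis by (simp add: sphere_density_def)
qed

lemma sphere_density_measurable [measurable]: "sphere_density \<in> borel_measurable borel"
  unfolding sphere_density_def by measurable

text \<open>This writes the density, a decreasing function of the radius \<open>r\<close>, as an integral over \<open>[r, \<infinity>)\<close>. By Fubini's
  theorem its integral over \<open>\<real>\<^sup>4\<close> is then a superposition of volumes of balls.\<close>

lemma radial_integral:
  assumes "r \<ge> 0"
  shows "(\<integral>\<^sup>+u. ennreal (128 * u / (1 + u\<^sup>2) ^ 5) * indicator {r..} u \<partial>lborel) = ennreal (16 / (1 + r\<^sup>2) ^ 4)"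
proof -
  have p: "1 + u\<^sup>2 \<noteq> 0" for u :: real by (metis add_pos_nonneg less_irrefl zero_le_power2 zero_less_one)
  have "(\<integral>\<^sup>+u. ennreal (128 * u / (1 + u\<^sup>2) ^ 5) * indicator {r..} u \<partial>lborel) = ennreal (0 - (- 16 / (1 + r\<^sup>2) ^ 4))"
  proof (rule nn_integral_FTC_atLeast)
    show "((\<lambda>u :: real. - 16 / (1 + u\<^sup>2) ^ 4) has_real_derivative 128 * u / (1 + u\<^sup>2) ^ 5) (at u)" for u
      using p[of u] by (auto intro!: derivative_eq_intros simp: divide_simps)
    show "((\<lambda>u :: real. - 16 / (1 + u\<^sup>2) ^ 4) \<longlongrightarrow> 0) at_top" by real_asymp
  qed (use assms in auto)
  then show ?thesis by simp
qed

lemma sphere_density_total: "(\<integral>\<^sup>+y. sphere_density y \<partial>lborel) = ennreal (8 * pi\<^sup>2 / 3)"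
proof -
  let ?k = "\<lambda>u. ennreal (128 * u / (1 + u\<^sup>2) ^ 5)"
  have p: "1 + u\<^sup>2 \<noteq> 0" for u :: real by (metis add_pos_nonneg less_irrefl zero_le_power2 zero_less_one)
  have "(\<integral>\<^sup>+y. sphere_density y \<partial>lborel) = (\<integral>\<^sup>+(y :: real^4). \<integral>\<^sup>+u. ?k u * indicator {norm y..} u \<partial>lborel \<partial>lborel)"
    by (intro nn_integral_cong) (simp add: radial_integral sphere_density_def power_divide)
  also have "\<dots> = (\<integral>\<^sup>+u. \<integral>\<^sup>+(y :: real^4). ?k u * indicator {norm y..} u \<partial>lborel \<partial>lborel)"
  proof (rule lborel_pair.Fubini')
    have [measurable]: "{z :: real \<times> (real^4). norm (snd z) \<le> fst z} \<in> sets (borel \<Otimes>\<^sub>M borel)"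
      unfolding borel_prod by (intro borel_closed closed_Collect_le continuous_intros)
    have "(\<lambda>z :: real \<times> (real^4). ?k (fst z) * indicator {z. norm (snd z) \<le> fst z} z) \<in> borel_measurable (borel \<Otimes>\<^sub>M borel)"
      by measurable
    also have "(\<lambda>z :: real \<times> (real^4). ?k (fst z) * indicator {z. norm (snd z) \<le> fst z} z) = (\<lambda>(u, y). ?k u * indicator {norm y..} u)"
      by (auto simp: fun_eq_iff indicator_def)
    finally show "(\<lambda>(u, y :: real^4). ?k u * indicator {norm y..} u) \<in> borel_measurable (lborel \<Otimes>\<^sub>M lborel)"
      by (simp add: lborel_prod borel_prod)
  qed
  also have "\<dots> = (\<integral>\<^sup>+u. ennreal (64 * pi\<^sup>2 * u ^ 5 / (1 + u\<^sup>2) ^ 5) * indicator {0..} u \<partial>lborel)"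
  proof (intro nn_integral_cong)
    fix u :: real
    have "(\<integral>\<^sup>+(y :: real^4). ?k u * indicator {norm y..} u \<partial>lborel) = (\<integral>\<^sup>+(y :: real^4). ?k u * indicator (cball 0 u) y \<partial>lborel)"
      by (intro nn_integral_cong) (auto simp: indicator_def)
    also have "\<dots> = ?k u * emeasure lborel (cball (0 :: real^4) u)"
      by (rule nn_integral_cmult_indicator) auto
    also have "\<dots> = ennreal (64 * pi\<^sup>2 * u ^ 5 / (1 + u\<^sup>2) ^ 5) * indicator {0..} u"
    proof (cases "u \<ge> 0")
      case True
      then have "?k u * emeasure lborel (cball (0 :: real^4) u) = ?k u * ennreal (pi\<^sup>2 / 2 * u ^ 4)"
        by (simp add: emeasure_cball eval_unit_ball_vol)
      also have "\<dots> = ennreal (128 * u / (1 + u\<^sup>2) ^ 5 * (pi\<^sup>2 / 2 * u ^ 4))"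
        by (rule ennreal_mult[symmetric]) (use True in auto)
      also have "128 * u / (1 + u\<^sup>2) ^ 5 * (pi\<^sup>2 / 2 * u ^ 4) = 64 * pi\<^sup>2 * u ^ 5 / (1 + u\<^sup>2) ^ 5"
        by (simp add: eval_nat_numeral)
      finally show ?thesis using True by simp
    qed auto
    finally show "(\<integral>\<^sup>+(y :: real^4). ?k u * indicator {norm y..} u \<partial>lborel) = ennreal (64 * pi\<^sup>2 * u ^ 5 / (1 + u\<^sup>2) ^ 5) * indicator {0..} u" .
  qed
  also have "\<dots> = ennreal (64 * pi\<^sup>2 / 24 - 0)"
  proof -
    \<comment> \<open>An antiderivative of \<open>u\<^sup>5 / (1 + u\<^sup>2)\<^sup>5\<close> that vanishes at \<open>0\<close>; it tends to \<open>1/24\<close> at infinity.\<close>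
    let ?F = "\<lambda>u :: real. 64 * pi\<^sup>2 * (u ^ 6 * (u\<^sup>2 + 4) / (24 * (1 + u\<^sup>2) ^ 4))"
    have "(\<integral>\<^sup>+u. ennreal (64 * pi\<^sup>2 * u ^ 5 / (1 + u\<^sup>2) ^ 5) * indicator {0..} u \<partial>lborel) = ennreal (64 * pi\<^sup>2 / 24 - ?F 0)"
    proof (rule nn_integral_FTC_atLeast)
      have "((\<lambda>u :: real. u ^ 6 * (u\<^sup>2 + 4) / (24 * (1 + u\<^sup>2) ^ 4)) has_real_derivative u ^ 5 / (1 + u\<^sup>2) ^ 5) (at u)" for u
        using p[of u] by (auto intro!: derivative_eq_intros simp: divide_simps) (simp add: eval_nat_numeral algebra_simps)
      from DERIV_cmult[OF this, of "64 * pi\<^sup>2"]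
      show "(?F has_real_derivative 64 * pi\<^sup>2 * u ^ 5 / (1 + u\<^sup>2) ^ 5) (at u)" for u by simp
      have "((\<lambda>u :: real. u ^ 6 * (u\<^sup>2 + 4) / (24 * (1 + u\<^sup>2) ^ 4)) \<longlongrightarrow> 1 / 24) at_top" by real_asymp
      from tendsto_mult_left[OF this, of "64 * pi\<^sup>2"]
      show "(?F \<longlongrightarrow> 64 * pi\<^sup>2 / 24) at_top" by simp
    qed auto
    then show ?thesis by simp
  qed
  finally show ?thesis by simp
qed

lemma inversion_has_derivative:
  fixes y :: "real^'n::finite"
  assumes "y \<noteq> 0"
  shows "((\<lambda>y. (1 / (norm y)\<^sup>2) *\<^sub>R y) has_derivative
    (\<lambda>h. (1 / (norm y)\<^sup>2) *\<^sub>R (h - (2 * (y \<bullet> h) / (y \<bullet> y)) *\<^sub>R y))) (at y)"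
proof -
  have y: "y \<bullet> y \<noteq> 0" using assms by simp
  have "((\<lambda>y. 1 / (y \<bullet> y)) has_derivative (\<lambda>h. - (2 * (y \<bullet> h) / (y \<bullet> y)\<^sup>2))) (at y)"
    using y by (auto intro!: derivative_eq_intros simp: inner_commute power2_eq_square divide_simps)
  from has_derivative_scaleR[OF this has_derivative_ident]
  show ?thesis unfolding power2_norm_eq_inner
    using y by (simp add: scaleR_diff_right power2_eq_square)
qed

text \<open>The derivative of the inversion is \<open>1/|y|\<^sup>2\<close> times the reflection in the hyperplane orthogonal to \<open>y\<close>.\<close>

lemma inversion_det:
  fixes y :: "real^'n::finite"
  assumes "y \<noteq> 0"
  shows "\<bar>det (matrix (\<lambda>h. (1 / (norm y)\<^sup>2) *\<^sub>R (h - (2 * (y \<bullet> h) / (y \<bullet> y)) *\<^sub>R y)))\<bar> = (1 / (norm y)\<^sup>2) ^ CARD('n)"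
proof -
  let ?R = "\<lambda>h. h - (2 * (y \<bullet> h) / (y \<bullet> y)) *\<^sub>R y"
  have y: "y \<bullet> y \<noteq> 0" using assms by simp
  have lin: "linear ?R"
    by (rule linearI) (simp_all add: inner_add_right algebra_simps add_divide_distrib)
  have "orthogonal_transformation ?R"
    unfolding orthogonal_transformation_def
  proof (intro conjI lin allI)
    show "?R a \<bullet> ?R b = a \<bullet> b" for a b
      using y by (simp add: inner_diff_left inner_diff_right inner_commute[of a y] divide_simps)
  qed
  then have R: "\<bar>det (matrix ?R)\<bar> = 1" by simp
  have "matrix (\<lambda>h. (1 / (norm y)\<^sup>2) *\<^sub>R ?R h) = matrix ((*\<^sub>R) (1 / (norm y)\<^sup>2)) ** matrix ?R"
    using matrix_compose[OF lin, of "(*\<^sub>R) (1 / (norm y)\<^sup>2)"] by (simp add: o_def)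
  then show ?thesis by (simp only: det_mul abs_mult R det_matrix_scaleR) (simp add: power_abs)
qed

lemma integrable_sphere_density: "integrable lborel sphere_density"
  by (rule integrableI_nn_integral_finite[OF _ _ sphere_density_total])
    (auto simp: less_imp_le[OF sphere_density_pos])

lemma sphere_density_inversion:
  assumes "y \<noteq> 0"
  shows "(1 / (norm y)\<^sup>2) ^ 4 * sphere_density ((1 / (norm y)\<^sup>2) *\<^sub>R y) = sphere_density y"
proof -
  define r where "r = norm y"
  have r: "r > 0" "norm ((1 / r\<^sup>2) *\<^sub>R y) = 1 / r"
    using assms by (simp_all add: r_def power2_eq_square)
  have p: "1 + r\<^sup>2 > 0" by (simp add: add_pos_nonneg)
  have "1 / r\<^sup>2 * (2 / (1 + (1 / r)\<^sup>2)) = 2 / (1 + r\<^sup>2)"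
    using r(1) p by (simp add: power_divide divide_simps)
  then show ?thesis
    unfolding sphere_density_def r_def[symmetric] r(2) power_mult_distrib[symmetric] by simp
qed

text \<open>Change of variables on the complement of the origin, which the inversion maps to itself; the Jacobian
  \<open>|y|\<^sup>-\<^sup>8\<close> is the quotient of the densities at \<open>y\<close> and at its image.\<close>

lemma sphere_density_inversion_invariant:
  assumes A [measurable]: "A \<in> sets borel"
  shows "(\<integral>\<^sup>+y. ennreal (sphere_density y) * indicator A ((1 / (norm y)\<^sup>2) *\<^sub>R y) \<partial>lborel)
    = (\<integral>\<^sup>+y. ennreal (sphere_density y) * indicator A y \<partial>lborel)"
proof -
  define inv where "inv y = (1 / (norm y)\<^sup>2) *\<^sub>R y" for y :: "real^4"
  define f where "f x = sphere_density x * indicator A x" for x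
  define S where "S = - {0 :: real^4}"
  have inv_inv: "inv (inv y) = y" if "y \<in> S" for y
    using that by (simp add: inv_def S_def power2_eq_square)
  have inv_S: "inv y \<in> S" if "y \<in> S" for y
    using that by (simp add: inv_def S_def)
  have img: "inv ` S = S" using inv_inv inv_S by force
  have inj: "inj_on inv S" using inv_inv by (rule inj_on_inverseI)
  let ?D = "\<lambda>y h. (1 / (norm y)\<^sup>2) *\<^sub>R (h - (2 * (y \<bullet> h) / (y \<bullet> y)) *\<^sub>R y)"
  have der: "(inv has_derivative ?D y) (at y within S)" if "y \<in> S" for y
    using inversion_has_derivative[of y] that has_derivative_at_withinI unfolding inv_def[abs_def] S_def by auto
  have "integrable lborel (\<lambda>x. indicator (A \<inter> S) x *\<^sub>R sphere_density x)"
    by (rule integrable_mult_indicator[OF _ integrable_sphere_density]) (simp add: S_def)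
  then have "integrable lebesgue (\<lambda>x. indicator S x *\<^sub>R f x)"
    by (subst integrable_completion) (auto simp: f_def S_def indicator_inter_arith mult_ac)
  then have f_int: "f absolutely_integrable_on S" by (simp add: set_integrable_def)
  have "(\<lambda>x. \<bar>det (matrix (?D x))\<bar> *\<^sub>R vec (f (inv x)) :: real^1) absolutely_integrable_on S \<and>
        integral S (\<lambda>x. \<bar>det (matrix (?D x))\<bar> *\<^sub>R vec (f (inv x))) = (vec (integral S f) :: real^1)
     \<longleftrightarrow> (\<lambda>x. vec (f x) :: real^1) absolutely_integrable_on (inv ` S) \<and>
        integral (inv ` S) (\<lambda>x. vec (f x)) = (vec (integral S f) :: real^1)"
    by (rule has_absolute_integral_change_of_variables[OF _ der inj]) (auto simp: S_def)
  then have 1: "(\<lambda>x. \<bar>det (matrix (?D x))\<bar> * f (inv x)) absolutely_integrable_on S"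
    and 2: "integral S (\<lambda>x. \<bar>det (matrix (?D x))\<bar> * f (inv x)) = integral S f"
    using f_int by (simp_all add: absolutely_integrable_on_1_iff integral_on_1_eq img)
  have eq: "\<bar>det (matrix (?D x))\<bar> * f (inv x) = sphere_density x * indicator A (inv x)" if "x \<in> S" for x
    using that inversion_det[of x] sphere_density_inversion[of x]
    by (simp add: f_def inv_def S_def mult.assoc[symmetric])
  have "(f has_integral integral S f) S"
    using f_int by (intro integrable_integral set_lebesgue_integral_eq_integral(1))
  from nn_integral_has_integral_lebesgue[OF _ this]
  have I1: "(\<integral>\<^sup>+x. ennreal (indicator S x * f x) \<partial>lborel) = ennreal (integral S f)"
    by (simp add: f_def less_imp_le[OF sphere_density_pos])
  have "((\<lambda>x. \<bar>det (matrix (?D x))\<bar> * f (inv x)) has_integral integral S f) S"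
    using integrable_integral[OF set_lebesgue_integral_eq_integral(1)[OF 1]] unfolding 2 .
  then have "((\<lambda>x. sphere_density x * indicator A (inv x)) has_integral integral S f) S"
    by (rule has_integral_eq[rotated]) (rule eq)
  from nn_integral_has_integral_lebesgue[OF _ this]
  have I2: "(\<integral>\<^sup>+x. ennreal (indicator S x * (sphere_density x * indicator A (inv x))) \<partial>lborel) = ennreal (integral S f)"
    by (simp add: less_imp_le[OF sphere_density_pos])
  have ae: "AE x in lborel. x \<in> S" using AE_lborel_singleton[of "0 :: real^4"] by (simp add: S_def)
  have "(\<integral>\<^sup>+y. ennreal (sphere_density y) * indicator A (inv y) \<partial>lborel)
    = (\<integral>\<^sup>+x. ennreal (indicator S x * (sphere_density x * indicator A (inv x))) \<partial>lborel)"
    by (rule nn_integral_cong_AE) (use ae in eventually_elim, auto simp: indicator_def)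
  also have "\<dots> = (\<integral>\<^sup>+x. ennreal (indicator S x * f x) \<partial>lborel)" using I1 I2 by simp
  also have "\<dots> = (\<integral>\<^sup>+y. ennreal (sphere_density y) * indicator A y \<partial>lborel)"
    by (rule nn_integral_cong_AE) (use ae in eventually_elim, auto simp: indicator_def f_def)
  finally show ?thesis unfolding inv_def .
qed

lemma sphere_chart_change:
  assumes A: "stereo_inv 1 -` A \<in> sets (borel :: (real^4) measure)" and s: "s = 1 \<or> s = - 1"
  shows "(\<integral>\<^sup>+y. ennreal (sphere_density y) * indicator A (stereo_inv s y) \<partial>lborel)
    = (\<integral>\<^sup>+y. ennreal (sphere_density y) * indicator A (stereo_inv 1 y) \<partial>lborel)"
proof (cases "s = 1")
  case False
  then have s: "s = - 1" using s by simp
  have "(\<integral>\<^sup>+y. ennreal (sphere_density y) * indicator A (stereo_inv s y) \<partial>lborel)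
    = (\<integral>\<^sup>+y. ennreal (sphere_density y) * indicator (stereo_inv 1 -` A) ((1 / (norm y)\<^sup>2) *\<^sub>R y) \<partial>lborel)"
    by (rule nn_integral_cong_AE, use AE_lborel_singleton[of "0 :: real^4"] in eventually_elim)
      (simp add: s stereo_inv_inversion indicator_def)
  also have "\<dots> = (\<integral>\<^sup>+y. ennreal (sphere_density y) * indicator A (stereo_inv 1 y) \<partial>lborel)"
    unfolding sphere_density_inversion_invariant[OF A] by (simp add: indicator_def)
  finally show ?thesis .
qed simp

section \<open>Riemannian volume measures\<close>

definition is_volume_measure :: "('a, 'n::finite, 'i) riem_mfd \<Rightarrow> 'a measure \<Rightarrow> bool" where
  "is_volume_measure M \<mu> \<longleftrightarrow> space \<mu> = points M \<and> sets \<mu> = borel_sets M \<and>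
     (\<forall>\<alpha>\<in>charts M. \<forall>B\<in>borel_sets M. B \<subseteq> par M \<alpha> ` pdom M \<alpha> \<longrightarrow>
        emeasure \<mu> B = (\<integral>\<^sup>+x\<in>chart_preimage M \<alpha> B. ennreal (sqrt (det (met M \<alpha> x))) \<partial>lborel))"

definition countable_atlas :: "('a, 'n::finite, 'i) riem_mfd \<Rightarrow> (nat \<Rightarrow> 'i) \<Rightarrow> bool" where
  "countable_atlas M A \<longleftrightarrow> range A \<subseteq> charts M \<and> points M \<subseteq> (\<Union>n. par M (A n) ` pdom M (A n)) \<and>
     (\<forall>n. par M (A n) ` pdom M (A n) \<in> borel_sets M)"

text \<open>The values on subsets of chart images are prescribed, and a countable atlas cuts every set into countably
  many such pieces.\<close>

lemma volume_measure_unique: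
  assumes A: "countable_atlas M A" and \<mu>: "is_volume_measure M \<mu>" and \<nu>: "is_volume_measure M \<nu>"
  shows "\<mu> = \<nu>"
proof (rule measure_eqI)
  show sets: "sets \<mu> = sets \<nu>" using \<mu> \<nu> by (simp add: is_volume_measure_def)
  fix X assume X: "X \<in> sets \<mu>"
  define D where "D = disjointed (\<lambda>n. par M (A n) ` pdom M (A n))"
  have D: "D n \<in> sets \<mu>" "D n \<in> sets \<nu>" for n
  proof -
    have "range (\<lambda>n. par M (A n) ` pdom M (A n)) \<subseteq> sets \<mu>"
      using A \<mu> by (auto simp: countable_atlas_def is_volume_measure_def)
    from sets.range_disjointed_sets[OF this] show "D n \<in> sets \<mu>" unfolding D_def by blast
    then show "D n \<in> sets \<nu>" using sets by simp
  qed
  have disj: "disjoint_family (\<lambda>n. X \<inter> D n)"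
    using disjoint_family_disjointed[of "\<lambda>n. par M (A n) ` pdom M (A n)"] unfolding D_def disjoint_family_on_def by blast
  have "X \<subseteq> points M" using X \<mu> sets.sets_into_space[OF X] by (simp add: is_volume_measure_def)
  then have U: "(\<Union>n. X \<inter> D n) = X"
    using A unfolding D_def countable_atlas_def by (simp add: UN_disjointed_eq flip: Int_UN_distrib) blast
  have eq: "emeasure \<mu> (X \<inter> D n) = emeasure \<nu> (X \<inter> D n)" for n
  proof -
    have 1: "X \<inter> D n \<subseteq> par M (A n) ` pdom M (A n)" using disjointed_subset D_def by fastforce
    have 2: "X \<inter> D n \<in> borel_sets M" using sets.Int[OF X D(1)[of n]] \<mu> by (simp add: is_volume_measure_def)
    have 3: "A n \<in> charts M" using A by (auto simp: countable_atlas_def)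
    show ?thesis using \<mu> \<nu> 1 2 3 by (simp add: is_volume_measure_def)
  qed
  have r: "range (\<lambda>n. X \<inter> D n) \<subseteq> sets \<mu>" "range (\<lambda>n. X \<inter> D n) \<subseteq> sets \<nu>"
    using X D sets by auto
  have "emeasure \<mu> X = (\<Sum>n. emeasure \<mu> (X \<inter> D n))"
    by (simp only: suminf_emeasure[OF r(1) disj] U)
  also have "\<dots> = emeasure \<nu> X"
    by (simp only: eq suminf_emeasure[OF r(2) disj] U)
  finally show "emeasure \<mu> X = emeasure \<nu> X" .
qed

lemma volume_measure_eqI:
  assumes "countable_atlas M A" "is_volume_measure M \<mu>"
  shows "volume_measure M = \<mu>"
  unfolding volume_measure_def
  using assms volume_measure_unique[OF assms(1)]
  by (intro the_equality) (auto simp: is_volume_measure_def)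

lemma borel_sets_sigma_algebra:
  assumes dom: "\<And>\<alpha>. \<alpha> \<in> charts M \<Longrightarrow> pdom M \<alpha> \<in> sets borel"
    and par: "\<And>\<alpha> x. \<alpha> \<in> charts M \<Longrightarrow> x \<in> pdom M \<alpha> \<Longrightarrow> par M \<alpha> x \<in> points M"
  shows "sigma_algebra (points M) (borel_sets M)"
proof (rule sigma_algebra_iff2[THEN iffD2], intro conjI ballI allI impI)
  show "borel_sets M \<subseteq> Pow (points M)" by (auto simp: borel_sets_def)
  show "{} \<in> borel_sets M" by (simp add: borel_sets_def chart_preimage_def)
  fix B assume B: "B \<in> borel_sets M"
  have "chart_preimage M \<alpha> (points M - B) = pdom M \<alpha> - chart_preimage M \<alpha> B" if "\<alpha> \<in> charts M" for \<alpha>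
    using par[OF that] by (auto simp: chart_preimage_def)
  with B dom show "points M - B \<in> borel_sets M" by (auto simp: borel_sets_def)
next
  fix B :: "nat \<Rightarrow> _" assume "range B \<subseteq> borel_sets M"
  moreover have "chart_preimage M \<alpha> (\<Union>i. B i) = (\<Union>i. chart_preimage M \<alpha> (B i))" for \<alpha>
    by (auto simp: chart_preimage_def)
  ultimately show "(\<Union>i. B i) \<in> borel_sets M" by (auto simp: borel_sets_def)
qed

text \<open>To find the volume measure, it suffices to have one global parametrization \<open>\<Phi>\<close> by a measure on
  Euclidean space that reproduces the prescribed values. A chart of full measure or a
  fundamental domain provides one.\<close>

lemma volume_measure_pushforward:
  fixes M :: "('a, 'n::finite, 'i) riem_mfd" and \<kappa> :: "(real^'n) measure"
  assumes A: "countable_atlas M A"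
    and dom: "\<And>\<alpha>. \<alpha> \<in> charts M \<Longrightarrow> pdom M \<alpha> \<in> sets borel"
    and par: "\<And>\<alpha> x. \<alpha> \<in> charts M \<Longrightarrow> x \<in> pdom M \<alpha> \<Longrightarrow> par M \<alpha> x \<in> points M"
    and \<kappa>: "sets \<kappa> = sets borel" and \<Phi>: "\<And>x. \<Phi> x \<in> points M"
    and meas: "\<And>B. B \<in> borel_sets M \<Longrightarrow> \<Phi> -` B \<in> sets borel"
    and eq: "\<And>\<alpha> B. \<alpha> \<in> charts M \<Longrightarrow> B \<in> borel_sets M \<Longrightarrow> B \<subseteq> par M \<alpha> ` pdom M \<alpha> \<Longrightarrow>
      emeasure \<kappa> (\<Phi> -` B) = (\<integral>\<^sup>+x\<in>chart_preimage M \<alpha> B. ennreal (sqrt (det (met M \<alpha> x))) \<partial>lborel)"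
  shows "space (volume_measure M) = points M" "measure (volume_measure M) (points M) = measure \<kappa> UNIV"
proof -
  define N where "N = sigma (points M) (borel_sets M)"
  have sub: "borel_sets M \<subseteq> Pow (points M)" by (auto simp: borel_sets_def)
  have N: "space N = points M" "sets N = borel_sets M"
    using sigma_algebra.sets_measure_of_eq[OF borel_sets_sigma_algebra[OF dom par]] sub
    by (auto simp: N_def space_measure_of_conv)
  have sp: "space \<kappa> = UNIV" using sets_eq_imp_space_eq[OF \<kappa>] by simp
  have \<Phi>m: "\<Phi> \<in> \<kappa> \<rightarrow>\<^sub>M N"
    by (rule measurableI) (use \<Phi> meas N sp \<kappa> in auto)
  have "emeasure (distr \<kappa> N \<Phi>) B = emeasure \<kappa> (\<Phi> -` B)" if "B \<in> borel_sets M" for B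
    using that by (simp add: emeasure_distr[OF \<Phi>m] N sp)
  then have "is_volume_measure M (distr \<kappa> N \<Phi>)"
    unfolding is_volume_measure_def using N eq by simp
  from volume_measure_eqI[OF A this] have V: "volume_measure M = distr \<kappa> N \<Phi>" .
  show "space (volume_measure M) = points M" by (simp add: V N)
  have "points M \<in> sets N" using sets.top[of N] N by simp
  moreover have "\<Phi> -` points M = UNIV" using \<Phi> by auto
  ultimately show "measure (volume_measure M) (points M) = measure \<kappa> UNIV"
    by (simp add: V measure_distr[OF \<Phi>m] sp)
qed

section \<open>The area of the torus\<close>

context plane_lattice
begin

lemma countable_lattice: "countable L"
proof -
  have "L = (\<lambda>(m, n). of_int m *\<^sub>R v + of_int n *\<^sub>R w) ` UNIV"
    by (auto simp: torus_lattice_def)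
  then show ?thesis by simp
qed

lemma cell_measurable [measurable]: "cell \<in> sets borel"
proof -
  have [measurable]: "coord1 \<in> borel_measurable borel" "coord2 \<in> borel_measurable borel"
    using continuous_coord by (auto intro: borel_measurable_continuous_onI)
  show ?thesis unfolding cell_def by measurable
qed

lemma emeasure_lborel_translate:
  assumes "X \<in> sets borel"
  shows "emeasure lborel ((\<lambda>x :: real^2. x + c) -` X) = emeasure lborel X"
proof -
  have "emeasure (distr lborel borel ((+) c)) X = emeasure lborel ((\<lambda>x. x + c) -` X)"
    using assms by (subst emeasure_distr) (auto simp: add.commute intro: arg_cong[where f = "emeasure lborel"])
  then show ?thesis by (simp add: lborel_distr_plus)
qed

text \<open>Both sets are fundamental domains for the cosets that belong to \<open>B\<close>. Cutting one of them along the translates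
  of the other and moving the pieces by lattice vectors turns it into the other.\<close>

lemma emeasure_fundamental_domains:
  assumes V: "V \<in> sets borel" and inj: "inj_on proj V" and B: "proj -` B \<in> sets borel" "B \<subseteq> proj ` V"
  shows "emeasure lborel (cell \<inter> proj -` B) = emeasure lborel (V \<inter> proj -` B)"
proof -
  note [measurable] = V B(1)
  have tr [measurable]: "(\<lambda>x. x + l) -` X \<in> sets borel" if "X \<in> sets borel" for X and l :: "real^2"
    using measurable_sets[of "\<lambda>x. x + l" borel borel X] that by simp
  define P where "P l = (V \<inter> proj -` B) \<inter> (\<lambda>x. x + l) -` cell" for l
  define Q where "Q l = (cell \<inter> proj -` B) \<inter> (\<lambda>x. x + (- l)) -` V" for l
  have Ps: "P l \<in> sets lborel" and Qs: "Q l \<in> sets lborel" for l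
    unfolding P_def Q_def using V by (auto intro!: sets.Int tr B cell_measurable)
  have "V \<inter> proj -` B = (\<Union>l\<in>L. P l)"
    using cell_representative unfolding P_def by fast
  moreover have "cell \<inter> proj -` B = (\<Union>l\<in>L. Q l)"
  proof -
    have "\<exists>l\<in>L. x + (- l) \<in> V" if x: "x \<in> proj -` B" for x
    proof -
      obtain y where "y \<in> V" "proj x = proj y" using x B(2) by auto
      then show ?thesis by (intro bexI[of _ "x - y"]) (auto simp: proj_eq_iff)
    qed
    then show ?thesis unfolding Q_def by blast
  qed
  moreover have "emeasure lborel (\<Union>l\<in>L. P l) = (\<integral>\<^sup>+l. emeasure lborel (P l) \<partial>count_space L)"
  proof (rule emeasure_UN_countable[OF Ps countable_lattice])
    show "disjoint_family_on P L"
      unfolding disjoint_family_on_def P_def using cell_representative by fast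
  qed
  moreover have "emeasure lborel (\<Union>l\<in>L. Q l) = (\<integral>\<^sup>+l. emeasure lborel (Q l) \<partial>count_space L)"
  proof (rule emeasure_UN_countable[OF Qs countable_lattice])
    have "l = l'" if "l \<in> L" "l' \<in> L" "x + - l \<in> V" "x + - l' \<in> V" for l l' x
    proof -
      have "x - l - (x - l') \<in> L" using lattice_diff[OF that(2,1)] by simp
      then have "proj (x - l) = proj (x - l')" unfolding proj_eq_iff .
      then have "x - l = x - l'" using inj_onD[OF inj] that(3,4) by simp
      then show ?thesis by simp
    qed
    then show "disjoint_family_on Q L" unfolding disjoint_family_on_def Q_def by blast
  qed
  moreover have "(\<integral>\<^sup>+l. emeasure lborel (P l) \<partial>count_space L) = (\<integral>\<^sup>+l. emeasure lborel (Q l) \<partial>count_space L)"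
  proof (rule nn_integral_cong)
    fix l assume "l \<in> space (count_space L)"
    then have l: "l \<in> L" by simp
    have "P l = (\<lambda>x. x + l) -` Q l"
      using proj_add_lattice[OF l] by (auto simp: P_def Q_def)
    then show "emeasure lborel (P l) = emeasure lborel (Q l)" using emeasure_lborel_translate[of "Q l" l] Qs by simp
  qed
  ultimately show ?thesis by simp
qed

lemma open_saturation: "open V \<Longrightarrow> open (proj -` proj ` V)"
proof -
  assume V: "open V"
  have "proj -` proj ` V = (\<Union>l\<in>L. (\<lambda>x. l + x) ` V)"
  proof (intro set_eqI iffI)
    fix x assume "x \<in> proj -` proj ` V"
    then obtain y where "y \<in> V" "proj x = proj y" by auto
    then show "x \<in> (\<Union>l\<in>L. (\<lambda>x. l + x) ` V)"
      by (intro UN_I[of "x - y"] image_eqI[of _ _ y]) (auto simp: proj_eq_iff)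
  next
    fix x assume "x \<in> (\<Union>l\<in>L. (\<lambda>x. l + x) ` V)"
    then obtain l y where "l \<in> L" "y \<in> V" "x = y + l" by (auto simp: add.commute)
    then show "x \<in> proj -` proj ` V" by (simp add: proj_add_lattice)
  qed
  then show "open (proj -` proj ` V)" using V by (auto intro: open_translation)
qed

text \<open>Balls of a fixed small radius about the points of a countable dense set.\<close>

lemma countable_torus_charts:
  "\<exists>V :: nat \<Rightarrow> (real^2) set. (\<forall>n. open (V n) \<and> inj_on proj (V n)) \<and> (\<Union>n. V n) = UNIV"
proof -
  obtain \<epsilon> where e: "\<epsilon> > 0" "\<And>x. inj_on proj (ball x \<epsilon>)" using proj_inj_on_balls by blast
  obtain D :: "(real^2) set" where D: "countable D" "\<And>X. open X \<Longrightarrow> X \<noteq> {} \<Longrightarrow> \<exists>d\<in>D. d \<in> X"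
    using countable_dense_exists by blast
  have cover: "\<exists>d\<in>D. x \<in> ball d \<epsilon>" for x
    using D(2)[of "ball x \<epsilon>"] e(1) by (auto simp: dist_commute)
  then have "D \<noteq> {}" by blast
  then have "range (from_nat_into D) = D" using D(1) by (rule range_from_nat_into)
  with cover e show ?thesis
    by (intro exI[of _ "\<lambda>n. ball (from_nat_into D n) \<epsilon>"]) (auto, metis rangeE)
qed

lemma torus_measurable_preimage:
  assumes B: "B \<in> borel_sets (flat_torus v w)"
  shows "proj -` B \<in> sets borel"
proof -
  obtain V where V: "\<And>n :: nat. open (V n) \<and> inj_on proj (V n)" "(\<Union>n. V n) = UNIV"
    using countable_torus_charts by blast
  have "proj -` B = (\<Union>n. chart_preimage (flat_torus v w) (V n) B)"
    using V(2) by (auto simp: chart_preimage_def flat_torus_def)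
  moreover have "chart_preimage (flat_torus v w) (V n) B \<in> sets borel" for n
    using B V(1)[of n] by (auto simp: borel_sets_def flat_torus_def)
  ultimately show ?thesis by auto
qed

lemma riem_volume_torus: "riem_volume (flat_torus v w) = measure lborel cell"
proof -
  let ?T = "flat_torus v w"
  obtain V where V: "\<And>n :: nat. open (V n) \<and> inj_on proj (V n)" "(\<Union>n. V n) = UNIV"
    using countable_torus_charts by blast
  have img: "proj ` U \<in> borel_sets ?T" if "open U" for U
  proof -
    have "chart_preimage ?T W (proj ` U) = W \<inter> proj -` proj ` U" for W
      by (auto simp: chart_preimage_def flat_torus_def)
    then show ?thesis using open_saturation[OF that]
      by (auto simp: borel_sets_def flat_torus_def[of v w])
  qed
  have atlas: "countable_atlas ?T V"
    unfolding countable_atlas_def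
  proof (intro conjI allI)
    show "range V \<subseteq> charts ?T" using V(1) by (auto simp: flat_torus_def)
    show "points ?T \<subseteq> (\<Union>n. par ?T (V n) ` pdom ?T (V n))" using V(2) by (auto simp: flat_torus_def) blast
    show "par ?T (V n) ` pdom ?T (V n) \<in> borel_sets ?T" for n using img V(1) by (simp add: flat_torus_def)
  qed
  let ?\<kappa> = "density lborel (indicator cell) :: (real^2) measure"
  have "measure (volume_measure ?T) (points ?T) = measure ?\<kappa> UNIV"
  proof (rule volume_measure_pushforward(2)[OF atlas])
    fix U B assume U: "U \<in> charts ?T" and B: "B \<in> borel_sets ?T" "B \<subseteq> par ?T U ` pdom ?T U"
    have o: "open U" "inj_on proj U" using U by (auto simp: flat_torus_def)
    note [measurable] = torus_measurable_preimage[OF B(1)]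
    have "emeasure ?\<kappa> (proj -` B) = emeasure lborel (cell \<inter> proj -` B)"
      by (subst emeasure_density) (auto simp flip: indicator_inter_arith)
    also have "\<dots> = emeasure lborel (U \<inter> proj -` B)"
      by (rule emeasure_fundamental_domains) (use o B in \<open>auto simp: flat_torus_def\<close>)
    also have "U \<inter> proj -` B = chart_preimage ?T U B"
      by (auto simp: chart_preimage_def flat_torus_def)
    also have "emeasure lborel (chart_preimage ?T U B) = (\<integral>\<^sup>+x\<in>chart_preimage ?T U B. ennreal (sqrt (det (met ?T U x))) \<partial>lborel)"
      using B(1) U by (simp add: flat_torus_def[of v w] borel_sets_def)
    finally show "emeasure ?\<kappa> (proj -` B) = (\<integral>\<^sup>+x\<in>chart_preimage ?T U B. ennreal (sqrt (det (met ?T U x))) \<partial>lborel)" .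
  qed (use torus_measurable_preimage in \<open>auto simp: flat_torus_def\<close>)
  also have "\<dots> = measure lborel cell"
    by (simp add: measure_def emeasure_density)
  finally show ?thesis by (simp add: riem_volume_def)
qed

end

section \<open>The volume of the product and its total \<open>L\<^sub>1\<close>\<close>

lemma snd_coords_measurable [measurable]: "snd_coords \<in> borel \<rightarrow>\<^sub>M borel"
  by (intro borel_measurable_continuous_onI linear_continuous_on linear_conv_bounded_linear[THEN iffD1] linear_snd_coords)

lemma fst_coords_measurable [measurable]: "fst_coords \<in> borel \<rightarrow>\<^sub>M borel"
  by (intro borel_measurable_continuous_onI linear_continuous_on linear_conv_bounded_linear[THEN iffD1] linear_fst_coords)

lemma norm_stereo_inv:
  assumes "s = 1 \<or> s = - 1"
  shows "norm (stereo_inv s y) = 1"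
proof -
  define q where "q = y \<bullet> y"
  have q: "1 + q > 0" by (simp add: q_def add_pos_nonneg)
  have s2: "s\<^sup>2 = 1" using assms by auto
  have n: "(norm y)\<^sup>2 = q" by (simp add: q_def power2_norm_eq_inner)
  have "(norm (stereo_inv s y))\<^sup>2 = stereo_inv s y \<bullet> stereo_inv s y"
    by (rule power2_norm_eq_inner)
  also have "\<dots> = (2 / (1 + q))\<^sup>2 * q + s\<^sup>2 * ((q - 1) / (1 + q))\<^sup>2"
    unfolding stereo_inv_def inner_Pair n by (simp add: power2_eq_square flip: q_def)
  also have "\<dots> = 1"
    unfolding s2 using q by (simp add: power_divide divide_simps) (simp add: power2_eq_square algebra_simps)
  finally show ?thesis using norm_ge_zero[of "stereo_inv s y"] by (simp add: power2_eq_1_iff)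
qed

lemma stereo_inv_surj:
  fixes p :: "(real^'n::finite) \<times> real"
  assumes "norm p = 1" and s: "s = 1 \<or> s = - 1" and ne: "snd p \<noteq> s"
  shows "p \<in> range (stereo_inv s)"
proof -
  obtain a t where p: "p = (a, t)" by (cases p)
  have s2: "s * s = 1" using s by auto
  have at: "(norm a)\<^sup>2 + t\<^sup>2 = 1" using assms(1) by (simp add: p norm_Pair)
  \<comment> \<open>Stereographic projection from \<open>(0, s)\<close> sends \<open>(a, t)\<close> to \<open>a / (1 - s t)\<close>.\<close>
  define c where "c = 1 - s * t"
  have c: "c \<noteq> 0" using ne s by (auto simp: c_def p)
  have n: "1 + (norm ((1 / c) *\<^sub>R a))\<^sup>2 = 2 / c"
  proof -
    have "c * c + (norm a)\<^sup>2 = 1 - 2 * (s * t) + (s * s) * t\<^sup>2 + (norm a)\<^sup>2"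
      by (simp add: c_def algebra_simps power2_eq_square)
    also have "\<dots> = 2 * c" using at by (simp add: s2 c_def)
    finally have "c * c + (norm a)\<^sup>2 = 2 * c" .
    then show ?thesis using c by (simp add: power_mult_distrib power_divide power2_eq_square divide_simps)
  qed
  have "s * (((norm ((1 / c) *\<^sub>R a))\<^sup>2 - 1) / (1 + (norm ((1 / c) *\<^sub>R a))\<^sup>2)) = s * (1 - c)"
  proof -
    have "(norm ((1 / c) *\<^sub>R a))\<^sup>2 = 2 / c - 1" using n by simp
    then show ?thesis unfolding n using c by (simp only:) (simp add: divide_simps)
  qed
  also have "\<dots> = t" using s2 by (simp add: c_def mult.assoc[symmetric])
  finally have "stereo_inv s ((1 / c) *\<^sub>R a) = p"
    unfolding stereo_inv_def n using c by (simp add: p)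
  then show ?thesis by (metis rangeI)
qed

text \<open>Only the pole from which one projects is missed by a stereographic chart, so the preimage is everything or
  the complement of the origin.\<close>

lemma stereo_inv_range_preimage:
  assumes "s = 1 \<or> s = - 1" "s' = 1 \<or> s' = - 1"
  shows "stereo_inv s' -` range (stereo_inv s) \<in> sets (borel :: (real^'n::finite) measure)"
proof -
  have "- {0} \<subseteq> stereo_inv s' -` range (stereo_inv s :: real^'n \<Rightarrow> _)"
  proof
    fix y :: "real^'n" assume "y \<in> - {0}"
    then have "stereo_inv s' y = stereo_inv (- s') ((1 / (norm y)\<^sup>2) *\<^sub>R y)"
      using stereo_inv_inversion[of y "- s'"] by simp
    moreover have "s = s' \<or> s = - s'" using assms by auto
    ultimately show "y \<in> stereo_inv s' -` range (stereo_inv s)" by (metis rangeI vimageI)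
  qed
  moreover have "T \<in> {UNIV, - {0}}" if "- {0} \<subseteq> T" for T :: "(real^'n) set"
  proof -
    have "- T \<subseteq> {0}" using that by blast
    then have "- T = {} \<or> - T = {0}" by (rule subset_singletonD)
    then have "- (- T) = - {} \<or> - (- T) = - {0}" by (elim disjE) (simp_all only: simp_thms)
    then show ?thesis by simp
  qed
  ultimately have "stereo_inv s' -` range (stereo_inv s :: real^'n \<Rightarrow> _) \<in> {UNIV, - {0}}" by blast
  then show ?thesis by auto
qed

context plane_lattice
begin

lemma par_product: "par M (V, s) x = (proj (fst_coords x), stereo_inv s (snd_coords x))"
  by (simp add: riem_product_def flat_torus_def round_S4_def round_sphere_def)

lemma pdom_product: "pdom M (V, s) = fst_coords -` V"
  by (auto simp: riem_product_def flat_torus_def round_S4_def round_sphere_def)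

lemma charts_product: "charts M = {V. open V \<and> inj_on proj V} \<times> {1, - 1}"
  by (simp add: riem_product_def flat_torus_def round_S4_def round_sphere_def)

lemma points_product: "points M = range proj \<times> sphere 0 1"
  by (simp add: riem_product_def flat_torus_def round_S4_def round_sphere_def)

lemma chart_preimage_product: "chart_preimage M (V, s) B =
    {x. fst_coords x \<in> V \<and> (proj (fst_coords x), stereo_inv s (snd_coords x)) \<in> B}"
  by (auto simp: chart_preimage_def par_product pdom_product)

lemma countable_atlas_product: "\<exists>A. countable_atlas M A"
proof -
  obtain V where V: "\<And>n :: nat. open (V n) \<and> inj_on proj (V n)" "(\<Union>n. V n) = UNIV"
    using countable_torus_charts by blast
  \<comment> \<open>Even numbers enumerate the charts with \<open>s = 1\<close>, odd ones those with \<open>s = - 1\<close>.\<close>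
  define A where "A n = (V (n div 2), if even n then 1 else - 1 :: real)" for n :: nat
  have "countable_atlas M A"
    unfolding countable_atlas_def
  proof (intro conjI allI)
    show "range A \<subseteq> charts M" using V(1) by (auto simp: charts_product A_def)
    show "points M \<subseteq> (\<Union>n. par M (A n) ` pdom M (A n))"
    proof
      fix z assume "z \<in> points M"
      then obtain x p where z: "z = (proj x, p)" "norm p = 1" by (auto simp: points_product)
      obtain s :: real where s: "s = 1 \<or> s = - 1" "snd p \<noteq> s" by (metis one_neq_neg_one)
      then obtain y where y: "p = stereo_inv s y" using stereo_inv_surj[OF z(2)] by blast
      obtain n where n: "x \<in> V n" using V(2) by blast
      have "A (if s = 1 then 2 * n else 2 * n + 1) = (V n, s)" using s(1) by (auto simp: A_def)
      moreover have "z \<in> par M (V n, s) ` pdom M (V n, s)"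
        using n by (intro image_eqI[of _ _ "join_coords x y"]) (simp_all add: par_product pdom_product z y)
      ultimately have "z \<in> par M (A (if s = 1 then 2 * n else 2 * n + 1)) ` pdom M (A (if s = 1 then 2 * n else 2 * n + 1))"
        by (simp only:)
      then show "z \<in> (\<Union>n. par M (A n) ` pdom M (A n))" by (rule UN_I[OF UNIV_I])
    qed
    fix n
    obtain U s where U: "A n = (U, s)" "open U" and s: "s = 1 \<or> s = - 1" using V(1) by (simp add: A_def)
    have img: "par M (A n) ` pdom M (A n) = proj ` U \<times> range (stereo_inv s :: real^4 \<Rightarrow> _)"
    proof
      show "proj ` U \<times> range (stereo_inv s :: real^4 \<Rightarrow> _) \<subseteq> par M (A n) ` pdom M (A n)"
      proof
        fix z assume "z \<in> proj ` U \<times> range (stereo_inv s :: real^4 \<Rightarrow> _)"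
        then have "fst z \<in> proj ` U" "snd z \<in> range (stereo_inv s :: real^4 \<Rightarrow> _)" by (simp_all add: mem_Times_iff)
        then obtain x y where "x \<in> U" "fst z = proj x" "snd z = stereo_inv s y" by blast
        then show "z \<in> par M (A n) ` pdom M (A n)"
          unfolding U by (intro image_eqI[of _ _ "join_coords x y"]) (simp_all add: par_product pdom_product prod_eq_iff)
      qed
    qed (auto simp: U par_product pdom_product)
    have "chart_preimage M (W, s') (proj ` U \<times> range (stereo_inv s :: real^4 \<Rightarrow> _)) \<in> sets borel"
      if "open W" "s' = 1 \<or> s' = - 1" for W s'
    proof -
      have [measurable]: "proj -` proj ` U \<in> sets borel" "W \<in> sets borel"
        "stereo_inv s' -` range (stereo_inv s :: real^4 \<Rightarrow> _) \<in> sets (borel :: (real^4) measure)"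
        using open_saturation[OF U(2)] that stereo_inv_range_preimage[OF s that(2)] by auto
      have "chart_preimage M (W, s') (proj ` U \<times> range (stereo_inv s :: real^4 \<Rightarrow> _)) =
        fst_coords -` (W \<inter> proj -` proj ` U) \<inter> snd_coords -` (stereo_inv s' -` range (stereo_inv s :: real^4 \<Rightarrow> _))"
        by (auto simp: chart_preimage_product)
      also have "\<dots> \<in> sets borel"
        using measurable_sets[OF fst_coords_measurable, of "W \<inter> proj -` proj ` U"]
          measurable_sets[OF snd_coords_measurable, of "stereo_inv s' -` range (stereo_inv s :: real^4 \<Rightarrow> _)"]
        by (intro sets.Int) simp_all
      finally show ?thesis .
    qed
    then show "par M (A n) ` pdom M (A n) \<in> borel_sets M"
      unfolding img using norm_stereo_inv[OF s] by (auto simp: borel_sets_def charts_product points_product)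
  qed
  then show ?thesis by blast
qed

lemma product_measurable_preimage:
  assumes B: "B \<in> borel_sets M" and s: "s = 1 \<or> s = - 1"
  shows "{x. (proj (fst_coords x), stereo_inv s (snd_coords x)) \<in> B} \<in> sets borel"
proof -
  obtain V where V: "\<And>n :: nat. open (V n) \<and> inj_on proj (V n)" "(\<Union>n. V n) = UNIV"
    using countable_torus_charts by blast
  have "{x. (proj (fst_coords x), stereo_inv s (snd_coords x)) \<in> B} = (\<Union>n. chart_preimage M (V n, s) B)"
    using V(2) by (auto simp: chart_preimage_product)
  moreover have "chart_preimage M (V n, s) B \<in> sets borel" for n
    using B V(1)[of n] s by (auto simp: borel_sets_def charts_product)
  ultimately show ?thesis by auto
qed

lemma volume_density_product:
  assumes "s = 1 \<or> s = - 1"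
  shows "sqrt (det (met M (V, s) x)) = sphere_density (snd_coords x)"
proof -
  have "det (torus_sphere_metric x) = (\<Prod>i\<in>(UNIV :: (2 + 4) set). exp (2 * (sph i * conf_log x)))"
    by (subst det_diagonal) auto
  also have "\<dots> = exp (2 * conf_log x) ^ 4"
    by (simp add: prod_sum_type)
  also have "\<dots> = (sphere_density (snd_coords x))\<^sup>2"
    by (simp add: sphere_density_def exp_double exp_conf_log flip: power_mult)
  finally show ?thesis
    unfolding product_chart_metric[OF assms] using sphere_density_pos[of "snd_coords x"] by simp
qed

text \<open>The measure \<open>\<kappa>\<close> is the product density on \<open>cell \<times> \<real>\<^sup>4\<close> in the chart \<open>s = 1\<close>. To compare with the chart
  \<open>(V, s)\<close>, integrate first over the sphere and change the stereographic chart for a fixed point of the torus;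
  then integrate first over the torus and exchange \<open>cell\<close> for \<open>V\<close> at a fixed point of the sphere.\<close>

lemma volume_product:
  "space (volume_measure M) = points M" (is ?space)
  "measure (volume_measure M) (points M) = 8 * pi\<^sup>2 / 3 * riem_volume (flat_torus v w)" (is ?measure)
proof -
  obtain A where A: "countable_atlas M A" using countable_atlas_product by blast
  define \<kappa> where "\<kappa> = density lborel (\<lambda>x :: real^(2+4). indicator cell (fst_coords x) * ennreal (sphere_density (snd_coords x)))"
  have \<kappa>: "emeasure \<kappa> X = (\<integral>\<^sup>+p. \<integral>\<^sup>+y. indicator cell p * ennreal (sphere_density y) * indicator X (join_coords p y) \<partial>lborel \<partial>lborel)"
    if [measurable]: "X \<in> sets borel" for X
  proof -
    have "emeasure \<kappa> X = (\<integral>\<^sup>+x. indicator cell (fst_coords x) * ennreal (sphere_density (snd_coords x)) * indicator X x \<partial>lborel)"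
      unfolding \<kappa>_def by (rule emeasure_density) (auto simp: that)
    also have "\<dots> = (\<integral>\<^sup>+p. \<integral>\<^sup>+y. indicator cell (fst_coords (join_coords p y)) * ennreal (sphere_density (snd_coords (join_coords p y))) * indicator X (join_coords p y) \<partial>lborel \<partial>lborel)"
      by (rule nn_integral_join_coords(1)) measurable
    finally show ?thesis by simp
  qed
  define \<Phi> where "\<Phi> x = (proj (fst_coords x), stereo_inv 1 (snd_coords x))" for x :: "real^(2+4)"
  have pre: "\<Phi> -` B \<in> sets borel" if "B \<in> borel_sets M" for B
    using product_measurable_preimage[OF that, of 1] by (simp add: \<Phi>_def vimage_def)
  have eq: "emeasure \<kappa> (\<Phi> -` B) = (\<integral>\<^sup>+x\<in>chart_preimage M \<alpha> B. ennreal (sqrt (det (met M \<alpha> x))) \<partial>lborel)"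
    if \<alpha>: "\<alpha> \<in> charts M" and B: "B \<in> borel_sets M" "B \<subseteq> par M \<alpha> ` pdom M \<alpha>" for \<alpha> B
  proof -
    obtain V s where V: "\<alpha> = (V, s)" "open V" "inj_on proj V" and s: "s = 1 \<or> s = - 1"
      using \<alpha> by (auto simp: charts_product)
    define E where "E r = {x. (proj (fst_coords x), stereo_inv r (snd_coords x)) \<in> B}" for r
    have E [measurable]: "E 1 \<in> sets borel" "E s \<in> sets borel"
      using product_measurable_preimage[OF B(1)] s by (auto simp: E_def)
    have Ej: "join_coords p y \<in> E r \<longleftrightarrow> (proj p, stereo_inv r y) \<in> B" for p y r by (simp add: E_def)
    have sec1 [measurable]: "{y. (proj p, stereo_inv 1 y) \<in> B} \<in> sets borel" for p
    proof -
      have "(\<lambda>y :: real^4. join_coords p y) -` E 1 \<inter> space borel \<in> sets borel"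
        by (rule measurable_sets[OF borel_measurable_continuous_onI[OF continuous_join_coords(1)] E(1)])
      then show ?thesis by (simp add: Ej vimage_def)
    qed
    have sec2 [measurable]: "{p. (proj p, stereo_inv s y) \<in> B} \<in> sets borel" for y
    proof -
      have "(\<lambda>p :: real^2. join_coords p y) -` E s \<inter> space borel \<in> sets borel"
        by (rule measurable_sets[OF borel_measurable_continuous_onI[OF continuous_join_coords(2)] E(2)])
      then show ?thesis by (simp add: Ej vimage_def)
    qed
    have mV [measurable]: "V \<in> sets borel" using V(2) by simp
    have swap: "(\<integral>\<^sup>+p. \<integral>\<^sup>+y. indicator C p * ennreal (sphere_density y) * indicator (E s) (join_coords p y) \<partial>lborel \<partial>lborel)
      = (\<integral>\<^sup>+y. ennreal (sphere_density y) * emeasure lborel (C \<inter> {p. (proj p, stereo_inv s y) \<in> B}) \<partial>lborel)"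
      and whole: "(\<integral>\<^sup>+x. indicator C (fst_coords x) * ennreal (sphere_density (snd_coords x)) * indicator (E s) x \<partial>lborel)
      = (\<integral>\<^sup>+y. ennreal (sphere_density y) * emeasure lborel (C \<inter> {p. (proj p, stereo_inv s y) \<in> B}) \<partial>lborel)"
      if [measurable]: "C \<in> sets borel" for C :: "(real^2) set"
    proof -
      let ?f = "\<lambda>x :: real^(2+4). indicator C (fst_coords x) * ennreal (sphere_density (snd_coords x)) * indicator (E s) x"
      have m: "?f \<in> borel_measurable borel" by measurable
      have "(\<integral>\<^sup>+p. ?f (join_coords p y) \<partial>lborel) = ennreal (sphere_density y) * emeasure lborel (C \<inter> {p. (proj p, stereo_inv s y) \<in> B})" for y
      proof -
        have "(\<integral>\<^sup>+p. ?f (join_coords p y) \<partial>lborel) = (\<integral>\<^sup>+p. ennreal (sphere_density y) * indicator (C \<inter> {p. (proj p, stereo_inv s y) \<in> B}) p \<partial>lborel)"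
          by (intro nn_integral_cong) (simp add: indicator_def Ej)
        also have "\<dots> = ennreal (sphere_density y) * emeasure lborel (C \<inter> {p. (proj p, stereo_inv s y) \<in> B})"
          by (rule nn_integral_cmult_indicator) (simp add: sec2 that)
        finally show ?thesis .
      qed
      then show w: "(\<integral>\<^sup>+x. ?f x \<partial>lborel) = (\<integral>\<^sup>+y. ennreal (sphere_density y) * emeasure lborel (C \<inter> {p. (proj p, stereo_inv s y) \<in> B}) \<partial>lborel)"
        by (simp only: nn_integral_join_coords(2)[OF m])
      show "(\<integral>\<^sup>+p. \<integral>\<^sup>+y. indicator C p * ennreal (sphere_density y) * indicator (E s) (join_coords p y) \<partial>lborel \<partial>lborel)
      = (\<integral>\<^sup>+y. ennreal (sphere_density y) * emeasure lborel (C \<inter> {p. (proj p, stereo_inv s y) \<in> B}) \<partial>lborel)"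
        unfolding w[symmetric] nn_integral_join_coords(1)[OF m] by simp
    qed
    have "\<Phi> -` B = E 1" by (auto simp: \<Phi>_def E_def)
    then have "emeasure \<kappa> (\<Phi> -` B) = (\<integral>\<^sup>+p. \<integral>\<^sup>+y. indicator cell p * ennreal (sphere_density y) * indicator (E 1) (join_coords p y) \<partial>lborel \<partial>lborel)"
      by (simp add: \<kappa>)
    also have "\<dots> = (\<integral>\<^sup>+p. \<integral>\<^sup>+y. indicator cell p * ennreal (sphere_density y) * indicator (E s) (join_coords p y) \<partial>lborel \<partial>lborel)"
    proof (rule nn_integral_cong)
      fix p
      have "(\<integral>\<^sup>+y. ennreal (sphere_density y) * indicator {q. (proj p, q) \<in> B} (stereo_inv s y) \<partial>lborel)
        = (\<integral>\<^sup>+y. ennreal (sphere_density y) * indicator {q. (proj p, q) \<in> B} (stereo_inv 1 y) \<partial>lborel)"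
        by (rule sphere_chart_change[OF _ s]) (use sec1[of p] in \<open>simp add: vimage_def\<close>)
      then show "(\<integral>\<^sup>+y. indicator cell p * ennreal (sphere_density y) * indicator (E 1) (join_coords p y) \<partial>lborel)
        = (\<integral>\<^sup>+y. indicator cell p * ennreal (sphere_density y) * indicator (E s) (join_coords p y) \<partial>lborel)"
        by (cases "p \<in> cell") (simp_all add: indicator_def Ej)
    qed
    also have "\<dots> = (\<integral>\<^sup>+y. ennreal (sphere_density y) * emeasure lborel (cell \<inter> {p. (proj p, stereo_inv s y) \<in> B}) \<partial>lborel)"
      by (rule swap) simp
    also have "\<dots> = (\<integral>\<^sup>+y. ennreal (sphere_density y) * emeasure lborel (V \<inter> {p. (proj p, stereo_inv s y) \<in> B}) \<partial>lborel)"
    proof (rule nn_integral_cong)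
      fix y
      have "emeasure lborel (cell \<inter> proj -` {t. (t, stereo_inv s y) \<in> B}) = emeasure lborel (V \<inter> proj -` {t. (t, stereo_inv s y) \<in> B})"
        by (rule emeasure_fundamental_domains[OF mV V(3)])
          (use sec2[of y] B(2) in \<open>auto simp: vimage_def V(1) par_product pdom_product\<close>)
      then show "ennreal (sphere_density y) * emeasure lborel (cell \<inter> {p. (proj p, stereo_inv s y) \<in> B})
        = ennreal (sphere_density y) * emeasure lborel (V \<inter> {p. (proj p, stereo_inv s y) \<in> B})"
        by (simp add: vimage_def)
    qed
    also have "\<dots> = (\<integral>\<^sup>+x. indicator V (fst_coords x) * ennreal (sphere_density (snd_coords x)) * indicator (E s) x \<partial>lborel)"
      by (rule whole[symmetric]) simp
    also have "\<dots> = (\<integral>\<^sup>+x\<in>chart_preimage M \<alpha> B. ennreal (sqrt (det (met M \<alpha> x))) \<partial>lborel)"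
      unfolding V(1) volume_density_product[OF s]
      by (intro nn_integral_cong) (simp add: indicator_def chart_preimage_product E_def)
    finally show ?thesis .
  qed
  have 1: "pdom M \<alpha> \<in> sets borel" if "\<alpha> \<in> charts M" for \<alpha>
  proof -
    have "fst_coords -` V \<in> sets (borel :: (real^(2+4)) measure)" if "open V" for V :: "(real^2) set"
      using measurable_sets[OF fst_coords_measurable, of V] that by simp
    then show ?thesis using that by (auto simp: charts_product pdom_product)
  qed
  have 2: "par M \<alpha> x \<in> points M" if "\<alpha> \<in> charts M" for \<alpha> x
    using that by (auto simp: charts_product par_product points_product norm_stereo_inv)
  have 3: "sets \<kappa> = sets borel" by (simp add: \<kappa>_def)
  have 4: "\<Phi> x \<in> points M" for x by (auto simp: \<Phi>_def points_product norm_stereo_inv)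
  show ?space by (rule volume_measure_pushforward(1)[OF A 1 2 3 4 pre eq])
  have "emeasure \<kappa> UNIV = (\<integral>\<^sup>+p. indicator cell p * ennreal (8 * pi\<^sup>2 / 3) \<partial>lborel)"
    by (simp add: \<kappa> nn_integral_cmult sphere_density_total)
  also have "\<dots> = ennreal (8 * pi\<^sup>2 / 3) * emeasure lborel cell"
    by (subst mult.commute, rule nn_integral_cmult_indicator) simp
  finally have "measure \<kappa> UNIV = 8 * pi\<^sup>2 / 3 * measure lborel cell"
    by (simp add: measure_def enn2real_mult)
  moreover have "measure (volume_measure M) (points M) = measure \<kappa> UNIV"
    by (rule volume_measure_pushforward(2)[OF A 1 2 3 4 pre eq])
  ultimately show ?measure by (simp add: riem_volume_torus)
qed

lemma L1_product:
  assumes "p \<in> points M"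
  shows "L1 M p = - 36"
proof -
  obtain \<alpha> x where c: "\<alpha> \<in> charts M" "x \<in> pdom M \<alpha>" "par M \<alpha> x = p"
    using countable_atlas_product assms unfolding countable_atlas_def by blast
  have L: "L1_coord (met M \<alpha>) x = - 36" if "\<alpha> \<in> charts M" for \<alpha> x
    using that by (auto simp: charts_product product_chart_metric L1_coord_model)
  show ?thesis
    unfolding L1_def by (rule the_equality) (use L c in auto)
qed

lemma total_L1_product: "total_L1 M = - 96 * pi\<^sup>2 * riem_volume (flat_torus v w)"
proof -
  have "total_L1 M = (\<integral>p. - 36 \<partial>volume_measure M)"
    unfolding total_L1_def by (rule Bochner_Integration.integral_cong) (simp_all add: volume_product(1) L1_product)
  also have "\<dots> = - 36 * measure (volume_measure M) (points M)"
    by (simp add: volume_product(1))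
  finally show ?thesis by (simp add: volume_product(2))
qed

end

theorem proposition1p2:
  fixes v w :: "real^2"
  assumes "independent {v, w}" and "v \<noteq> w"
  shows "total_L1 (riem_product (flat_torus v w) round_S4)
           = - 96 * pi\<^sup>2 * riem_volume (flat_torus v w)
         \<and> \<not> conformally_einstein (riem_product (flat_torus v w) round_S4)"
proof -
  interpret plane_lattice v w by unfold_locales (use assms in auto)
  show ?thesis using total_L1_product not_conformally_einstein by blast
qed

end
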